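(* Let $\mathfrak{M}=(\mathcal{Q},\mathcal{W},\mathcal{R})$ be an hereditary abelian model structure on an abelian category $\mathcal{A}$. For $A\in\mathcal{A}$ cofibrant, $B\in\mathcal{A}$ fibrant, and every $n\in\mathbb{Z}$, there are natural isomorphisms $$\ell\mathrm{Ext}^n_{\mathfrak{M}}(A,B)\cong \mathrm{Ho}(\mathfrak{M})(\Omega^nA,B)\cong \mathrm{Ho}(\mathfrak{M})(A,\Sigma^nB)\cong r\mathrm{Ext}^n_{\mathfrak{M}}(A,B).$$
   Context: $\mathrm{Ext}^n_{\mathcal{A}}$ denotes Yoneda Ext in $\mathcal{A}$. A cotorsion pair is a pair of classes $(\mathcal{X},\mathcal{Y})$ with $\mathcal{Y}=\{Y:\mathrm{Ext}^1_{\mathcal{A}}(X,Y)=0\ \forall X\in\mathcal{X}\}$ and $\mathcal{X}=\{X:\mathrm{Ext}^1_{\mathcal{A}}(X,Y)=0\ \forall Y\in\mathcal{Y}\}$. It is complete if every object $A$ admits short exact sequences $0\to Y\to X\to A\to0$ and $0\to A\to Y'\to X'\to 0$ with $X,X'\in\mathcal{X}$, $Y,Y'\in\mathcal{Y}$; hereditary if $\mathrm{Ext}^i_{\mathcal{A}}(X,Y)=0$ for all $X\in\mathcal{X}$, $Y\in\mathcal{Y}$, $i\ge1$. An hereditary abelian model structure is a triple $\mathfrak{M}=(\mathcal{Q},\mathcal{W},\mathcal{R})$ of classes of objects such that $\mathcal{W}$ is thick (2 out of 3 property on short exact sequences) and, with $\mathcal{Q}_{\mathcal{W}}=\mathcal{Q}\cap\mathcal{W}$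 and $\mathcal{R}_{\mathcal{W}}=\mathcal{W}\cap\mathcal{R}$, both $(\mathcal{Q},\mathcal{R}_{\mathcal{W}})$ and $(\mathcal{Q}_{\mathcal{W}},\mathcal{R})$ are complete hereditary cotorsion pairs. Objects of $\mathcal{Q}$ are cofibrant, objects of $\mathcal{R}$ fibrant. The core is $\omega=\mathcal{Q}\cap\mathcal{W}\cap\mathcal{R}$; $f\sim^\omega g$ means $g-f$ factors through an object of $\omega$, and $\underline{\mathrm{Hom}}_\omega(A,B)=\mathrm{Hom}_{\mathcal{A}}(A,B)/\sim^\omega$. A cofibrant replacement $QA$ is given by a short exact sequence $0\to F\to QA\to A\to0$ with $QA\in\mathcal{Q}$, $F\in\mathcal{R}_{\mathcal{W}}$; a fibrant replacement $RA$ by $0\to A\to RA\to C\to0$ with $RA\in\mathcal{R}$, $C\in\mathcal{Q}_{\mathcal{W}}$. The homotopy category $\mathrm{Ho}(\mathfrak{M})$ has the objects of $\mathcal{A}$ and $\mathrm{Ho}(\mathfrak{M})(A,B)=\underline{\mathrm{Hom}}_\omega(RQA,RQB)$ (different choices of bifibrant replacements are canonically isomorphic). Suspension and loop: $\Sigma X$ is any object in a short exact sequence $0\to X\to W\to\Sigma X\to0$ with $W\in\mathcal{W}$, and $\Omega X$ any object in $0\to\Omega X\to W\to X\to0$ with $W\in\mathcal{W}$; these give well-defined (up to canonical isomorphism) additive endofunctors of $\mathrm{Ho}(\mathfrak{M})$. For $\Sigma$ on morphisms: such sequences for $X,X'$ have bifibrant replacement sequences $0\to RQX\to RQW\to RQ\Sigma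 X\to0$ with $RQW\in\omega$ (similarly for $X'$), a representative $f:RQX\to RQX'$ extends to a morphism of short exact sequences with right-hand map $c$, and $\Sigma([f])=[c]$; $\Omega$ is defined dually. For $n>0$, $\Omega^{-n}:=\Sigma^n$ and $\Sigma^{-n}:=\Omega^n$. An $\mathfrak{M}$-resolution of $A$ is an exact chain complex $W_A\equiv\cdots\to Q_1\xrightarrow{d_1}Q_0\xrightarrow{d_0}R_{-1}\xrightarrow{d_{-1}}R_{-2}\to\cdots$ with $d_0=\eta\epsilon$, where $\cdots\to Q_1\to Q_0\xrightarrow{\epsilon}A\to0$ is exact with each $Q_i\in\mathcal{Q}_{\mathcal{W}}$ and all kernels $\ker\epsilon$, $\ker d_i$ ($i\ge1$) in $\mathcal{R}$, and $0\to A\xrightarrow{\eta}R_{-1}\to R_{-2}\to\cdots$ is exact with each $R_i\in\mathcal{R}_{\mathcal{W}}$ and all cokernels $\mathrm{cok}\,\eta$, $\mathrm{cok}\,d_i$ ($i\le-1$) in $\mathcal{Q}$. An $\mathfrak{M}$-coresolution $W^B$ of $B$ is the same kind of complex written as a cochain complex $\cdots\to Q^{-2}\to Q^{-1}\to R^0\to R^1\to\cdots$, with $d^{-1}$ factoring as $Q^{-1}\twoheadrightarrow B\hookrightarrow R^0$. Define $\ell\mathrm{Ext}^n_{\mathfrak{M}}(A,B)=H^n[\mathrm{Hom}_{\mathcal{A}}(W_A,B)]$ and $r\mathrm{Ext}^n_{\mathfrak{M}}(A,B)=H^n[\mathrm{Hom}_{\mathcal{A}}(A,W^B)]$; these are bifunctors,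 independent of choices up to canonical isomorphism. *)

theory Defs
  imports "HOL-Algebra.Coset"
begin

section \<open>Abelian categories\<close>

text \<open>The objects of a category are the elements of the type \<open>'o\<close>; the arrows form the set
  \<open>arrs C\<close>, and nothing is assumed about elements of \<open>'a\<close> outside it. \<open>g \<cdot> f\<close> means
  ``first \<open>f\<close>, then \<open>g\<close>''.\<close>

record ('o, 'a) cat =
  arrs :: "'a set"
  src :: "'a \<Rightarrow> 'o"
  tgt :: "'a \<Rightarrow> 'o"
  idn :: "'o \<Rightarrow> 'a"
  cmp :: "'a \<Rightarrow> 'a \<Rightarrow> 'a" (infixr \<open>\<cdot>\<index>\<close> 70)
  hadd :: "'a \<Rightarrow> 'a \<Rightarrow> 'a" (infixl \<open>+.\<index>\<close> 65)
  nul :: "'o \<Rightarrow> 'o \<Rightarrow> 'a"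

definition Mor :: "('o, 'a) cat \<Rightarrow> 'o \<Rightarrow> 'o \<Rightarrow> 'a set" where
  "Mor C x y = {f \<in> arrs C. src C f = x \<and> tgt C f = y}"

text \<open>Abelian groups are HOL-Algebra monoids whose multiplication is the addition. Hence
  \<open>G Mod H\<close> below is the quotient group, and the coset \<open>H #> f\<close> is the class of \<open>f\<close>.\<close>

definition MorGrp :: "('o, 'a) cat \<Rightarrow> 'o \<Rightarrow> 'o \<Rightarrow> 'a monoid" where
  "MorGrp C x y = \<lparr>carrier = Mor C x y, mult = hadd C, one = nul C x y\<rparr>"

locale category =
  fixes C :: "('o, 'a) cat" (structure)
  assumes idn_Mor: "idn C x \<in> Mor C x x"
    and cmp_Mor: "\<lbrakk>f \<in> Mor C x y; g \<in> Mor C y z\<rbrakk> \<Longrightarrow> g \<cdot> f \<in> Mor C x z"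
    and cmp_idn: "f \<in> Mor C x y \<Longrightarrow> f \<cdot> idn C x = f"
    and idn_cmp: "f \<in> Mor C x y \<Longrightarrow> idn C y \<cdot> f = f"
    and cmp_assoc: "\<lbrakk>f \<in> Mor C w x; g \<in> Mor C x y; h \<in> Mor C y z\<rbrakk>
      \<Longrightarrow> (h \<cdot> g) \<cdot> f = h \<cdot> (g \<cdot> f)"

locale preadditive_category = category +
  assumes Mor_group: "comm_group (MorGrp C x y)"
    and cmp_plus: "\<lbrakk>f \<in> Mor C x y; f' \<in> Mor C x y; g \<in> Mor C y z\<rbrakk>
      \<Longrightarrow> g \<cdot> (f +. f') = g \<cdot> f +. g \<cdot> f'"
    and plus_cmp: "\<lbrakk>f \<in> Mor C x y; g \<in> Mor C y z; g' \<in> Mor C y z\<rbrakk>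
      \<Longrightarrow> (g +. g') \<cdot> f = g \<cdot> f +. g' \<cdot> f"

definition is_zero :: "('o, 'a) cat \<Rightarrow> 'o \<Rightarrow> bool" where
  "is_zero C z \<longleftrightarrow> (\<forall>x. (\<exists>!f. f \<in> Mor C z x) \<and> (\<exists>!f. f \<in> Mor C x z))"

definition is_biproduct :: "('o, 'a) cat \<Rightarrow> 'o \<Rightarrow> 'o \<Rightarrow> 'o \<Rightarrow> 'a \<Rightarrow> 'a \<Rightarrow> 'a \<Rightarrow> 'a \<Rightarrow> bool" where
  "is_biproduct C x y s i j p q \<longleftrightarrow>
     i \<in> Mor C x s \<and> j \<in> Mor C y s \<and> p \<in> Mor C s x \<and> q \<in> Mor C s y \<and>
     p \<cdot> i = idn C x \<and> q \<cdot> j = idn C y \<and> q \<cdot> i = nul C x y \<and> p \<cdot> j = nul C y x \<and>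
     i \<cdot> p +. j \<cdot> q = idn C s"
  for C (structure)

definition is_mono :: "('o, 'a) cat \<Rightarrow> 'a \<Rightarrow> bool" where
  "is_mono C f \<longleftrightarrow> f \<in> arrs C \<and>
     (\<forall>x. \<forall>g\<in>Mor C x (src C f). \<forall>h\<in>Mor C x (src C f). f \<cdot> g = f \<cdot> h \<longrightarrow> g = h)"
  for C (structure)

definition is_epi :: "('o, 'a) cat \<Rightarrow> 'a \<Rightarrow> bool" where
  "is_epi C f \<longleftrightarrow> f \<in> arrs C \<and>
     (\<forall>y. \<forall>g\<in>Mor C (tgt C f) y. \<forall>h\<in>Mor C (tgt C f) y. g \<cdot> f = h \<cdot> f \<longrightarrow> g = h)"
  for C (structure)

text \<open>\<open>is_kernel C f k\<close>: the arrow \<open>k\<close> is a kernel of \<open>f\<close>.\<close>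

definition is_kernel :: "('o, 'a) cat \<Rightarrow> 'a \<Rightarrow> 'a \<Rightarrow> bool" where
  "is_kernel C f k \<longleftrightarrow> f \<in> arrs C \<and> k \<in> arrs C \<and> tgt C k = src C f \<and>
     f \<cdot> k = nul C (src C k) (tgt C f) \<and>
     (\<forall>x. \<forall>g\<in>Mor C x (src C f). f \<cdot> g = nul C x (tgt C f) \<longrightarrow>
        (\<exists>!h. h \<in> Mor C x (src C k) \<and> k \<cdot> h = g))"
  for C (structure)

definition is_cokernel :: "('o, 'a) cat \<Rightarrow> 'a \<Rightarrow> 'a \<Rightarrow> bool" where
  "is_cokernel C f c \<longleftrightarrow> f \<in> arrs C \<and> c \<in> arrs C \<and> src C c = tgt C f \<and>
     c \<cdot> f = nul C (src C f) (tgt C c) \<and>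
     (\<forall>y. \<forall>g\<in>Mor C (tgt C f) y. g \<cdot> f = nul C (src C f) y \<longrightarrow>
        (\<exists>!h. h \<in> Mor C (tgt C c) y \<and> h \<cdot> c = g))"
  for C (structure)

locale abelian_category = preadditive_category +
  assumes zero_exists: "\<exists>z. is_zero C z"
    and biproduct_exists: "\<exists>s i j p q. is_biproduct C x y s i j p q"
    and kernel_exists: "f \<in> arrs C \<Longrightarrow> \<exists>k. is_kernel C f k"
    and cokernel_exists: "f \<in> arrs C \<Longrightarrow> \<exists>c. is_cokernel C f c"
    and mono_normal: "is_mono C f \<Longrightarrow> \<exists>g. is_kernel C g f"
    and epi_normal: "is_epi C f \<Longrightarrow> \<exists>g. is_cokernel C g f"

definition short_exact :: "('o, 'a) cat \<Rightarrow> 'a \<Rightarrow> 'a \<Rightarrow> bool" where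
  "short_exact C i p \<longleftrightarrow> is_kernel C p i \<and> is_cokernel C i p"

text \<open>Exactness of \<open>x \<rightarrow> y \<rightarrow> z\<close> at \<open>y\<close>: the image of \<open>f\<close>, i.e. the monomorphism in an epi-mono
  factorization of \<open>f\<close>, is a kernel of \<open>g\<close>.\<close>

definition exact :: "('o, 'a) cat \<Rightarrow> 'a \<Rightarrow> 'a \<Rightarrow> bool" where
  "exact C f g \<longleftrightarrow> f \<in> arrs C \<and> g \<in> arrs C \<and> tgt C f = src C g \<and>
     (\<exists>k e. is_kernel C g k \<and> is_epi C e \<and> tgt C e = src C k \<and> f = k \<cdot> e)"
  for C (structure)

section \<open>Yoneda Ext\<close>

text \<open>An exact sequence \<open>0 \<rightarrow> Y \<rightarrow> E\<^sub>n \<rightarrow> \<dots> \<rightarrow> E\<^sub>1 \<rightarrow> X \<rightarrow> 0\<close> is given by the list of its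
  \<open>n + 1\<close> arrows, starting at \<open>Y\<close>.\<close>

definition yoneda_extension :: "('o, 'a) cat \<Rightarrow> nat \<Rightarrow> 'o \<Rightarrow> 'o \<Rightarrow> 'a list \<Rightarrow> bool" where
  "yoneda_extension C n X Y fs \<longleftrightarrow> length fs = n + 1 \<and> set fs \<subseteq> arrs C \<and>
     src C (hd fs) = Y \<and> tgt C (last fs) = X \<and> is_mono C (hd fs) \<and> is_epi C (last fs) \<and>
     (\<forall>i<n. exact C (fs ! i) (fs ! Suc i))"

definition yoneda_morphism :: "('o, 'a) cat \<Rightarrow> nat \<Rightarrow> 'o \<Rightarrow> 'o \<Rightarrow> ('a list \<times> 'a list) set" where
  "yoneda_morphism C n X Y = {(fs, gs). yoneda_extension C n X Y fs \<and> yoneda_extension C n X Y gs \<and>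
     (\<exists>u :: nat \<Rightarrow> 'a. u 0 = idn C Y \<and> u (n + 1) = idn C X \<and>
        (\<forall>i\<le>n. u i \<in> Mor C (src C (fs ! i)) (src C (gs ! i))) \<and>
        (\<forall>i\<le>n. u (Suc i) \<cdot> fs ! i = gs ! i \<cdot> u i))}"
  for C (structure)

definition yoneda_Ext :: "('o, 'a) cat \<Rightarrow> nat \<Rightarrow> 'o \<Rightarrow> 'o \<Rightarrow> 'a list set set" where
  "yoneda_Ext C n X Y = {fs. yoneda_extension C n X Y fs} //
     (yoneda_morphism C n X Y \<union> (yoneda_morphism C n X Y)\<inverse>)\<^sup>*"

text \<open>The Baer sum is not needed: a group vanishes iff its underlying set has a single element.
  Only used for \<open>n \<ge> 1\<close>.\<close>

definition Ext_vanishes :: "('o, 'a) cat \<Rightarrow> nat \<Rightarrow> 'o \<Rightarrow> 'o \<Rightarrow> bool" where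
  "Ext_vanishes C n X Y \<longleftrightarrow> is_singleton (yoneda_Ext C n X Y)"

section \<open>Hereditary abelian model structures\<close>

definition cotorsion_pair :: "('o, 'a) cat \<Rightarrow> 'o set \<Rightarrow> 'o set \<Rightarrow> bool" where
  "cotorsion_pair C \<X> \<Y> \<longleftrightarrow>
     \<Y> = {Y. \<forall>X\<in>\<X>. Ext_vanishes C 1 X Y} \<and> \<X> = {X. \<forall>Y\<in>\<Y>. Ext_vanishes C 1 X Y}"

definition complete_pair :: "('o, 'a) cat \<Rightarrow> 'o set \<Rightarrow> 'o set \<Rightarrow> bool" where
  "complete_pair C \<X> \<Y> \<longleftrightarrow> (\<forall>A.
     (\<exists>i p. short_exact C i p \<and> src C i \<in> \<Y> \<and> src C p \<in> \<X> \<and> tgt C p = A) \<and>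
     (\<exists>i p. short_exact C i p \<and> src C i = A \<and> tgt C i \<in> \<Y> \<and> tgt C p \<in> \<X>))"

definition hereditary_pair :: "('o, 'a) cat \<Rightarrow> 'o set \<Rightarrow> 'o set \<Rightarrow> bool" where
  "hereditary_pair C \<X> \<Y> \<longleftrightarrow> (\<forall>X\<in>\<X>. \<forall>Y\<in>\<Y>. \<forall>i\<ge>1. Ext_vanishes C i X Y)"

definition thick :: "('o, 'a) cat \<Rightarrow> 'o set \<Rightarrow> bool" where
  "thick C \<W> \<longleftrightarrow> (\<forall>i p. short_exact C i p \<longrightarrow>
     (src C i \<in> \<W> \<and> tgt C i \<in> \<W> \<longrightarrow> tgt C p \<in> \<W>) \<and>
     (src C i \<in> \<W> \<and> tgt C p \<in> \<W> \<longrightarrow> tgt C i \<in> \<W>) \<and>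
     (tgt C i \<in> \<W> \<and> tgt C p \<in> \<W> \<longrightarrow> src C i \<in> \<W>))"

record 'o triple =
  cofs :: "'o set"
  trivs :: "'o set"
  fibs :: "'o set"

definition hereditary_model_structure :: "('o, 'a) cat \<Rightarrow> 'o triple \<Rightarrow> bool" where
  "hereditary_model_structure C M \<longleftrightarrow> thick C (trivs M) \<and>
     (\<forall>(\<X>, \<Y>) \<in> {(cofs M, trivs M \<inter> fibs M), (cofs M \<inter> trivs M, fibs M)}.
        cotorsion_pair C \<X> \<Y> \<and> complete_pair C \<X> \<Y> \<and> hereditary_pair C \<X> \<Y>)"

definition core :: "'o triple \<Rightarrow> 'o set" where
  "core M = cofs M \<inter> trivs M \<inter> fibs M"

section \<open>The homotopy category\<close>

text \<open>A replacement is recorded by its structure arrow \<open>QA \<rightarrow> A\<close>, respectively \<open>A \<rightarrow> RA\<close>.\<close>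

definition cofibrant_replacement :: "('o, 'a) cat \<Rightarrow> 'o triple \<Rightarrow> 'o \<Rightarrow> 'a \<Rightarrow> bool" where
  "cofibrant_replacement C M A p \<longleftrightarrow> tgt C p = A \<and> src C p \<in> cofs M \<and>
     (\<exists>i. short_exact C i p \<and> src C i \<in> trivs M \<inter> fibs M)"

definition fibrant_replacement :: "('o, 'a) cat \<Rightarrow> 'o triple \<Rightarrow> 'o \<Rightarrow> 'a \<Rightarrow> bool" where
  "fibrant_replacement C M A j \<longleftrightarrow> src C j = A \<and> tgt C j \<in> fibs M \<and>
     (\<exists>p. short_exact C j p \<and> tgt C p \<in> cofs M \<inter> trivs M)"

text \<open>A choice of a cofibrant and a fibrant replacement for every object.\<close>

record ('o, 'a) repl =
  cofr :: "'o \<Rightarrow> 'a"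
  fibr :: "'o \<Rightarrow> 'a"

definition replacement_choice :: "('o, 'a) cat \<Rightarrow> 'o triple \<Rightarrow> ('o, 'a) repl \<Rightarrow> bool" where
  "replacement_choice C M K \<longleftrightarrow>
     (\<forall>A. cofibrant_replacement C M A (cofr K A) \<and> fibrant_replacement C M A (fibr K A))"

definition Qob :: "('o, 'a) cat \<Rightarrow> ('o, 'a) repl \<Rightarrow> 'o \<Rightarrow> 'o" where
  "Qob C K A = src C (cofr K A)"

definition RQob :: "('o, 'a) cat \<Rightarrow> ('o, 'a) repl \<Rightarrow> 'o \<Rightarrow> 'o" where
  "RQob C K A = tgt C (fibr K (Qob C K A))"

definition core_maps :: "('o, 'a) cat \<Rightarrow> 'o triple \<Rightarrow> 'o \<Rightarrow> 'o \<Rightarrow> 'a set" where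
  "core_maps C M x y = {h \<cdot> g | g h w. w \<in> core M \<and> g \<in> Mor C x w \<and> h \<in> Mor C w y}"
  for C (structure)

definition stable_Mor :: "('o, 'a) cat \<Rightarrow> 'o triple \<Rightarrow> 'o \<Rightarrow> 'o \<Rightarrow> 'a set monoid" where
  "stable_Mor C M x y = MorGrp C x y Mod core_maps C M x y"

definition stable_class :: "('o, 'a) cat \<Rightarrow> 'o triple \<Rightarrow> 'o \<Rightarrow> 'o \<Rightarrow> 'a \<Rightarrow> 'a set" where
  "stable_class C M x y f = core_maps C M x y #>\<^bsub>MorGrp C x y\<^esub> f"

definition Ho :: "('o, 'a) cat \<Rightarrow> 'o triple \<Rightarrow> ('o, 'a) repl \<Rightarrow> 'o \<Rightarrow> 'o \<Rightarrow> 'a set monoid" where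
  "Ho C M K A B = stable_Mor C M (RQob C K A) (RQob C K B)"

text \<open>Operations that are well defined on classes are written, here and below, as unions over
  all representatives and all auxiliary choices of the resulting class, which is always the same.\<close>

definition Ho_comp :: "('o, 'a) cat \<Rightarrow> 'o triple \<Rightarrow> ('o, 'a) repl \<Rightarrow> 'o \<Rightarrow> 'o \<Rightarrow> 'a set \<Rightarrow> 'a set \<Rightarrow> 'a set" where
  "Ho_comp C M K A B G F =
     (\<Union>g\<in>G. \<Union>f\<in>F. stable_class C M (RQob C K A) (RQob C K B) (g \<cdot> f))"
  for C (structure)

text \<open>The canonical functor from the abelian category to its homotopy category, on an arrow
  \<open>f : A \<rightarrow> B\<close>: lift \<open>f\<close> to \<open>QA \<rightarrow> QB\<close>, then extend to \<open>RQA \<rightarrow> RQB\<close>.\<close>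

definition bifibrant_lifts :: "('o, 'a) cat \<Rightarrow> ('o, 'a) repl \<Rightarrow> 'a \<Rightarrow> 'a set" where
  "bifibrant_lifts C K f = (let A = src C f; B = tgt C f in
     {f'' \<in> Mor C (RQob C K A) (RQob C K B). \<exists>f' \<in> Mor C (Qob C K A) (Qob C K B).
        cofr K B \<cdot> f' = f \<cdot> cofr K A \<and>
        f'' \<cdot> fibr K (Qob C K A) = fibr K (Qob C K B) \<cdot> f'})"
  for C (structure)

definition Ho_arr :: "('o, 'a) cat \<Rightarrow> 'o triple \<Rightarrow> ('o, 'a) repl \<Rightarrow> 'a \<Rightarrow> 'a set" where
  "Ho_arr C M K f = (\<Union>f''\<in>bifibrant_lifts C K f.
     stable_class C M (RQob C K (src C f)) (RQob C K (tgt C f)) f'')"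

section \<open>Suspension and loop\<close>

definition suspension_choice :: "('o, 'a) cat \<Rightarrow> 'o triple \<Rightarrow> ('o \<Rightarrow> 'a \<times> 'a) \<Rightarrow> bool" where
  "suspension_choice C M s \<longleftrightarrow> (\<forall>X. short_exact C (fst (s X)) (snd (s X)) \<and>
     src C (fst (s X)) = X \<and> tgt C (fst (s X)) \<in> trivs M)"

definition loop_choice :: "('o, 'a) cat \<Rightarrow> 'o triple \<Rightarrow> ('o \<Rightarrow> 'a \<times> 'a) \<Rightarrow> bool" where
  "loop_choice C M l \<longleftrightarrow> (\<forall>X. short_exact C (fst (l X)) (snd (l X)) \<and>
     tgt C (snd (l X)) = X \<and> tgt C (fst (l X)) \<in> trivs M)"

definition susp :: "('o, 'a) cat \<Rightarrow> ('o \<Rightarrow> 'a \<times> 'a) \<Rightarrow> 'o \<Rightarrow> 'o" where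
  "susp C s X = tgt C (snd (s X))"

definition loop :: "('o, 'a) cat \<Rightarrow> ('o \<Rightarrow> 'a \<times> 'a) \<Rightarrow> 'o \<Rightarrow> 'o" where
  "loop C l X = src C (fst (l X))"

text \<open>\<open>(i', p')\<close> is a bifibrant replacement sequence \<open>RQX \<rightarrow> RQW \<rightarrow> RQZ\<close> of the short exact
  sequence \<open>(i, p) : X \<rightarrow> W \<rightarrow> Z\<close>. The replacements at both ends are the chosen ones; the replacements
  \<open>a : QW \<rightarrow> W\<close> and \<open>b : QW \<rightarrow> RQW\<close> in the middle are arbitrary, since in general the sequence
  \<open>(i, p)\<close> need not lift to one through prescribed replacements of all three objects.\<close>

definition bifibrant_sequence ::
  "('o, 'a) cat \<Rightarrow> 'o triple \<Rightarrow> ('o, 'a) repl \<Rightarrow> 'a \<times> 'a \<Rightarrow> 'a \<times> 'a \<Rightarrow> bool" where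
  "bifibrant_sequence C M K = (\<lambda>(i, p) (i', p').
     let X = src C i; W = tgt C i; Z = tgt C p in
     short_exact C i' p' \<and> src C i' = RQob C K X \<and> tgt C p' = RQob C K Z \<and> tgt C i' \<in> core M \<and>
     (\<exists>i\<^sub>0 p\<^sub>0 a b. short_exact C i\<^sub>0 p\<^sub>0 \<and> src C i\<^sub>0 = Qob C K X \<and> tgt C p\<^sub>0 = Qob C K Z \<and>
        cofibrant_replacement C M W a \<and> src C a = tgt C i\<^sub>0 \<and>
        a \<cdot> i\<^sub>0 = i \<cdot> cofr K X \<and> cofr K Z \<cdot> p\<^sub>0 = p \<cdot> a \<and>
        fibrant_replacement C M (tgt C i\<^sub>0) b \<and> tgt C b = tgt C i' \<and>
        b \<cdot> i\<^sub>0 = i' \<cdot> fibr K (Qob C K X) \<and> fibr K (Qob C K Z) \<cdot> p\<^sub>0 = p' \<cdot> b))"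
  for C (structure)

text \<open>The action of suspension and loop on a class \<open>F\<close> from \<open>X\<close> to \<open>X'\<close> in the homotopy category.\<close>

definition susp_map ::
  "('o, 'a) cat \<Rightarrow> 'o triple \<Rightarrow> ('o, 'a) repl \<Rightarrow> ('o \<Rightarrow> 'a \<times> 'a) \<Rightarrow> 'o \<Rightarrow> 'o \<Rightarrow> 'a set \<Rightarrow> 'a set" where
  "susp_map C M K s X X' F =
     (\<Union>c\<in>{c \<in> Mor C (RQob C K (susp C s X)) (RQob C K (susp C s X')).
           \<exists>f\<in>F. \<exists>i p i' p'. \<exists>v\<in>Mor C (tgt C i) (tgt C i').
             bifibrant_sequence C M K (s X) (i, p) \<and> bifibrant_sequence C M K (s X') (i', p') \<and>
             v \<cdot> i = i' \<cdot> f \<and> c \<cdot> p = p' \<cdot> v}.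
        stable_class C M (RQob C K (susp C s X)) (RQob C K (susp C s X')) c)"
  for C (structure)

definition loop_map ::
  "('o, 'a) cat \<Rightarrow> 'o triple \<Rightarrow> ('o, 'a) repl \<Rightarrow> ('o \<Rightarrow> 'a \<times> 'a) \<Rightarrow> 'o \<Rightarrow> 'o \<Rightarrow> 'a set \<Rightarrow> 'a set" where
  "loop_map C M K l X X' F =
     (\<Union>c\<in>{c \<in> Mor C (RQob C K (loop C l X)) (RQob C K (loop C l X')).
           \<exists>f\<in>F. \<exists>i p i' p'. \<exists>v\<in>Mor C (tgt C i) (tgt C i').
             bifibrant_sequence C M K (l X) (i, p) \<and> bifibrant_sequence C M K (l X') (i', p') \<and>
             p' \<cdot> v = f \<cdot> p \<and> i' \<cdot> c = v \<cdot> i}.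
        stable_class C M (RQob C K (loop C l X)) (RQob C K (loop C l X')) c)"
  for C (structure)

primrec susp_pow_map ::
  "('o, 'a) cat \<Rightarrow> 'o triple \<Rightarrow> ('o, 'a) repl \<Rightarrow> ('o \<Rightarrow> 'a \<times> 'a) \<Rightarrow> nat \<Rightarrow> 'o \<Rightarrow> 'o \<Rightarrow> 'a set \<Rightarrow> 'a set"
where
  "susp_pow_map C M K s 0 X X' F = F"
| "susp_pow_map C M K s (Suc k) X X' F =
     susp_map C M K s ((susp C s ^^ k) X) ((susp C s ^^ k) X') (susp_pow_map C M K s k X X' F)"

primrec loop_pow_map ::
  "('o, 'a) cat \<Rightarrow> 'o triple \<Rightarrow> ('o, 'a) repl \<Rightarrow> ('o \<Rightarrow> 'a \<times> 'a) \<Rightarrow> nat \<Rightarrow> 'o \<Rightarrow> 'o \<Rightarrow> 'a set \<Rightarrow> 'a set"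
where
  "loop_pow_map C M K l 0 X X' F = F"
| "loop_pow_map C M K l (Suc k) X X' F =
     loop_map C M K l ((loop C l ^^ k) X) ((loop C l ^^ k) X') (loop_pow_map C M K l k X X' F)"

text \<open>The powers for integer exponents, with \<open>\<Sigma>\<^sup>-\<^sup>k = \<Omega>\<^sup>k\<close> for \<open>k > 0\<close>.\<close>

definition Sigma_ob ::
  "('o, 'a) cat \<Rightarrow> ('o \<Rightarrow> 'a \<times> 'a) \<Rightarrow> ('o \<Rightarrow> 'a \<times> 'a) \<Rightarrow> int \<Rightarrow> 'o \<Rightarrow> 'o" where
  "Sigma_ob C s l n X = (if n \<ge> 0 then (susp C s ^^ nat n) X else (loop C l ^^ nat (- n)) X)"

definition Sigma_map ::
  "('o, 'a) cat \<Rightarrow> 'o triple \<Rightarrow> ('o, 'a) repl \<Rightarrow> ('o \<Rightarrow> 'a \<times> 'a) \<Rightarrow> ('o \<Rightarrow> 'a \<times> 'a) \<Rightarrow>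
     int \<Rightarrow> 'o \<Rightarrow> 'o \<Rightarrow> 'a set \<Rightarrow> 'a set" where
  "Sigma_map C M K s l n X X' F =
     (if n \<ge> 0 then susp_pow_map C M K s (nat n) X X' F else loop_pow_map C M K l (nat (- n)) X X' F)"

definition Omega_ob ::
  "('o, 'a) cat \<Rightarrow> ('o \<Rightarrow> 'a \<times> 'a) \<Rightarrow> ('o \<Rightarrow> 'a \<times> 'a) \<Rightarrow> int \<Rightarrow> 'o \<Rightarrow> 'o" where
  "Omega_ob C s l n = Sigma_ob C s l (- n)"

definition Omega_map ::
  "('o, 'a) cat \<Rightarrow> 'o triple \<Rightarrow> ('o, 'a) repl \<Rightarrow> ('o \<Rightarrow> 'a \<times> 'a) \<Rightarrow> ('o \<Rightarrow> 'a \<times> 'a) \<Rightarrow>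
     int \<Rightarrow> 'o \<Rightarrow> 'o \<Rightarrow> 'a set \<Rightarrow> 'a set" where
  "Omega_map C M K s l n = Sigma_map C M K s l (- n)"

section \<open>Resolutions and the two Ext functors\<close>

text \<open>A complex indexed by the integers with an augmentation and a coaugmentation. Whether
  \<open>dif P i\<close> goes from \<open>ob P i\<close> to \<open>ob P (i - 1)\<close> or to \<open>ob P (i + 1)\<close> depends on whether \<open>P\<close>
  is used as a chain or as a cochain complex.\<close>

record ('o, 'a) zcomplex =
  ob :: "int \<Rightarrow> 'o"
  dif :: "int \<Rightarrow> 'a"
  aug :: 'a
  coaug :: 'a

definition M_resolution :: "('o, 'a) cat \<Rightarrow> 'o triple \<Rightarrow> 'o \<Rightarrow> ('o, 'a) zcomplex \<Rightarrow> bool" where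
  "M_resolution C M A P \<longleftrightarrow>
     (\<forall>i. dif P i \<in> Mor C (ob P i) (ob P (i - 1))) \<and>
     aug P \<in> Mor C (ob P 0) A \<and> coaug P \<in> Mor C A (ob P (- 1)) \<and>
     dif P 0 = coaug P \<cdot> aug P \<and>
     (\<forall>i. exact C (dif P (i + 1)) (dif P i)) \<and>
     exact C (dif P 1) (aug P) \<and> is_epi C (aug P) \<and>
     is_mono C (coaug P) \<and> exact C (coaug P) (dif P (- 1)) \<and>
     (\<forall>i\<ge>0. ob P i \<in> cofs M \<inter> trivs M) \<and>
     (\<forall>k. is_kernel C (aug P) k \<longrightarrow> src C k \<in> fibs M) \<and>
     (\<forall>i\<ge>1. \<forall>k. is_kernel C (dif P i) k \<longrightarrow> src C k \<in> fibs M) \<and>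
     (\<forall>i\<le>-1. ob P i \<in> trivs M \<inter> fibs M) \<and>
     (\<forall>c. is_cokernel C (coaug P) c \<longrightarrow> tgt C c \<in> cofs M) \<and>
     (\<forall>i\<le>-1. \<forall>c. is_cokernel C (dif P i) c \<longrightarrow> tgt C c \<in> cofs M)"
  for C (structure)

text \<open>Passage between the chain and the cochain indexing, in either direction:
  \<open>Q\<^sub>0, R\<^sub>-\<^sub>1\<close> correspond to \<open>Q\<^sup>-\<^sup>1, R\<^sup>0\<close> and \<open>d\<^sub>0\<close> to \<open>d\<^sup>-\<^sup>1\<close>.\<close>

definition reindex :: "('o, 'a) zcomplex \<Rightarrow> ('o, 'a) zcomplex" where
  "reindex T = T\<lparr>ob := \<lambda>i. ob T (- i - 1), dif := \<lambda>i. dif T (- i - 1)\<rparr>"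

definition M_coresolution :: "('o, 'a) cat \<Rightarrow> 'o triple \<Rightarrow> 'o \<Rightarrow> ('o, 'a) zcomplex \<Rightarrow> bool" where
  "M_coresolution C M B T \<longleftrightarrow> M_resolution C M B (reindex T)"

definition coboundaries :: "(int \<Rightarrow> 'b monoid) \<Rightarrow> (int \<Rightarrow> 'b \<Rightarrow> 'b) \<Rightarrow> int \<Rightarrow> 'b set" where
  "coboundaries G \<delta> n = \<delta> (n - 1) ` carrier (G (n - 1))"

definition cohomology :: "(int \<Rightarrow> 'b monoid) \<Rightarrow> (int \<Rightarrow> 'b \<Rightarrow> 'b) \<Rightarrow> int \<Rightarrow> 'b set monoid" where
  "cohomology G \<delta> n =
     (G n)\<lparr>carrier := kernel (G n) (G (n + 1)) (\<delta> n)\<rparr> Mod coboundaries G \<delta> n"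

definition coclass :: "(int \<Rightarrow> 'b monoid) \<Rightarrow> (int \<Rightarrow> 'b \<Rightarrow> 'b) \<Rightarrow> int \<Rightarrow> 'b \<Rightarrow> 'b set" where
  "coclass G \<delta> n z = coboundaries G \<delta> n #>\<^bsub>G n\<^esub> z"

definition lcochains :: "('o, 'a) cat \<Rightarrow> ('o, 'a) zcomplex \<Rightarrow> 'o \<Rightarrow> int \<Rightarrow> 'a monoid" where
  "lcochains C P B i = MorGrp C (ob P i) B"

definition ldiff :: "('o, 'a) cat \<Rightarrow> ('o, 'a) zcomplex \<Rightarrow> int \<Rightarrow> 'a \<Rightarrow> 'a" where
  "ldiff C P i z = z \<cdot> dif P (i + 1)"
  for C (structure)

definition rcochains :: "('o, 'a) cat \<Rightarrow> 'o \<Rightarrow> ('o, 'a) zcomplex \<Rightarrow> int \<Rightarrow> 'a monoid" where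
  "rcochains C A T i = MorGrp C A (ob T i)"

definition rdiff :: "('o, 'a) cat \<Rightarrow> ('o, 'a) zcomplex \<Rightarrow> int \<Rightarrow> 'a \<Rightarrow> 'a" where
  "rdiff C T i z = dif T i \<cdot> z"
  for C (structure)

text \<open>\<open>P\<close> and \<open>T\<close> are choices of an \<open>M\<close>-resolution and an \<open>M\<close>-coresolution for every object.\<close>

definition lExt :: "('o, 'a) cat \<Rightarrow> ('o \<Rightarrow> ('o, 'a) zcomplex) \<Rightarrow> int \<Rightarrow> 'o \<Rightarrow> 'o \<Rightarrow> 'a set monoid" where
  "lExt C P n A B = cohomology (lcochains C (P A) B) (ldiff C (P A)) n"

definition rExt :: "('o, 'a) cat \<Rightarrow> ('o \<Rightarrow> ('o, 'a) zcomplex) \<Rightarrow> int \<Rightarrow> 'o \<Rightarrow> 'o \<Rightarrow> 'a set monoid" where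
  "rExt C T n A B = cohomology (rcochains C A (T B)) (rdiff C (T B)) n"

definition chain_lift ::
  "('o, 'a) cat \<Rightarrow> ('o, 'a) zcomplex \<Rightarrow> ('o, 'a) zcomplex \<Rightarrow> 'a \<Rightarrow> (int \<Rightarrow> 'a) \<Rightarrow> bool" where
  "chain_lift C P P' f u \<longleftrightarrow> (\<forall>i. u i \<in> Mor C (ob P i) (ob P' i)) \<and>
     (\<forall>i. dif P' i \<cdot> u i = u (i - 1) \<cdot> dif P i) \<and>
     aug P' \<cdot> u 0 = f \<cdot> aug P \<and> coaug P' \<cdot> f = u (- 1) \<cdot> coaug P"
  for C (structure)

text \<open>The maps induced by \<open>f : A' \<rightarrow> A\<close> and \<open>g : B \<rightarrow> B'\<close> on a class from \<open>(A, B)\<close>.\<close>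

definition lExt_map ::
  "('o, 'a) cat \<Rightarrow> ('o \<Rightarrow> ('o, 'a) zcomplex) \<Rightarrow> int \<Rightarrow> 'a \<Rightarrow> 'a \<Rightarrow> 'a set \<Rightarrow> 'a set" where
  "lExt_map C P n f g \<xi> =
     (\<Union>u\<in>{u. chain_lift C (P (src C f)) (P (tgt C f)) f u}. \<Union>z\<in>\<xi>.
        coclass (lcochains C (P (src C f)) (tgt C g)) (ldiff C (P (src C f))) n (g \<cdot> z \<cdot> u n))"
  for C (structure)

definition rExt_map ::
  "('o, 'a) cat \<Rightarrow> ('o \<Rightarrow> ('o, 'a) zcomplex) \<Rightarrow> int \<Rightarrow> 'a \<Rightarrow> 'a \<Rightarrow> 'a set \<Rightarrow> 'a set" where
  "rExt_map C T n f g \<xi> =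
     (\<Union>u\<in>{u. chain_lift C (reindex (T (src C g))) (reindex (T (tgt C g))) g u}. \<Union>z\<in>\<xi>.
        coclass (rcochains C (src C f) (T (tgt C g))) (rdiff C (T (tgt C g))) n
          (u (- n - 1) \<cdot> z \<cdot> f))"
  for C (structure)

text \<open>The two functors with values in \<open>Ho\<close>, on the same pair of arrows.\<close>

definition Ho_Omega_map ::
  "('o, 'a) cat \<Rightarrow> 'o triple \<Rightarrow> ('o, 'a) repl \<Rightarrow> ('o \<Rightarrow> 'a \<times> 'a) \<Rightarrow> ('o \<Rightarrow> 'a \<times> 'a) \<Rightarrow>
     int \<Rightarrow> 'a \<Rightarrow> 'a \<Rightarrow> 'a set \<Rightarrow> 'a set" where
  "Ho_Omega_map C M K s l n f g \<xi> =
     (let A' = src C f; A = tgt C f; B = src C g; B' = tgt C g; \<Omega> = Omega_ob C s l n in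
      Ho_comp C M K (\<Omega> A') B' (Ho_arr C M K g)
        (Ho_comp C M K (\<Omega> A') B \<xi> (Omega_map C M K s l n A' A (Ho_arr C M K f))))"

definition Ho_Sigma_map ::
  "('o, 'a) cat \<Rightarrow> 'o triple \<Rightarrow> ('o, 'a) repl \<Rightarrow> ('o \<Rightarrow> 'a \<times> 'a) \<Rightarrow> ('o \<Rightarrow> 'a \<times> 'a) \<Rightarrow>
     int \<Rightarrow> 'a \<Rightarrow> 'a \<Rightarrow> 'a set \<Rightarrow> 'a set" where
  "Ho_Sigma_map C M K s l n f g \<xi> =
     (let A' = src C f; B = src C g; B' = tgt C g; \<Sigma> = Sigma_ob C s l n in
      Ho_comp C M K A' (\<Sigma> B') (Sigma_map C M K s l n B B' (Ho_arr C M K g))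
        (Ho_comp C M K A' (\<Sigma> B) \<xi> (Ho_arr C M K f)))"

text \<open>Natural isomorphisms between functors of a cofibrant argument (contravariant) and a fibrant
  argument (covariant) with values in abelian groups; each functor is given by its values and
  its action on a pair of arrows.\<close>

definition natural_iso ::
  "('o, 'a) cat \<Rightarrow> 'o triple \<Rightarrow>
     ('o \<Rightarrow> 'o \<Rightarrow> 'b monoid) \<Rightarrow> ('a \<Rightarrow> 'a \<Rightarrow> 'b \<Rightarrow> 'b) \<Rightarrow>
     ('o \<Rightarrow> 'o \<Rightarrow> 'c monoid) \<Rightarrow> ('a \<Rightarrow> 'a \<Rightarrow> 'c \<Rightarrow> 'c) \<Rightarrow> ('o \<Rightarrow> 'o \<Rightarrow> 'b \<Rightarrow> 'c) \<Rightarrow> bool" where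
  "natural_iso C M F Fm G Gm \<tau> \<longleftrightarrow>
     (\<forall>A\<in>cofs M. \<forall>B\<in>fibs M. \<tau> A B \<in> iso (F A B) (G A B)) \<and>
     (\<forall>A\<in>cofs M. \<forall>A'\<in>cofs M. \<forall>B\<in>fibs M. \<forall>B'\<in>fibs M. \<forall>f\<in>Mor C A' A. \<forall>g\<in>Mor C B B'.
        \<forall>\<xi>\<in>carrier (F A B). \<tau> A' B' (Fm f g \<xi>) = Gm f g (\<tau> A B \<xi>))"

end

theory Submission
  imports Defs
begin

text \<open>Everything is reduced to the stable Hom groups \<open>S(X, Y)\<close> of maps modulo those that factor through the
  core, for cofibrant \<open>X\<close> and fibrant \<open>Y\<close>; between such objects, factoring through any trivial object
  suffices. Let \<open>X' \<rightarrow> W \<rightarrow> X\<close> and \<open>Y' \<rightarrow> V \<rightarrow> Y\<close> be short exact with trivial middle terms, the first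
  with cofibrant and the second with fibrant terms. A morphism between them exists with either end
  prescribed, and one end is null iff the other is, so \<open>S(X', Y') \<cong> S(X, Y)\<close>.

  The short exact pieces of a resolution of \<open>A\<close> form an integer-indexed family of the first kind,
  those of a coresolution of \<open>B\<close> one of the second kind, and the bifibrant replacements of the
  sequences defining \<open>\<Omega>\<^sup>n A\<close> one of both kinds. The theorem compares such families: the end maps in
  degree \<open>0\<close> are the canonical maps between \<open>A\<close> and \<open>RQA\<close>, respectively \<open>RQB\<close> and \<open>B\<close>, and the other
  degrees are determined up to null maps. A cocycle of \<open>Hom(W\<^sub>A, B)\<close> in degree \<open>n\<close> is a map
  from the \<open>n\<close>-th syzygy \<open>K\<^sub>n\<close> of \<open>A\<close> to \<open>B\<close>, and it is a coboundary iff that map is null.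

  Heredity enters twice: the vanishing of \<open>Ext\<^sup>2\<close> makes the classes closed under kernels, respectively
  cokernels, and allows a short exact sequence to be lifted through prescribed replacements of its ends.\<close>

section \<open>Preadditive categories and duality\<close>

text \<open>The obstacle is that the objects to be compared are not bifibrant. In degrees
  \<open>n \<le> 0\<close> the syzygies of a cofibrant \<open>A\<close> need not be fibrant, so
  their comparison with the replaced loop objects has no evident inverse. Equivalences are therefore
  tested on one side only, and a cocycle is matched with a stable map \<open>h\<close> by
  sandwiching \<open>h\<close> between a comparison out of the syzygy and the counit to
  \<open>B\<close>. A cocycle determines \<open>h\<close> only up to null maps, and the operations
  of the homotopy category are unions over all choices. Hence the isomorphisms are given by
  correspondences between representatives (\<open>coset_rel\<close>), and naturality is checked on a
  single related pair. The middle isomorphism needs no explicit adjunction between loop and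
  suspension: a morphism from the family of \<open>A\<close>, shifted by \<open>n\<close>, to the
  family of \<open>B\<close> is read at the indices 0 and \<open>- n\<close>. Families over all
  integers treat both signs of \<open>n\<close> alike. Duality is made formal through
  \<open>opc C\<close> and \<open>opm M\<close>, because nearly every argument is used on both
  sides.\<close>

lemma MorD: "f \<in> Mor C x y \<Longrightarrow> f \<in> arrs C" "f \<in> Mor C x y \<Longrightarrow> src C f = x" "f \<in> Mor C x y \<Longrightarrow> tgt C f = y"
  by (simp_all add: Mor_def)

lemma MorI: "\<lbrakk>f \<in> arrs C; src C f = x; tgt C f = y\<rbrakk> \<Longrightarrow> f \<in> Mor C x y"
  by (simp add: Mor_def)

text \<open>An arrow determines its hom group, so negation takes no objects as arguments and agrees
  with negation in \<open>opc C\<close>.\<close>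

definition hneg :: "('o, 'a) cat \<Rightarrow> 'a \<Rightarrow> 'a" where
  "hneg C f = inv\<^bsub>MorGrp C (src C f) (tgt C f)\<^esub> f"

definition hsub :: "('o, 'a) cat \<Rightarrow> 'a \<Rightarrow> 'a \<Rightarrow> 'a" (infixl \<open>-.\<index>\<close> 65) where
  "f -. g = f +. hneg C g" for C (structure)

text \<open>Simp rewrites the notions at \<open>opc C\<close> to their duals in \<open>C\<close>, so
  that many dual statements are instances of the original ones instead of second proofs.\<close>

definition opc :: "('o, 'a) cat \<Rightarrow> ('o, 'a) cat" where
  "opc C = \<lparr>arrs = arrs C, src = tgt C, tgt = src C, idn = idn C, cmp = (\<lambda>g f. cmp C f g),
     hadd = hadd C, nul = (\<lambda>x y. nul C y x)\<rparr>"

lemma opc_simps [simp]: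
  "arrs (opc C) = arrs C" "src (opc C) = tgt C" "tgt (opc C) = src C" "idn (opc C) = idn C"
  "cmp (opc C) g f = cmp C f g" "hadd (opc C) = hadd C" "nul (opc C) x y = nul C y x"
  by (simp_all add: opc_def)

lemma Mor_opc [simp]: "Mor (opc C) x y = Mor C y x"
  by (auto simp: Mor_def)

lemma MorGrp_opc [simp]: "MorGrp (opc C) x y = MorGrp C y x"
  by (simp add: MorGrp_def)

lemma hneg_opc [simp]: "hneg (opc C) f = hneg C f"
  by (simp add: hneg_def)

lemma hsub_opc [simp]: "hsub (opc C) f g = hsub C f g"
  by (simp add: hsub_def)

context category
begin

text \<open>This and the following rules recast the axioms with equations on \<open>src\<close> and
  \<open>tgt\<close> as side conditions: typing becomes a matter for simp, and composites are
  normalised to the right.\<close>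

lemma cmp_arr [simp]:
  assumes "f \<in> arrs C" "g \<in> arrs C" "tgt C f = src C g"
  shows "g \<cdot> f \<in> arrs C" "src C (g \<cdot> f) = src C f" "tgt C (g \<cdot> f) = tgt C g"
  using cmp_Mor[of f "src C f" "tgt C f" g "tgt C g"] assms by (auto simp: Mor_def)

lemma cmp_assoc' [simp]:
  "\<lbrakk>f \<in> arrs C; g \<in> arrs C; h \<in> arrs C; tgt C f = src C g; tgt C g = src C h\<rbrakk>
    \<Longrightarrow> (h \<cdot> g) \<cdot> f = h \<cdot> (g \<cdot> f)"
  by (rule cmp_assoc[of f "src C f" "tgt C f" g "tgt C g" h "tgt C h"]) (auto simp: Mor_def)

lemma idn_arr [simp]: "idn C x \<in> arrs C" "src C (idn C x) = x" "tgt C (idn C x) = x"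
  using idn_Mor[of x] by (auto simp: Mor_def)

lemma cmp_idn' [simp]: "\<lbrakk>f \<in> arrs C; src C f = x\<rbrakk> \<Longrightarrow> f \<cdot> idn C x = f"
  using cmp_idn[of f x "tgt C f"] by (auto simp: Mor_def)

lemma idn_cmp' [simp]: "\<lbrakk>f \<in> arrs C; tgt C f = y\<rbrakk> \<Longrightarrow> idn C y \<cdot> f = f"
  using idn_cmp[of f "src C f" y] by (auto simp: Mor_def)

text \<open>In composites nested to the right, a known value of \<open>g \<cdot> f\<close> no longer
  matches \<open>g \<cdot> (f \<cdot> h)\<close>. The rule turns such an equation into one that
  does.\<close>

lemma reassoc:
  "\<lbrakk>g \<cdot> f = t; h \<in> arrs C; f \<in> arrs C; g \<in> arrs C; tgt C h = src C f; tgt C f = src C g\<rbrakk>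
    \<Longrightarrow> g \<cdot> (f \<cdot> h) = t \<cdot> h"
  using cmp_assoc' by metis

end

context preadditive_category
begin

lemma grp: "comm_group (MorGrp C x y)" "group (MorGrp C x y)" "monoid (MorGrp C x y)"
  using Mor_group comm_group.axioms(2) group.is_monoid by blast+

lemma MorGrp_simps [simp]: "carrier (MorGrp C x y) = Mor C x y" "mult (MorGrp C x y) = hadd C"
  "one (MorGrp C x y) = nul C x y"
  by (simp_all add: MorGrp_def)

lemma nul_arr [simp]: "nul C x y \<in> arrs C" "src C (nul C x y) = x" "tgt C (nul C x y) = y"
  using monoid.one_closed[OF grp(3), of x y] by (auto simp: Mor_def)

lemma hadd_arr [simp]:
  assumes "f \<in> arrs C" "g \<in> arrs C" "src C f = src C g" "tgt C f = tgt C g"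
  shows "f +. g \<in> arrs C" "src C (f +. g) = src C g" "tgt C (f +. g) = tgt C g"
  using monoid.m_closed[OF grp(3), of f "src C g" "tgt C g" g] assms by (auto simp: Mor_def)

lemma hneg_arr [simp]:
  assumes "f \<in> arrs C" shows "hneg C f \<in> arrs C" "src C (hneg C f) = src C f"
    "tgt C (hneg C f) = tgt C f"
  using group.inv_closed[OF grp(2), of f "src C f" "tgt C f"] assms by (auto simp: Mor_def hneg_def)

lemma hsub_arr [simp]:
  assumes "f \<in> arrs C" "g \<in> arrs C" "src C f = src C g" "tgt C f = tgt C g"
  shows "f -. g \<in> arrs C" "src C (f -. g) = src C g" "tgt C (f -. g) = tgt C g"
  using assms by (auto simp: hsub_def)

lemma hadd_assoc [simp]: "\<lbrakk>f \<in> arrs C; g \<in> arrs C; h \<in> arrs C; src C f = src C g; tgt C f = tgt C g;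
   src C g = src C h; tgt C g = tgt C h\<rbrakk> \<Longrightarrow> (f +. g) +. h = f +. (g +. h)"
  using monoid.m_assoc[OF grp(3), of f "src C h" "tgt C h" g h] by (auto simp: Mor_def)

lemma hadd_commute: "\<lbrakk>f \<in> arrs C; g \<in> arrs C; src C f = src C g; tgt C f = tgt C g\<rbrakk> \<Longrightarrow>
    f +. g = g +. f"
  using comm_monoid.m_comm[OF comm_group.axioms(1)[OF grp(1)], of f "src C g" "tgt C g" g]
    by (auto simp: Mor_def)

lemma hadd_left_commute: "\<lbrakk>f \<in> arrs C; g \<in> arrs C; h \<in> arrs C; src C f = src C g; tgt C f = tgt C g;
   src C g = src C h; tgt C g = tgt C h\<rbrakk> \<Longrightarrow> f +. (g +. h) = g +. (f +. h)"
  by (metis hadd_assoc hadd_commute)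

lemma nul_hadd [simp]: "\<lbrakk>f \<in> arrs C; src C f = x; tgt C f = y\<rbrakk> \<Longrightarrow> nul C x y +. f = f"
  using monoid.l_one[OF grp(3), of f x y] by (auto simp: Mor_def)

lemma hadd_nul [simp]: "\<lbrakk>f \<in> arrs C; src C f = x; tgt C f = y\<rbrakk> \<Longrightarrow> f +. nul C x y = f"
  using monoid.r_one[OF grp(3), of f x y] by (auto simp: Mor_def)

lemma hadd_hneg [simp]: "f \<in> arrs C \<Longrightarrow> f +. hneg C f = nul C (src C f) (tgt C f)"
  using group.r_inv[OF grp(2), of f "src C f" "tgt C f"] by (auto simp: Mor_def hneg_def)

lemma hneg_hadd [simp]: "f \<in> arrs C \<Longrightarrow> hneg C f +. f = nul C (src C f) (tgt C f)"
  using group.l_inv[OF grp(2), of f "src C f" "tgt C f"] by (auto simp: Mor_def hneg_def)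

lemma hadd_cancel: "\<lbrakk>f +. g = f +. h; f \<in> arrs C; g \<in> arrs C; h \<in> arrs C; src C f =
    src C g; tgt C f = tgt C g;
   src C f = src C h; tgt C f = tgt C h\<rbrakk> \<Longrightarrow> g = h"
  using group.right_cancel[OF grp(2), of f "src C h" "tgt C h" g h]
    by (auto simp: Mor_def hadd_commute)

lemma hsub_self [simp]: "f \<in> arrs C \<Longrightarrow> f -. f = nul C (src C f) (tgt C f)"
  by (simp add: hsub_def)

lemma hsub_hadd [simp]: "\<lbrakk>f \<in> arrs C; g \<in> arrs C; src C f = src C g; tgt C f = tgt C g\<rbrakk> \<Longrightarrow>
    (f -. g) +. g = f"
  by (simp add: hsub_def)

lemma hadd_hsub [simp]: "\<lbrakk>f \<in> arrs C; g \<in> arrs C; src C f = src C g; tgt C f = tgt C g\<rbrakk> \<Longrightarrow>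
    (f +. g) -. g = f"
  by (simp add: hsub_def)

lemma hsub_eq_nulD: "\<lbrakk>f -. g = nul C x y; f \<in> arrs C; g \<in> arrs C; src C f = x; tgt C f =
    y; src C g = x; tgt C g = y\<rbrakk> \<Longrightarrow> f = g"
  using hsub_hadd[of f g] by simp

lemma cmp_hadd [simp]: "\<lbrakk>f \<in> arrs C; f' \<in> arrs C; g \<in> arrs C; src C f = src C f'; tgt C f =
    tgt C f'; tgt C f' = src C g\<rbrakk>
   \<Longrightarrow> g \<cdot> (f +. f') = g \<cdot> f +. g \<cdot> f'"
  by (rule cmp_plus[of f "src C f" "tgt C f"]) (auto simp: Mor_def)

lemma hadd_cmp [simp]: "\<lbrakk>f \<in> arrs C; g' \<in> arrs C; g \<in> arrs C; src C g = src C g'; tgt C g =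
    tgt C g'; tgt C f = src C g'\<rbrakk>
   \<Longrightarrow> (g +. g') \<cdot> f = g \<cdot> f +. g' \<cdot> f"
  by (rule plus_cmp[of f "src C f" "tgt C f"]) (auto simp: Mor_def)

lemma cmp_nul [simp]: "\<lbrakk>g \<in> arrs C; src C g = y\<rbrakk> \<Longrightarrow> g \<cdot> nul C x y = nul C x (tgt C g)"
  using cmp_hadd[of "nul C x y" "nul C x y" g] hadd_cancel[of "g \<cdot> nul C x y" "g \<cdot> nul C x y"
    "nul C x (tgt C g)"]
  by simp

lemma nul_cmp [simp]: "\<lbrakk>g \<in> arrs C; tgt C g = y\<rbrakk> \<Longrightarrow> nul C y x \<cdot> g = nul C (src C g) x"
  using hadd_cmp[of g "nul C y x" "nul C y x"] hadd_cancel[of "nul C y x \<cdot> g" "nul C y x \<cdot> g"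
    "nul C (src C g) x"]
  by simp

lemma cmp_hneg [simp]: "\<lbrakk>f \<in> arrs C; g \<in> arrs C; tgt C f = src C g\<rbrakk> \<Longrightarrow> g \<cdot> hneg C f = hneg C (g \<cdot> f)"
  by (rule hadd_cancel[of "g \<cdot> f"], subst cmp_hadd[symmetric]) simp_all

lemma hneg_cmp [simp]: "\<lbrakk>f \<in> arrs C; g \<in> arrs C; tgt C f = src C g\<rbrakk> \<Longrightarrow> hneg C g \<cdot> f = hneg C (g \<cdot> f)"
  by (rule hadd_cancel[of "g \<cdot> f"], subst hadd_cmp[symmetric]) simp_all

lemma hneg_hneg [simp]: "f \<in> arrs C \<Longrightarrow> hneg C (hneg C f) = f"
  by (rule hadd_cancel[of "hneg C f"]) simp_all

lemma hneg_nul [simp]: "hneg C (nul C x y) = nul C x y"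
  using hadd_hneg[of "nul C x y"] nul_hadd[of "hneg C (nul C x y)"] by simp

lemma hneg_sum [simp]: "\<lbrakk>f \<in> arrs C; g \<in> arrs C; src C f = src C g; tgt C f = tgt C g\<rbrakk> \<Longrightarrow>
    hneg C (f +. g) = hneg C f +. hneg C g"
  using comm_group.inv_mult[OF grp(1), of f "src C g" "tgt C g" g] by (simp add: hneg_def Mor_def)

lemma hneg_cancel [simp]: "\<lbrakk>f \<in> arrs C; g \<in> arrs C; src C f = src C g; tgt C f = tgt C g\<rbrakk> \<Longrightarrow>
    f +. (hneg C f +. g) = g"
  "\<lbrakk>f \<in> arrs C; g \<in> arrs C; src C f = src C g; tgt C f = tgt C g\<rbrakk> \<Longrightarrow> hneg C f +. (f +. g) = g"
  by (simp_all flip: hadd_assoc)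

lemma cmp_hsub [simp]: "\<lbrakk>f \<in> arrs C; f' \<in> arrs C; g \<in> arrs C; src C f = src C f'; tgt C f =
    tgt C f'; tgt C f' = src C g\<rbrakk>
   \<Longrightarrow> g \<cdot> (f -. f') = g \<cdot> f -. g \<cdot> f'"
  by (simp add: hsub_def)

lemma hsub_cmp [simp]: "\<lbrakk>f \<in> arrs C; g' \<in> arrs C; g \<in> arrs C; src C g = src C g'; tgt C g =
    tgt C g'; tgt C f = src C g'\<rbrakk>
   \<Longrightarrow> (g -. g') \<cdot> f = g \<cdot> f -. g' \<cdot> f"
  by (simp add: hsub_def)

lemma hsub_nul [simp]: "\<lbrakk>f \<in> arrs C; src C f = x; tgt C f = y\<rbrakk> \<Longrightarrow> f -. nul C x y = f"
  by (simp add: hsub_def)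

lemma hsub_hsub: "\<lbrakk>f \<in> arrs C; g \<in> arrs C; src C f = src C g; tgt C f = tgt C g\<rbrakk> \<Longrightarrow>
    f -. (f -. g) = g"
  by (simp add: hsub_def)

lemma nul_hsub [simp]: "\<lbrakk>f \<in> arrs C; src C f = x; tgt C f = y\<rbrakk> \<Longrightarrow> nul C x y -. f = hneg C f"
  by (simp add: hsub_def)

lemma is_epiI:
  assumes "f \<in> arrs C" "\<And>g. \<lbrakk>g \<in> arrs C; src C g = tgt C f; g \<cdot> f = nul C (src C f) (tgt C g)\<rbrakk> \<Longrightarrow>
      g = nul C (tgt C f) (tgt C g)"
  shows "is_epi C f"
  unfolding is_epi_def
proof (intro conjI allI ballI impI)
  fix y g h assume *: "g \<in> Mor C (tgt C f) y" "h \<in> Mor C (tgt C f) y" "g \<cdot> f = h \<cdot> f"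
  then have "g -. h = nul C (tgt C f) y"
    using assms(2)[of "g -. h"] assms(1) by (simp add: Mor_def)
  then show "g = h" using * by (intro hsub_eq_nulD[of g h "tgt C f" y]) (simp_all add: Mor_def)
qed fact

lemma is_epiD: "\<lbrakk>is_epi C f; g \<cdot> f = h \<cdot> f; g \<in> arrs C; h \<in> arrs C; src C g = tgt C f; src C h =
    tgt C f; tgt C g = tgt C h\<rbrakk> \<Longrightarrow> g = h"
  unfolding is_epi_def Mor_def by auto

lemma is_epi_arr: "is_epi C f \<Longrightarrow> f \<in> arrs C" unfolding is_epi_def by simp

lemma is_epi_cmp:
  assumes "is_epi C f" "is_epi C g" "tgt C f = src C g" shows "is_epi C (g \<cdot> f)"
proof (rule is_epiI)
  note [simp] = is_epi_arr[OF assms(1)] is_epi_arr[OF assms(2)] assms(3)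
  show "g \<cdot> f \<in> arrs C" by simp
  fix h assume [simp]: "h \<in> arrs C" "src C h = tgt C (g \<cdot> f)"
    and *: "h \<cdot> (g \<cdot> f) = nul C (src C (g \<cdot> f)) (tgt C h)"
  have "h \<cdot> g = nul C (src C g) (tgt C h)"
    by (rule is_epiD[OF assms(1)]) (use * in simp_all)
  with is_epiD[OF assms(2), of h "nul C (src C h) (tgt C h)"]
  show "h = nul C (tgt C (g \<cdot> f)) (tgt C h)" by simp
qed

lemma is_epi_cmpD: "\<lbrakk>is_epi C (g \<cdot> f); f \<in> arrs C; g \<in> arrs C; tgt C f = src C g\<rbrakk> \<Longrightarrow> is_epi C g"
  by (rule is_epiI) (simp, rule is_epiD[of "g \<cdot> f"], simp_all flip: cmp_assoc')

end

lemma is_mono_opc [simp]: "is_mono (opc C) f = is_epi C f"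
  by (simp add: is_mono_def is_epi_def)

lemma is_epi_opc [simp]: "is_epi (opc C) f = is_mono C f"
  by (simp add: is_mono_def is_epi_def)

lemma is_kernel_opc [simp]: "is_kernel (opc C) f k = is_cokernel C f k"
  by (simp add: is_kernel_def is_cokernel_def)

lemma is_cokernel_opc [simp]: "is_cokernel (opc C) f k = is_kernel C f k"
  by (simp add: is_kernel_def is_cokernel_def)

lemma short_exact_opc [simp]: "short_exact (opc C) i p = short_exact C p i"
  by (auto simp: short_exact_def)

lemma category_opc: "category C \<Longrightarrow> category (opc C)"
  by (unfold_locales) (simp_all add: category.idn_Mor category.cmp_Mor category.cmp_idn
    category.idn_cmp category.cmp_assoc)

lemma preadditive_category_opc: assumes "preadditive_category C"
  shows "preadditive_category (opc C)"
proof -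
  interpret preadditive_category C by fact
  interpret o: category "opc C" by (intro category_opc) unfold_locales
  show ?thesis
    by (intro preadditive_category.intro preadditive_category_axioms.intro o.category_axioms)
      (simp_all add: grp cmp_plus plus_cmp)
qed

lemma is_biproduct_opc: "is_biproduct C x y s i j p q \<Longrightarrow> is_biproduct (opc C) x y s p q i j"
  by (simp add: is_biproduct_def)

lemma is_zero_opc [simp]: "is_zero (opc C) z = is_zero C z"
  unfolding is_zero_def Mor_opc by blast

lemma abelian_category_opc: assumes "abelian_category C" shows "abelian_category (opc C)"
proof -
  interpret abelian_category C by fact
  have "\<exists>s i j p q. is_biproduct (opc C) x y s i j p q" for x y
    using biproduct_exists[of x y] is_biproduct_opc by metis
  then show ?thesis
    by (intro abelian_category.intro abelian_category_axioms.intro preadditive_category_opc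
      preadditive_category_axioms)
      (simp_all add: zero_exists kernel_exists cokernel_exists mono_normal epi_normal)
qed

context preadditive_category
begin

lemmas is_monoI = preadditive_category.is_epiI[OF preadditive_category_opc[OF
  preadditive_category_axioms], simplified]
lemmas is_monoD = preadditive_category.is_epiD[OF preadditive_category_opc[OF
  preadditive_category_axioms], simplified]
lemmas is_mono_arr = preadditive_category.is_epi_arr[OF preadditive_category_opc[OF
  preadditive_category_axioms], simplified]
lemmas is_mono_cmpD = preadditive_category.is_epi_cmpD[OF preadditive_category_opc[OF
  preadditive_category_axioms], simplified]

end

section \<open>Short exact sequences and pullbacks\<close>

text \<open>Stated with arrows alone, and with existence and uniqueness of the mediating arrow as
  separate clauses; a pushout in \<open>C\<close> is then a pullback in
  \<open>opc C\<close>.\<close>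

definition is_pullback :: "('o, 'a) cat \<Rightarrow> 'a \<Rightarrow> 'a \<Rightarrow> 'a \<Rightarrow> 'a \<Rightarrow> bool" where
  "is_pullback C f g p q \<longleftrightarrow> f \<in> arrs C \<and> g \<in> arrs C \<and> p \<in> arrs C \<and> q \<in> arrs C \<and> tgt C f = tgt C g \<and>
     src C p = src C q \<and> tgt C p = src C f \<and> tgt C q = src C g \<and> f \<cdot> p = g \<cdot> q \<and>
     (\<forall>a\<in>arrs C. \<forall>b\<in>arrs C. src C a = src C b \<and> tgt C a = src C f \<and> tgt C b = src C g \<and> f \<cdot> a = g \<cdot>
       b \<longrightarrow>
        (\<exists>h\<in>arrs C. src C h = src C b \<and> tgt C h = src C q \<and> p \<cdot> h = a \<and> q \<cdot> h = b)) \<and>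
     (\<forall>h\<in>arrs C. \<forall>h'\<in>arrs C. src C h = src C h' \<and> tgt C h = src C q \<and> tgt C h' = src C q \<and>
        p \<cdot> h = p \<cdot> h' \<and> q \<cdot> h = q \<cdot> h' \<longrightarrow> h = h')"
  for C (structure)

text \<open>Vanishing of Ext^1(X, Y) in elementary terms. Retractions are required here;
  \<open>split_section\<close> trades them for sections, which makes the notion self-dual.\<close>

definition splits :: "('o, 'a) cat \<Rightarrow> 'o \<Rightarrow> 'o \<Rightarrow> bool" where
  "splits C X Y \<longleftrightarrow> (\<forall>i p. short_exact C i p \<and> src C i = Y \<and> tgt C p = X \<longrightarrow>
     (\<exists>r\<in>arrs C. src C r = tgt C i \<and> tgt C r = Y \<and> r \<cdot> i = idn C Y))"
  for C (structure)

section \<open>Kernels and pullbacks\<close>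

context preadditive_category
begin

lemma kernelD:
  assumes "is_kernel C f k"
  shows "f \<in> arrs C" "k \<in> arrs C" "tgt C k = src C f" "f \<cdot> k = nul C (src C k) (tgt C f)"
  using assms by (auto simp: is_kernel_def)

lemma kernel_lift:
  assumes "is_kernel C f k" "g \<in> arrs C" "tgt C g = src C f" "f \<cdot> g = nul C (src C g) (tgt C f)"
  obtains h where "h \<in> arrs C" "src C h = src C g" "tgt C h = src C k" "k \<cdot> h = g"
proof -
  have "g \<in> Mor C (src C g) (src C f)" using assms by (simp add: Mor_def)
  with assms obtain h where "h \<in> Mor C (src C g) (src C k)" "k \<cdot> h = g"
    unfolding is_kernel_def by blast
  then show ?thesis by (intro that) (simp_all add: Mor_def)
qed

lemma kernel_mono: assumes "is_kernel C f k" shows "is_mono C k"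
  unfolding is_mono_def
proof (intro conjI allI ballI impI)
  note [simp] = kernelD[OF assms]
  show "k \<in> arrs C" by simp
  fix x g h assume *: "g \<in> Mor C x (src C k)" "h \<in> Mor C x (src C k)" "k \<cdot> g = k \<cdot> h"
  then have "k \<cdot> g \<in> Mor C x (src C f)" "f \<cdot> (k \<cdot> g) = nul C x (tgt C f)"
    by (simp_all add: Mor_def reassoc[of f k] del: *(3))
  with assms * show "g = h" unfolding is_kernel_def by metis
qed

lemma kernelI:
  assumes "is_mono C k" "f \<in> arrs C" "tgt C k = src C f" "f \<cdot> k = nul C (src C k) (tgt C f)"
    and "\<And>g. \<lbrakk>g \<in> arrs C; tgt C g = src C f; f \<cdot> g = nul C (src C g) (tgt C f)\<rbrakk>
       \<Longrightarrow> \<exists>h\<in>arrs C. src C h = src C g \<and> tgt C h = src C k \<and> k \<cdot> h = g"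
  shows "is_kernel C f k"
  unfolding is_kernel_def
proof (intro conjI allI ballI impI)
  show "k \<in> arrs C" using assms(1) is_mono_arr by blast
  fix x g assume "g \<in> Mor C x (src C f)" "f \<cdot> g = nul C x (tgt C f)"
  then obtain h where h: "h \<in> arrs C" "src C h = x" "tgt C h = src C k" "k \<cdot> h = g"
    using assms(5)[of g] by (auto simp: Mor_def)
  show "\<exists>!h. h \<in> Mor C x (src C k) \<and> k \<cdot> h = g"
  proof (rule ex1I[of _ h])
    show "h' = h" if "h' \<in> Mor C x (src C k) \<and> k \<cdot> h' = g" for h'
      using that h is_monoD[OF assms(1), of h' h] by (simp add: Mor_def)
  qed (use h in \<open>simp add: Mor_def\<close>)
qed (use assms in simp_all)

lemma biproductD:
  assumes "is_biproduct C x y s i j p q"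
  shows "i \<in> arrs C" "j \<in> arrs C" "p \<in> arrs C" "q \<in> arrs C" "src C i = x" "src C j = y"
    "src C p = s" "src C q = s"
    "tgt C i = s" "tgt C j = s" "tgt C p = x" "tgt C q = y"
    "p \<cdot> i = idn C x" "q \<cdot> j = idn C y" "q \<cdot> i = nul C x y" "p \<cdot> j = nul C y x"
    "\<And>t. t \<in> arrs C \<Longrightarrow> tgt C t = s \<Longrightarrow> i \<cdot> (p \<cdot> t) +. j \<cdot> (q \<cdot> t) = t"
proof -
  show *: "i \<in> arrs C" "j \<in> arrs C" "p \<in> arrs C" "q \<in> arrs C" "src C i = x" "src C j = y"
    "src C p = s" "src C q = s"
    "tgt C i = s" "tgt C j = s" "tgt C p = x" "tgt C q = y"
    "p \<cdot> i = idn C x" "q \<cdot> j = idn C y" "q \<cdot> i = nul C x y" "p \<cdot> j = nul C y x"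
    using assms by (auto simp: is_biproduct_def Mor_def)
  have e: "i \<cdot> p +. j \<cdot> q = idn C s" using assms by (simp add: is_biproduct_def)
  show "i \<cdot> (p \<cdot> t) +. j \<cdot> (q \<cdot> t) = t" if "t \<in> arrs C" "tgt C t = s" for t
    using arg_cong[OF e, of "\<lambda>x. x \<cdot> t"] that * by simp
qed

lemma is_pullback_sym: "is_pullback C f g p q \<Longrightarrow> is_pullback C g f q p"
  unfolding is_pullback_def by metis

lemma pullbackD:
  assumes "is_pullback C f g p q"
  shows "f \<in> arrs C" "g \<in> arrs C" "p \<in> arrs C" "q \<in> arrs C" "tgt C f = tgt C g"
     "src C p = src C q" "tgt C p = src C f" "tgt C q = src C g" "f \<cdot> p = g \<cdot> q"
  using assms unfolding is_pullback_def by auto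

lemma pullback_lift:
  assumes "is_pullback C f g p q" "a \<in> arrs C" "b \<in> arrs C" "src C a = src C b" "tgt C a = src C f"
    "tgt C b = src C g" "f \<cdot> a = g \<cdot> b"
  obtains h where "h \<in> arrs C" "src C h = src C b" "tgt C h = src C q" "p \<cdot> h = a" "q \<cdot> h = b"
  using assms unfolding is_pullback_def by blast

lemma pullback_unique:
  assumes "is_pullback C f g p q" "p \<cdot> h = p \<cdot> h'" "q \<cdot> h = q \<cdot> h'" "h \<in> arrs C" "h' \<in> arrs C"
    "src C h = src C h'" "tgt C h = src C q" "tgt C h' = src C q"
  shows "h = h'"
  using assms unfolding is_pullback_def by blast

text \<open>Pairing \<open>k\<close> with the zero arrow gives an arrow into the pullback, which is
  mono because \<open>k\<close> is. An arrow killed by \<open>p\<close> is carried by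
  \<open>q\<close> into the kernel of \<open>g\<close>, so it factors.\<close>

lemma pullback_kernel:
  assumes "is_pullback C f g p q" "is_kernel C g k"
  obtains k' where "is_kernel C p k'" "q \<cdot> k' = k" "src C k' = src C k"
proof -
  note [simp] = pullbackD[OF assms(1)] kernelD[OF assms(2)]
  obtain k' where k' [simp]: "k' \<in> arrs C" "src C k' = src C k" "tgt C k' = src C q"
    "p \<cdot> k' = nul C (src C k) (src C f)" "q \<cdot> k' = k"
    by (rule pullback_lift[OF assms(1), of "nul C (src C k) (src C f)" k]) simp_all
  have "is_kernel C p k'"
  proof (rule kernelI)
    have "is_mono C (q \<cdot> k')" using kernel_mono[OF assms(2)] by simp
    then show "is_mono C k'" by (rule is_mono_cmpD) simp_all
    fix t assume t [simp]: "t \<in> arrs C" "tgt C t = src C p" "p \<cdot> t = nul C (src C t) (tgt C p)"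
    have "g \<cdot> (q \<cdot> t) = f \<cdot> (p \<cdot> t)" by (simp add: reassoc[OF pullbackD(9)[OF assms(1)]] del: t(3))
    then have "g \<cdot> q \<cdot> t = nul C (src C (q \<cdot> t)) (tgt C g)" by simp
    then obtain h where h [simp]: "h \<in> arrs C" "src C h = src C t" "tgt C h = src C k"
      "k \<cdot> h = q \<cdot> t"
      using kernel_lift[OF assms(2), of "q \<cdot> t"] by auto
    have "k' \<cdot> h = t"
      by (rule pullback_unique[OF assms(1)]) (simp_all add: reassoc[of p k'] reassoc[of q k'])
    then show "\<exists>h\<in>arrs C. src C h = src C t \<and> tgt C h = src C k' \<and> k' \<cdot> h = t"
      by (intro bexI[of _ h]) simp_all
  qed simp_all
  then show ?thesis by (intro that[of k']) simp_all
qed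

end

lemmas (in preadditive_category)
  cokernelD = preadditive_category.kernelD[OF preadditive_category_opc[OF
  preadditive_category_axioms], simplified]
lemmas (in preadditive_category)
  cokernel_colift = preadditive_category.kernel_lift[OF preadditive_category_opc[OF
  preadditive_category_axioms], simplified]
lemmas (in preadditive_category)
  cokernel_epi = preadditive_category.kernel_mono[OF preadditive_category_opc[OF
  preadditive_category_axioms], simplified]

section \<open>Short exact sequences: pullbacks, pushouts and splittings\<close>

context abelian_category
begin

text \<open>A mono \<open>i\<close> is the kernel of some \<open>g\<close>. As
  \<open>g \<cdot> i\<close> vanishes, \<open>g\<close> factors through the cokernel
  \<open>c\<close>, so everything killed by \<open>c\<close> is killed by \<open>g\<close> and
  factors through \<open>i\<close>.\<close>

lemma mono_kernel_cokernel:
  assumes "is_mono C i" "is_cokernel C i c" shows "short_exact C i c"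
proof -
  obtain g where g: "is_kernel C g i" using mono_normal[OF assms(1)] by blast
  note [simp] = kernelD[OF g] cokernelD[OF assms(2)]
  obtain g' where g' [simp]: "g' \<in> arrs C" "src C g' = tgt C c" "tgt C g' = tgt C g" "g' \<cdot> c = g"
    by (rule cokernel_colift[OF assms(2), of g]) simp_all
  have "is_kernel C c i"
  proof (rule kernelI)
    fix t assume t [simp]: "t \<in> arrs C" "tgt C t = src C c" "c \<cdot> t = nul C (src C t) (tgt C c)"
    have "g \<cdot> t = g' \<cdot> (c \<cdot> t)" by (subst g'(4)[symmetric], subst cmp_assoc') (simp_all del: g'(4)
      t(3))
    then have "g \<cdot> t = nul C (src C t) (tgt C g)" by simp
    from kernel_lift[OF g _ _ this]
    show "\<exists>h\<in>arrs C. src C h = src C t \<and> tgt C h = src C i \<and> i \<cdot> h = t" by auto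
  qed (simp_all add: assms(1))
  then show ?thesis using assms by (simp add: short_exact_def)
qed

lemma mono_ses: assumes "is_mono C i" obtains p where "short_exact C i p"
  using cokernel_exists[of i] mono_kernel_cokernel[OF assms] is_mono_arr[OF assms] by blast

lemma sesD:
  assumes "short_exact C i p"
  shows "i \<in> arrs C" "p \<in> arrs C" "src C p = tgt C i" "p \<cdot> i = nul C (src C i) (tgt C p)"
    "\<And>t. \<lbrakk>t \<in> arrs C; tgt C t = src C i\<rbrakk> \<Longrightarrow> p \<cdot> (i \<cdot> t) = nul C (src C t) (tgt C p)"
    "is_mono C i" "is_epi C p"
proof -
  have k: "is_kernel C p i" "is_cokernel C i p" using assms by (auto simp: short_exact_def)
  show 1 [simp]: "i \<in> arrs C" "p \<in> arrs C" "src C p = tgt C i" "p \<cdot> i = nul C (src C i) (tgt C p)"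
    using kernelD[OF k(1)] by simp_all
  show "p \<cdot> (i \<cdot> t) = nul C (src C t) (tgt C p)" if "t \<in> arrs C" "tgt C t = src C i" for t
    using that by (simp add: reassoc[of p i])
  show "is_mono C i" "is_epi C p" using k kernel_mono cokernel_epi by blast+
qed

lemma ses_lift:
  assumes "short_exact C i p" "g \<in> arrs C" "tgt C g = tgt C i" "p \<cdot> g = nul C (src C g) (tgt C p)"
  obtains h where "h \<in> arrs C" "src C h = src C g" "tgt C h = src C i" "i \<cdot> h = g"
  using assms kernel_lift[of p i g] sesD(3)[OF assms(1)] by (auto simp: short_exact_def)

lemma ses_colift:
  assumes "short_exact C i p" "g \<in> arrs C" "src C g = tgt C i" "g \<cdot> i = nul C (src C i) (tgt C g)"
  obtains h where "h \<in> arrs C" "tgt C h = tgt C g" "src C h = tgt C p" "h \<cdot> p = g"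
  using assms cokernel_colift[of i p g] by (auto simp: short_exact_def)

text \<open>The pullback is the kernel of the difference \<open>\<phi>\<close> of the two composites
  on a biproduct. If \<open>g\<close> is epi, so is \<open>\<phi>\<close>, because it restricts to
  \<open>hneg C g\<close> along \<open>j\<close>; hence it is a cokernel of \<open>k\<close>. For
  \<open>t\<close> killing the projection, \<open>t \<cdot> \<pi>\<close> is then some
  \<open>u \<cdot> \<phi>\<close>; restriction along \<open>j\<close> shows that \<open>u\<close>
  vanishes, and restriction along \<open>i\<close> that \<open>t\<close> does.\<close>

lemma pullback_exists:
  assumes [simp]: "f \<in> arrs C" "g \<in> arrs C" "tgt C f = tgt C g"
  obtains p q where "is_pullback C f g p q" "is_epi C g \<Longrightarrow> is_epi C p"
proof -
  obtain s i j \<pi> \<rho> where b: "is_biproduct C (src C f) (src C g) s i j \<pi> \<rho>" using biproduct_exists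
    by blast
  note [simp] = biproductD[OF b]
  define \<phi> where "\<phi> = f \<cdot> \<pi> -. g \<cdot> \<rho>"
  have \<phi> [simp]: "\<phi> \<in> arrs C" "src C \<phi> = s" "tgt C \<phi> = tgt C g" by (simp_all add: \<phi>_def)
  obtain k where k: "is_kernel C \<phi> k" using kernel_exists[of \<phi>] by auto
  note [simp] = kernelD[OF k]
  note [simp] = reassoc[OF biproductD(13)[OF b]] reassoc[OF biproductD(14)[OF b]]
    reassoc[OF biproductD(15)[OF b]] reassoc[OF biproductD(16)[OF b]]
  have "is_pullback C f g (\<pi> \<cdot> k) (\<rho> \<cdot> k)"
    unfolding is_pullback_def
  proof (intro conjI ballI impI; (elim conjE)?)
    have "f \<cdot> \<pi> \<cdot> k -. g \<cdot> \<rho> \<cdot> k = \<phi> \<cdot> k" by (subst \<phi>_def) (simp del: kernelD(4)[OF k])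
    then show "f \<cdot> \<pi> \<cdot> k = g \<cdot> \<rho> \<cdot> k"
      using hsub_eq_nulD[of "f \<cdot> \<pi> \<cdot> k" "g \<cdot> \<rho> \<cdot> k" "src C k" "tgt C g"] by simp
    fix a b assume [simp]: "a \<in> arrs C" "b \<in> arrs C" "src C a = src C b" "tgt C a = src C f"
      "tgt C b = src C g" "f \<cdot> a = g \<cdot> b"
    have "\<phi> \<cdot> (i \<cdot> a +. j \<cdot> b) = nul C (src C b) (tgt C g)" by (simp add: \<phi>_def)
    then obtain h where h [simp]: "h \<in> arrs C" "src C h = src C b" "tgt C h = src C k"
      "k \<cdot> h = i \<cdot> a +. j \<cdot> b"
      using kernel_lift[OF k, of "i \<cdot> a +. j \<cdot> b"] by auto
    show "\<exists>h\<in>arrs C. src C h = src C b \<and> tgt C h = src C (\<rho> \<cdot> k) \<and> (\<pi> \<cdot> k) \<cdot> h = a \<and>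
        (\<rho> \<cdot> k) \<cdot> h = b"
      by (intro bexI[of _ h]) simp_all
  next
    fix h h' assume [simp]: "h \<in> arrs C" "h' \<in> arrs C" "src C h = src C h'"
      "tgt C h = src C (\<rho> \<cdot> k)" "tgt C h' = src C (\<rho> \<cdot> k)"
     and *: "(\<pi> \<cdot> k) \<cdot> h = (\<pi> \<cdot> k) \<cdot> h'" "(\<rho> \<cdot> k) \<cdot> h = (\<rho> \<cdot> k) \<cdot> h'"
    have "k \<cdot> h = i \<cdot> \<pi> \<cdot> k \<cdot> h +. j \<cdot> \<rho> \<cdot> k \<cdot> h" by simp
    also have "\<dots> = i \<cdot> \<pi> \<cdot> k \<cdot> h' +. j \<cdot> \<rho> \<cdot> k \<cdot> h'" using * by (simp del: biproductD(17)[OF b])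
    also have "\<dots> = k \<cdot> h'" by simp
    finally show "h = h'" by (rule is_monoD[OF kernel_mono[OF k]]) simp_all
  qed simp_all
  moreover have "is_epi C (\<pi> \<cdot> k)" if g: "is_epi C g"
  proof (rule is_epiI)
    have e: "\<phi> \<cdot> j = hneg C g" by (simp add: \<phi>_def hsub_def)
    have "is_epi C \<phi>"
    proof (rule is_epiI)
      fix t assume [simp]: "t \<in> arrs C" "src C t = tgt C \<phi>"
        and t: "t \<cdot> \<phi> = nul C (src C \<phi>) (tgt C t)"
      have "hneg C (t \<cdot> g) = (t \<cdot> \<phi>) \<cdot> j" using e by simp
      also have "\<dots> = nul C (src C g) (tgt C t)" by (simp only: t) simp
      finally have "hneg C (hneg C (t \<cdot> g)) = hneg C (nul C (src C g) (tgt C t))" by (rule arg_cong)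
      then have "t \<cdot> g = nul C (src C g) (tgt C t)" by simp
      then show "t = nul C (tgt C \<phi>) (tgt C t)"
        by (intro is_epiD[OF g, of t "nul C (tgt C \<phi>) (tgt C t)"]) simp_all
    qed simp
    then obtain \<psi> where "is_cokernel C \<psi> \<phi>" using epi_normal by blast
    then have c: "short_exact C k \<phi>"
      using abelian_category.mono_kernel_cokernel[OF abelian_category_opc[OF
        abelian_category_axioms], of \<phi> k] k \<open>is_epi C \<phi>\<close>
      by simp
    fix t assume [simp]: "t \<in> arrs C" "src C t = tgt C (\<pi> \<cdot> k)"
      and t: "t \<cdot> \<pi> \<cdot> k = nul C (src C (\<pi> \<cdot> k)) (tgt C t)"
    obtain u where u [simp]: "u \<in> arrs C" "tgt C u = tgt C t" "src C u = tgt C \<phi>" "u \<cdot> \<phi> = t \<cdot> \<pi>"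
      by (rule ses_colift[OF c, of "t \<cdot> \<pi>"]) (use t in simp_all)
    have "hneg C (u \<cdot> g) = (u \<cdot> \<phi>) \<cdot> j" using e by (simp del: u(4))
    also have "\<dots> = nul C (src C g) (tgt C t)" by simp
    finally have "hneg C (hneg C (u \<cdot> g)) = hneg C (nul C (src C g) (tgt C t))" by (rule arg_cong)
    then have "u = nul C (tgt C g) (tgt C t)"
      by (intro is_epiD[OF g, of u "nul C (tgt C g) (tgt C t)"]) simp_all
    then have "t \<cdot> \<pi> = nul C s (tgt C t)" using u(4) by simp
    then have "(t \<cdot> \<pi>) \<cdot> i = nul C (src C f) (tgt C t)" by simp
    then show "t = nul C (tgt C (\<pi> \<cdot> k)) (tgt C t)" by simp
  qed simp
  ultimately show ?thesis using that by blast
qed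

lemmas epi_kernel_cokernel = abelian_category.mono_kernel_cokernel[OF abelian_category_opc[OF
  abelian_category_axioms], simplified]

lemma ses_pullback:
  assumes "short_exact C i p" "f \<in> arrs C" "tgt C f = tgt C p"
  obtains i' p' f' where "short_exact C i' p'" "src C i' = src C i" "tgt C p' = src C f"
    "is_pullback C f p p' f'" "f' \<cdot> i' = i"
proof -
  note [simp] = sesD[OF assms(1)] assms(2,3)
  obtain p' f' where 1: "is_pullback C f p p' f'" "is_epi C p \<Longrightarrow> is_epi C p'"
    using pullback_exists[of f p] by auto
  obtain i' where "is_kernel C p' i'" "f' \<cdot> i' = i" "src C i' = src C i"
    using pullback_kernel[OF 1(1), of i] assms(1) by (auto simp: short_exact_def)
  moreover have "tgt C p' = src C f" using pullbackD[OF 1(1)] by simp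
  ultimately show ?thesis using epi_kernel_cokernel[of p' i'] 1 that by simp
qed

lemma ses_pushout:
  assumes "short_exact C i p" "f \<in> arrs C" "src C f = src C i"
  obtains i' p' f' where "short_exact C i' p'" "tgt C p' = tgt C p" "src C i' = tgt C f"
    "is_pullback (opc C) f i i' f'" "p' \<cdot> f' = p"
proof -
  obtain p' i' f' where "short_exact (opc C) p' i'" "src (opc C) p' = src (opc C) p"
    "tgt (opc C) i' = src (opc C) f"
    "is_pullback (opc C) f i i' f'" "cmp (opc C) f' p' = p"
    by (rule abelian_category.ses_pullback[OF abelian_category_opc[OF abelian_category_axioms],
      of p i f]) (use assms in simp_all)
  then show ?thesis by (intro that[of i' p' f']) simp_all
qed

text \<open>The kernel of \<open>g \<cdot> f\<close> is the preimage of the kernel of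
  \<open>g\<close>, that is, the pullback of \<open>j\<close> along \<open>f\<close>, and as such an
  extension of \<open>src C j\<close> by \<open>src C i\<close>.\<close>

lemma comp_ses_epi:
  assumes "short_exact C i f" "short_exact C j g" "tgt C f = tgt C j"
  obtains k u v where "short_exact C k (g \<cdot> f)" "short_exact C u v" "src C u = src C i"
    "tgt C u = src C k" "tgt C v = src C j"
    "k \<cdot> u = i"
proof -
  note [simp] = sesD[OF assms(1)] sesD[OF assms(2)] assms(3)
  obtain u v k where 1: "short_exact C u v" "src C u = src C i" "tgt C v = src C j"
    "is_pullback C j f v k" "k \<cdot> u = i"
    by (rule ses_pullback[OF assms(1), of j]) simp_all
  note [simp] = pullbackD(1-4,6-8)[OF 1(4)] pullbackD(9)[OF 1(4), symmetric] sesD(1,2)[OF 1(1)]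
  have "is_kernel C (g \<cdot> f) k"
  proof (rule kernelI)
    show "is_mono C k"
    proof (rule is_monoI)
      fix t assume [simp]: "t \<in> arrs C" "tgt C t = src C k"
        and t: "k \<cdot> t = nul C (src C t) (tgt C k)"
      have "j \<cdot> (v \<cdot> t) = f \<cdot> (k \<cdot> t)" by (simp add: reassoc[OF pullbackD(9)[OF 1(4), symmetric]])
      then have v: "v \<cdot> t = nul C (src C t) (src C j)"
        by - (rule is_monoD[OF sesD(6)[OF assms(2)]], simp_all add: t)
      show "t = nul C (src C t) (src C k)"
        by (rule pullback_unique[OF 1(4)]) (use v t in simp_all)
    qed simp
    show "(g \<cdot> f) \<cdot> k = nul C (src C k) (tgt C (g \<cdot> f))" by simp
    fix t assume [simp]: "t \<in> arrs C" "tgt C t = src C (g \<cdot> f)"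
      and t: "(g \<cdot> f) \<cdot> t = nul C (src C t) (tgt C (g \<cdot> f))"
    obtain s where s: "s \<in> arrs C" "src C s = src C t" "tgt C s = src C j" "j \<cdot> s = f \<cdot> t"
      by (rule ses_lift[OF assms(2), of "f \<cdot> t"]) (use t in simp_all)
    obtain h where "h \<in> arrs C" "src C h = src C t" "tgt C h = src C k" "k \<cdot> h = t"
      using pullback_lift[OF 1(4), of s t] s by auto
    then show "\<exists>h\<in>arrs C. src C h = src C t \<and> tgt C h = src C k \<and> k \<cdot> h = t" by auto
  qed simp_all
  then have "short_exact C k (g \<cdot> f)" using epi_kernel_cokernel is_epi_cmp by simp
  moreover have "tgt C u = src C k" using pullbackD(6)[OF 1(4)] sesD(3)[OF 1(1)] by simp
  ultimately show ?thesis using 1 by (intro that[of k u v])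
qed

text \<open>The idempotent complementary to \<open>i \<cdot> r\<close> kills \<open>i\<close>, so it
  descends along \<open>p\<close>; the descended arrow is the section.\<close>

lemma split_section:
  assumes "short_exact C i p" "r \<in> arrs C" "src C r = tgt C i" "tgt C r = src C i"
    "r \<cdot> i = idn C (src C i)"
  obtains s where "s \<in> arrs C" "src C s = tgt C p" "tgt C s = tgt C i" "p \<cdot> s = idn C (tgt C p)"
proof -
  note [simp] = sesD[OF assms(1)] assms(2-5)
  obtain s where s [simp]: "s \<in> arrs C" "tgt C s = tgt C i" "src C s = tgt C p"
    "s \<cdot> p = idn C (tgt C i) -. i \<cdot> r"
    by (rule ses_colift[OF assms(1), of "idn C (tgt C i) -. i \<cdot> r"]) simp_all
  have "p \<cdot> s = idn C (tgt C p)"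
    by (rule is_epiD[OF sesD(7)[OF assms(1)]]) simp_all
  then show ?thesis by (intro that) simp_all
qed

lemma splits_opc_le: assumes "splits C X Y" shows "splits (opc C) Y X"
  unfolding splits_def
proof (intro allI impI, elim conjE)
  fix i p assume "short_exact (opc C) i p" "src (opc C) i = X" "tgt (opc C) p = Y"
  then have 1: "short_exact C p i" "tgt C i = X" "src C p = Y" by simp_all
  then obtain r where "r \<in> arrs C" "src C r = tgt C p" "tgt C r = src C p" "r \<cdot> p = idn C (src C p)"
    using assms unfolding splits_def by blast
  then obtain s where "s \<in> arrs C" "src C s = tgt C i" "tgt C s = tgt C p" "i \<cdot> s = idn C (tgt C i)"
    using split_section[OF 1(1)] by blast
  then show "\<exists>r\<in>arrs (opc C). src (opc C) r = tgt (opc C) i \<and> tgt (opc C) r = X \<and>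
      cmp (opc C) r i = idn (opc C) X"
    using 1 sesD(3)[OF 1(1)] by auto
qed

end

lemma opc_opc [simp]: "opc (opc C) = C"
  by (simp add: opc_def)

context abelian_category
begin

lemma splits_opc [simp]: "splits (opc C) Y X = splits C X Y"
  using splits_opc_le[of X Y] abelian_category.splits_opc_le[OF abelian_category_opc[OF
    abelian_category_axioms], of Y X] by auto

text \<open>In the pushout of the sequence along \<open>f\<close> the extension exists by
  construction, and a retraction of the pushed-out sequence brings it back to
  \<open>Y\<close>.\<close>

lemma splits_extend:
  assumes "splits C (tgt C p) Y" "short_exact C i p" "f \<in> arrs C" "src C f = src C i" "tgt C f = Y"
  obtains t where "t \<in> arrs C" "src C t = tgt C i" "tgt C t = Y" "t \<cdot> i = f"
proof -
  note [simp] = sesD[OF assms(2)] assms(3-5)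
  obtain i' p' f' where 1: "short_exact C i' p'" "tgt C p' = tgt C p" "src C i' = tgt C f"
    "is_pullback (opc C) f i i' f'" "p' \<cdot> f' = p"
    by (rule ses_pushout[OF assms(2), of f]) simp_all
  have [simp]: "f' \<in> arrs C" "i' \<in> arrs C" "i' \<cdot> f = f' \<cdot> i" "src C f' = tgt C i"
    "tgt C f' = tgt C i'"
    using 1(4) by (auto simp: is_pullback_def)
  obtain r where [simp]: "r \<in> arrs C" "src C r = tgt C i'" "tgt C r = Y" "r \<cdot> i' = idn C Y"
    using assms(1) 1 unfolding splits_def by auto
  have "(r \<cdot> f') \<cdot> i = (r \<cdot> i') \<cdot> f" using 1(3) by (subst cmp_assoc') simp_all
  then show ?thesis using 1(3) by (intro that[of "r \<cdot> f'"]) simp_all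
qed

lemma splits_lift:
  assumes "splits C X (src C i)" "short_exact C i p" "f \<in> arrs C" "tgt C f = tgt C p" "src C f = X"
  obtains t where "t \<in> arrs C" "tgt C t = tgt C i" "src C t = X" "p \<cdot> t = f"
  using abelian_category.splits_extend[OF abelian_category_opc[OF abelian_category_axioms],
    of i X p f] assms sesD(3)[OF assms(2)] by auto

end

section \<open>Yoneda extensions of length one and two\<close>

text \<open>A witness that the class of the exact sequence \<open>(a, b, c)\<close> in \<open>Ext\<^sup>2\<close> vanishes: an object through which
  \<open>b\<close> factors and which is at once an extension of \<open>src c\<close> by \<open>src a\<close> and of \<open>tgt c\<close> by \<open>tgt a\<close>.
  The conditions are self-dual.\<close>

definition weave :: "('o, 'a) cat \<Rightarrow> 'a \<Rightarrow> 'a \<Rightarrow> 'a \<Rightarrow> 'a \<Rightarrow> 'a \<Rightarrow> bool" where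
  "weave C a b c \<alpha> \<beta> \<longleftrightarrow> \<alpha> \<in> arrs C \<and> \<beta> \<in> arrs C \<and> src C \<alpha> = tgt C a \<and> src C \<beta> = tgt C \<alpha> \<and>
      tgt C \<beta> = src C c \<and>
     \<beta> \<cdot> \<alpha> = b \<and> short_exact C (\<alpha> \<cdot> a) \<beta> \<and> short_exact C \<alpha> (c \<cdot> \<beta>)"
  for C (structure)

text \<open>Vanishing of Ext^2(X, Y) in elementary terms. The two-step extension is given already
  cut at its middle image, into the sequences \<open>(a, e)\<close> and
  \<open>(k, c)\<close>.\<close>

definition splices :: "('o, 'a) cat \<Rightarrow> 'o \<Rightarrow> 'o \<Rightarrow> bool" where
  "splices C X Y \<longleftrightarrow> (\<forall>a e k c. short_exact C a e \<and> short_exact C k c \<and> src C a = Y \<and>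
      tgt C e = src C k \<and> tgt C c = X \<longrightarrow>
     (\<exists>\<alpha> \<beta>. weave C a (k \<cdot> e) c \<alpha> \<beta>))"
  for C (structure)

lemma weave_opc [simp]: "weave (opc C) c b a \<beta> \<alpha> \<longleftrightarrow> weave C a b c \<alpha> \<beta>"
  by (auto simp: weave_def)

lemma splices_opc_le: "splices C X Y \<Longrightarrow> splices (opc C) Y X"
  by (simp add: splices_def) metis

lemma splices_opc [simp]: "splices (opc C) Y X = splices C X Y"
  using splices_opc_le[of C X Y] splices_opc_le[of "opc C" Y X] by auto

section \<open>Cutting Yoneda extensions into short exact sequences\<close>

context abelian_category
begin

lemma kernel_mono_cmp:
  assumes "is_kernel C e a" "is_mono C k" "src C k = tgt C e"
  shows "is_kernel C (k \<cdot> e) a"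
proof -
  note [simp] = kernelD[OF assms(1)] is_mono_arr[OF assms(2)] assms(3)
  show ?thesis
  proof (rule kernelI)
    fix t assume [simp]: "t \<in> arrs C" "tgt C t = src C (k \<cdot> e)"
      and t: "(k \<cdot> e) \<cdot> t = nul C (src C t) (tgt C (k \<cdot> e))"
    have "e \<cdot> t = nul C (src C t) (tgt C e)"
      by (rule is_monoD[OF assms(2)]) (use t in simp_all)
    from kernel_lift[OF assms(1) _ _ this]
    show "\<exists>h\<in>arrs C. src C h = src C t \<and> tgt C h = src C a \<and> a \<cdot> h = t" by auto
  qed (simp_all add: kernel_mono[OF assms(1)])
qed

lemma kernel_mono_cmpD:
  assumes "is_kernel C (k \<cdot> e) a" "is_mono C k" "e \<in> arrs C" "src C k = tgt C e"
  shows "is_kernel C e a"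
proof -
  note [simp] = is_mono_arr[OF assms(2)] assms(3,4)
  have a [simp]: "a \<in> arrs C" "tgt C a = src C e" and ka: "k \<cdot> e \<cdot> a = nul C (src C a) (tgt C k)"
    using kernelD[OF assms(1)] by simp_all
  show ?thesis
  proof (rule kernelI)
    show "e \<cdot> a = nul C (src C a) (tgt C e)"
      by (rule is_monoD[OF assms(2)]) (use ka in simp_all)
    fix t assume [simp]: "t \<in> arrs C" "tgt C t = src C e" and t: "e \<cdot> t = nul C (src C t) (tgt C e)"
    have "(k \<cdot> e) \<cdot> t = nul C (src C t) (tgt C (k \<cdot> e))" by (simp add: t)
    from kernel_lift[OF assms(1) _ _ this]
    show "\<exists>h\<in>arrs C. src C h = src C t \<and> tgt C h = src C a \<and> a \<cdot> h = t" by auto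
  qed (simp_all add: kernel_mono[OF assms(1)])
qed

text \<open>The cokernel arrow of \<open>f\<close> is zero because \<open>f\<close> is epi, so it
  kills the identity of the target, which therefore lifts through \<open>f\<close>.\<close>

lemma mono_epi_section:
  assumes "is_mono C f" "is_epi C f"
  obtains h where "h \<in> arrs C" "src C h = tgt C f" "tgt C h = src C f" "f \<cdot> h = idn C (tgt C f)"
proof -
  obtain c where c: "short_exact C f c" using mono_ses[OF assms(1)] by blast
  note [simp] = sesD(1-4)[OF c]
  have c0: "c = nul C (tgt C f) (tgt C c)"
    by (rule is_epiD[OF assms(2)]) simp_all
  have "c \<cdot> idn C (tgt C f) = nul C (src C (idn C (tgt C f))) (tgt C c)" using c0 by simp
  from ses_lift[OF c _ _ this] show ?thesis using that by auto
qed

text \<open>The epi part \<open>e\<close> of \<open>a\<close> is also mono and hence has a section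
  \<open>h\<close>; a lift \<open>s\<close> through \<open>k\<close> becomes the lift
  \<open>h \<cdot> s\<close> through \<open>a\<close>.\<close>

lemma exact_mono_kernel:
  assumes "exact C a b" "is_mono C a" shows "is_kernel C b a"
proof -
  obtain k e where ke: "is_kernel C b k" "is_epi C e" "tgt C e = src C k" "a = k \<cdot> e"
    using assms(1) unfolding exact_def by auto
  note [simp] = kernelD[OF ke(1)] is_epi_arr[OF ke(2)] ke(3)
  have "is_mono C e" using assms(2) unfolding ke(4) by (rule is_mono_cmpD) simp_all
  then obtain h where [simp]: "h \<in> arrs C" "src C h = tgt C e" "tgt C h = src C e"
    "e \<cdot> h = idn C (tgt C e)"
    using mono_epi_section ke(2) by blast
  show ?thesis unfolding ke(4)
  proof (rule kernelI)
    fix t assume t [simp]: "t \<in> arrs C" "tgt C t = src C b" "b \<cdot> t = nul C (src C t) (tgt C b)"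
    obtain s where [simp]: "s \<in> arrs C" "src C s = src C t" "tgt C s = src C k" "k \<cdot> s = t"
      by (rule kernel_lift[OF ke(1) t]) simp_all
    show "\<exists>h\<in>arrs C. src C h = src C t \<and> tgt C h = src C (k \<cdot> e) \<and> (k \<cdot> e) \<cdot> h = t"
      by (intro bexI[of _ "h \<cdot> s"]) (simp_all add: reassoc[of e h])
  qed (use assms(2) ke(4) in \<open>simp_all add: reassoc[of b k]\<close>)
qed

lemma exactI: "\<lbrakk>is_kernel C g k; is_epi C e; tgt C e = src C k\<rbrakk> \<Longrightarrow> exact C (k \<cdot> e) g"
  unfolding exact_def using kernelD[of g k] is_epi_arr[of e] by auto

lemma is_epi_idn: "is_epi C (idn C x)"
  by (rule is_epiI) simp_all

lemma ses_exact: "short_exact C i p \<Longrightarrow> exact C i p"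
  using exactI[of p i "idn C (src C i)"] is_epi_idn sesD(1) by (auto simp: short_exact_def)

lemma yoneda_extension1:
  "yoneda_extension C 1 X Y fs \<longleftrightarrow> (\<exists>i p. fs = [i, p] \<and> short_exact C i p \<and> src C i = Y \<and>
      tgt C p = X)"
proof
  assume 1: "yoneda_extension C 1 X Y fs"
  then have "length fs = 2" by (simp add: yoneda_extension_def)
  then obtain i p where [simp]: "fs = [i, p]" by (auto simp: length_Suc_conv numeral_2_eq_2)
  have "is_kernel C p i" "is_epi C p"
    using 1 by (auto simp: yoneda_extension_def intro: exact_mono_kernel)
  then show "\<exists>i p. fs = [i, p] \<and> short_exact C i p \<and> src C i = Y \<and> tgt C p = X"
    using 1 epi_kernel_cokernel by (auto simp: yoneda_extension_def)
qed (use sesD ses_exact in \<open>auto simp: yoneda_extension_def\<close>)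

lemma yoneda_extension2:
  "yoneda_extension C 2 X Y fs \<longleftrightarrow> (\<exists>a e k c. fs = [a, k \<cdot> e, c] \<and> short_exact C a e \<and>
      short_exact C k c \<and>
     tgt C e = src C k \<and> src C a = Y \<and> tgt C c = X)"
proof
  assume 1: "yoneda_extension C 2 X Y fs"
  then have "length fs = 3" by (simp add: yoneda_extension_def)
  then obtain a b c where [simp]: "fs = [a, b, c]" by (auto simp: length_Suc_conv numeral_3_eq_3)
  have 2: "is_mono C a" "is_epi C c" "src C a = Y" "tgt C c = X" "exact C a b" "exact C b c"
    using 1 by (auto simp: yoneda_extension_def numeral_2_eq_2 All_less_Suc)
  obtain k e where ke: "is_kernel C c k" "is_epi C e" "tgt C e = src C k" "b = k \<cdot> e"
    using 2(6) unfolding exact_def by auto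
  have "is_kernel C e a" using exact_mono_kernel[OF 2(5,1)] ke kernel_mono[OF ke(1)]
    is_epi_arr[OF ke(2)]
    by - (rule kernel_mono_cmpD[of k], simp_all)
  then have "short_exact C a e" "short_exact C k c" "fs = [a, k \<cdot> e, c]"
    using ke(4) epi_kernel_cokernel[OF 2(2) ke(1)] epi_kernel_cokernel[OF ke(2), of a] by simp_all
  then show "\<exists>a e k c. fs = [a, k \<cdot> e, c] \<and> short_exact C a e \<and> short_exact C k c \<and>
     tgt C e = src C k \<and> src C a = Y \<and> tgt C c = X"
    using 2(3,4) ke(3) by blast
next
  assume "\<exists>a e k c. fs = [a, k \<cdot> e, c] \<and> short_exact C a e \<and> short_exact C k c \<and>
     tgt C e = src C k \<and> src C a = Y \<and> tgt C c = X"
  then obtain a e k c where 1: "fs = [a, k \<cdot> e, c]" "short_exact C a e" "short_exact C k c"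
     "tgt C e = src C k" "src C a = Y" "tgt C c = X" by blast
  note [simp] = sesD[OF 1(2)] sesD[OF 1(3)] 1(4-6)
  have "is_kernel C (k \<cdot> e) a" using 1(2) by (intro kernel_mono_cmp) (simp_all add: short_exact_def)
  then have "exact C a (k \<cdot> e)"
    using exactI[of "k \<cdot> e" a "idn C Y"] is_epi_idn by simp
  moreover have "exact C (k \<cdot> e) c"
    using 1(3) by (intro exactI) (simp_all add: short_exact_def)
  ultimately show "yoneda_extension C 2 X Y fs"
    by (simp add: 1(1) yoneda_extension_def numeral_2_eq_2 All_less_Suc)
qed

lemma biproduct_ses:
  assumes b: "is_biproduct C Y X s i0 j0 p0 q0" shows "short_exact C i0 q0"
proof -
  note [simp] = biproductD[OF b]
  have m: "is_mono C i0"
  proof (rule is_monoI)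
    fix g assume [simp]: "g \<in> arrs C" "tgt C g = src C i0"
      and g: "i0 \<cdot> g = nul C (src C g) (tgt C i0)"
    have "g = (p0 \<cdot> i0) \<cdot> g" by simp
    also have "\<dots> = nul C (src C g) (src C i0)" by (subst cmp_assoc') (simp_all add: g)
    finally show "g = nul C (src C g) (src C i0)" .
  qed simp
  have e: "is_epi C q0"
  proof (rule is_epiI)
    fix g assume [simp]: "g \<in> arrs C" "src C g = tgt C q0"
      and g: "g \<cdot> q0 = nul C (src C q0) (tgt C g)"
    have "g = g \<cdot> (q0 \<cdot> j0)" by simp
    also have "\<dots> = nul C (tgt C q0) (tgt C g)" by (subst cmp_assoc'[symmetric]) (simp_all add: g)
    finally show "g = nul C (tgt C q0) (tgt C g)" .
  qed simp
  have k: "is_kernel C q0 i0"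
  proof (rule kernelI)
    fix g assume [simp]: "g \<in> arrs C" "tgt C g = src C q0"
      and g: "q0 \<cdot> g = nul C (src C g) (tgt C q0)"
    have "i0 \<cdot> (p0 \<cdot> g) = g" using biproductD(17)[OF b, of g]
      by (simp add: g del: biproductD(17)[OF b])
    then show "\<exists>h\<in>arrs C. src C h = src C g \<and> tgt C h = src C i0 \<and> i0 \<cdot> h = g"
      by (intro bexI[of _ "p0 \<cdot> g"]) simp_all
  qed (simp_all add: m)
  show ?thesis using epi_kernel_cokernel[OF e k] .
qed

section \<open>From the vanishing of Ext^1 and Ext^2 to splittings and weaves\<close>

lemma Ext_vanishes_equivalent:
  assumes "Ext_vanishes C n X Y" "yoneda_extension C n X Y fs" "yoneda_extension C n X Y gs"
  shows "(fs, gs) \<in> (yoneda_morphism C n X Y \<union> (yoneda_morphism C n X Y)\<inverse>)\<^sup>*" (is "_ \<in> ?r")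
proof -
  have "?r `` {fs} \<in> yoneda_Ext C n X Y" "?r `` {gs} \<in> yoneda_Ext C n X Y"
    unfolding yoneda_Ext_def quotient_def using assms(2,3) by blast+
  then have "?r `` {fs} = ?r `` {gs}"
    using assms(1) unfolding Ext_vanishes_def is_singleton_def by auto
  then show ?thesis by blast
qed

text \<open>A single class means that any two extensions are joined by a zigzag of morphisms
  pointing either way. A property of one base extension reaches all others as soon as it passes
  along a single morphism in both directions.\<close>

lemma Ext_vanishes_zigzag:
  assumes "Ext_vanishes C n X Y" "yoneda_extension C n X Y fs" "yoneda_extension C n X Y gs" "Pr gs"
    and "\<And>fs gs. \<lbrakk>(fs, gs) \<in> yoneda_morphism C n X Y \<union> (yoneda_morphism C n X Y)\<inverse>; Pr gs\<rbrakk> \<Longrightarrow> Pr fs"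
  shows "Pr fs"
  using Ext_vanishes_equivalent[OF assms(1-3)]
  by (induction rule: converse_rtrancl_induct) (use assms(4,5) in blast)+

lemma Ext_vanishes_imp_splits:
  assumes "Ext_vanishes C 1 X Y" shows "splits C X Y"
  unfolding splits_def
proof (intro allI impI, elim conjE)
  fix i p assume 1: "short_exact C i p" "src C i = Y" "tgt C p = X"
  note [simp] = sesD[OF 1(1)] 1(2,3)
  obtain s i0 j0 p0 q0 where b: "is_biproduct C Y X s i0 j0 p0 q0" using biproduct_exists by blast
  note [simp] = biproductD[OF b]
  define split where "split fs \<longleftrightarrow> (\<exists>i p r. fs = [i, p] \<and> short_exact C i p \<and> src C i = Y \<and>
      tgt C p = X \<and>
     r \<in> arrs C \<and> src C r = tgt C i \<and> tgt C r = Y \<and> r \<cdot> i = idn C Y)" for fs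
  have 0: "short_exact C i0 q0" using biproduct_ses[OF b] .
  have base: "split [i0, q0]" unfolding split_def using 0 by (auto intro!: exI[of _ p0])
  have step: "split fs" if fg: "(fs, gs) \<in> yoneda_morphism C 1 X Y \<union> (yoneda_morphism C 1 X Y)\<inverse>"
    and "split gs" for fs gs
  proof -
    from that obtain i2 p2 r2 where 2: "gs = [i2, p2]" "short_exact C i2 p2" "src C i2 = Y"
      "tgt C p2 = X"
      "r2 \<in> arrs C" "src C r2 = tgt C i2" "tgt C r2 = Y" "r2 \<cdot> i2 = idn C Y" unfolding split_def
      by blast
    have "yoneda_extension C 1 X Y fs" using fg by (auto simp: yoneda_morphism_def)
    then obtain i1 p1 where 3: "fs = [i1, p1]" "short_exact C i1 p1" "src C i1 = Y" "tgt C p1 = X"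
      by (auto simp: yoneda_extension1[unfolded One_nat_def])
    note [simp] = sesD[OF 2(2)] 2(3-8) sesD[OF 3(2)] 3(3,4)
    from fg show ?thesis
    proof
      assume "(fs, gs) \<in> yoneda_morphism C 1 X Y"
      then obtain u :: "nat \<Rightarrow> 'b" where u: "u 0 = idn C Y" "u 2 = idn C X"
        "u 1 \<in> Mor C (tgt C i1) (tgt C i2)"
        "u 1 \<cdot> i1 = i2 \<cdot> u 0"
        by (auto simp: yoneda_morphism_def 2(1) 3(1)
          numeral_2_eq_2 all_conj_distrib le_Suc_eq imp_conjL)
      \<comment> \<open>For a morphism into a split extension, the retraction is composed with the
        middle arrow.\<close>
      then have "(r2 \<cdot> u 1) \<cdot> i1 = idn C Y" by (subst cmp_assoc') (simp_all add: Mor_def)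
      then show ?thesis using u(3) 3 unfolding split_def
        by (intro exI[of _ i1] exI[of _ p1] exI[of _ "r2 \<cdot> u 1"]) (simp add: Mor_def)
    next
      assume "(fs, gs) \<in> (yoneda_morphism C 1 X Y)\<inverse>"
      then obtain u :: "nat \<Rightarrow> 'b" where u: "u 0 = idn C Y" "u 2 = idn C X"
        "u 1 \<in> Mor C (tgt C i2) (tgt C i1)"
        "u 2 \<cdot> p2 = p1 \<cdot> u 1"
        by (auto simp: yoneda_morphism_def 2(1) 3(1)
          numeral_2_eq_2 all_conj_distrib le_Suc_eq imp_conjL)
      \<comment> \<open>For a morphism out of a split extension the retraction cannot be moved, but
        a section can: the splitting is turned into a section, pushed forward by \<open>u 1\<close>,
        and turned back in \<open>opc C\<close>.\<close>
      obtain s where s: "s \<in> arrs C" "src C s = tgt C p2" "tgt C s = tgt C i2"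
        "p2 \<cdot> s = idn C (tgt C p2)"
        by (rule split_section[OF 2(2), of r2]) simp_all
      then have "p1 \<cdot> (u 1 \<cdot> s) = idn C X"
        using u by (subst cmp_assoc'[symmetric]) (simp_all add: Mor_def flip: u(4))
      then obtain r where "r \<in> arrs C" "src C r = tgt C i1" "tgt C r = src C i1"
        "r \<cdot> i1 = idn C (src C i1)"
        using abelian_category.split_section[OF abelian_category_opc[OF abelian_category_axioms],
          of p1 i1 "u 1 \<cdot> s"] s u(3) 3
        by (auto simp: Mor_def)
      then show ?thesis using 3 unfolding split_def by auto
    qed
  qed
  have "split [i, p]"
    by (rule Ext_vanishes_zigzag[where Pr = split and gs = "[i0, q0]", OF assms])
      (use step base 0 1 in \<open>auto simp: yoneda_extension1[unfolded One_nat_def]\<close>)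
  then show "\<exists>r\<in>arrs C. src C r = tgt C i \<and> tgt C r = Y \<and> r \<cdot> i = idn C Y" by (auto simp: split_def)
qed

text \<open>Any two split extensions are joined by a single morphism, so there is at most one class;
  the biproduct provides it.\<close>

lemma splits_imp_Ext_vanishes:
  assumes "splits C X Y" shows "Ext_vanishes C 1 X Y"
proof -
  let ?r = "(yoneda_morphism C 1 X Y \<union> (yoneda_morphism C 1 X Y)\<inverse>)\<^sup>*"
  obtain s i0 j0 p0 q0 where b: "is_biproduct C Y X s i0 j0 p0 q0" using biproduct_exists by blast
  then have ne: "yoneda_extension C 1 X Y [i0, q0]"
    unfolding yoneda_extension1 using biproduct_ses[OF b] biproductD[OF b] by blast
  have rel: "(fs, gs) \<in> yoneda_morphism C 1 X Y"
    if fg: "yoneda_extension C 1 X Y fs" "yoneda_extension C 1 X Y gs" for fs gs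
  proof -
    obtain i p where 1: "fs = [i, p]" "short_exact C i p" "src C i = Y" "tgt C p = X"
      using fg(1) unfolding yoneda_extension1 by blast
    obtain j q where 2: "gs = [j, q]" "short_exact C j q" "src C j = Y" "tgt C q = X"
      using fg(2) unfolding yoneda_extension1 by blast
    note [simp] = sesD[OF 1(2)] 1(3,4) sesD[OF 2(2)] 2(3,4)
    obtain r where r [simp]: "r \<in> arrs C" "src C r = tgt C i" "tgt C r = Y" "r \<cdot> i = idn C Y"
      using assms 1 unfolding splits_def by blast
    obtain r' where r' [simp]: "r' \<in> arrs C" "src C r' = tgt C j" "tgt C r' = Y" "r' \<cdot> j = idn C Y"
      using assms 2 unfolding splits_def by blast
    obtain s where s [simp]: "s \<in> arrs C" "src C s = tgt C q" "tgt C s = tgt C j"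
      "q \<cdot> s = idn C (tgt C q)"
      by (rule split_section[OF 2(2), of r']) simp_all
    \<comment> \<open>Both middle terms are identified with the biproduct: \<open>r\<close> and
      \<open>j\<close> carry the \<open>Y\<close>-component, \<open>p\<close> and \<open>s\<close>
      the \<open>X\<close>-component.\<close>
    define u where "u = j \<cdot> r +. s \<cdot> p"
    have u: "u \<in> Mor C (tgt C i) (tgt C j)" "u \<cdot> i = j" "q \<cdot> u = p"
      using reassoc[OF s(4), of p] by (simp_all add: Mor_def u_def)
    define U where "U n = (if n = 0 then idn C Y else if n = 1 then u else idn C X)" for n :: nat
    show ?thesis
      unfolding yoneda_morphism_def using u fg
      by (auto simp: 1(1) 2(1) U_def Mor_def le_Suc_eq all_conj_distrib imp_conjL intro!: exI[of _
        U])
  qed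
  have "?r `` {fs} = ?r `` {gs}" if "yoneda_extension C 1 X Y fs" "yoneda_extension C 1 X Y gs"
    for fs gs
  proof -
    have "(fs, gs) \<in> ?r" "(gs, fs) \<in> ?r" using rel that by blast+
    then show ?thesis by (blast intro: rtrancl_trans)
  qed
  then have "yoneda_Ext C 1 X Y = {?r `` {[i0, q0]}}"
    using ne unfolding yoneda_Ext_def quotient_def by blast
  then show ?thesis unfolding Ext_vanishes_def is_singleton_def by blast
qed

text \<open>Of the two short exact sequences in a weave only the one ending in
  \<open>\<beta>\<close> has to be constructed; a diagram chase yields the other.\<close>

lemma weave_half:
  assumes "short_exact C a e" "short_exact C k c" "tgt C e = src C k"
    and ab: "\<alpha> \<in> arrs C" "\<beta> \<in> arrs C" "src C \<alpha> = tgt C a" "src C \<beta> = tgt C \<alpha>" "tgt C \<beta> = tgt C k"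
      "\<beta> \<cdot> \<alpha> = k \<cdot> e"
    and ses: "short_exact C (\<alpha> \<cdot> a) \<beta>"
  shows "weave C a (k \<cdot> e) c \<alpha> \<beta>"
proof -
  note [simp] = sesD[OF assms(1)] sesD[OF assms(2)] assms(3) ab(1-5)
  have ba [simp]: "\<beta> \<cdot> \<alpha> \<cdot> t = k \<cdot> e \<cdot> t" if "t \<in> arrs C" "tgt C t = tgt C a" for t
    using that by (simp add: reassoc[OF ab(6)])
  have m: "is_mono C \<alpha>"
  proof (rule is_monoI)
    fix x assume x [simp]: "x \<in> arrs C" "tgt C x = src C \<alpha>"
      and ax: "\<alpha> \<cdot> x = nul C (src C x) (tgt C \<alpha>)"
    have "k \<cdot> e \<cdot> x = nul C (src C x) (tgt C k)" by (subst ba[symmetric]) (simp_all add: ax del: ba)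
    then have "e \<cdot> x = nul C (src C x) (tgt C e)"
      by - (rule is_monoD[OF sesD(6)[OF assms(2)]], simp_all)
    then obtain y where y [simp]: "y \<in> arrs C" "src C y = src C x" "tgt C y = src C a" "a \<cdot> y = x"
      using ses_lift[OF assms(1), of x] by auto
    have "(\<alpha> \<cdot> a) \<cdot> y = nul C (src C x) (tgt C \<alpha>)" using ax by simp
    then have "y = nul C (src C x) (src C a)"
      by - (rule is_monoD[OF sesD(6)[OF ses]], simp_all)
    then show "x = nul C (src C x) (src C \<alpha>)" using y(4) by simp
  qed simp
  obtain d where d: "short_exact C \<alpha> d" using mono_ses[OF m] by blast
  note [simp] = sesD(2-5)[OF d]
  have "is_kernel C (c \<cdot> \<beta>) \<alpha>"
  proof (rule kernelI[OF m])
    show "(c \<cdot> \<beta>) \<cdot> \<alpha> = nul C (src C \<alpha>) (tgt C (c \<cdot> \<beta>))" by (simp add: ab(6))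
    fix t assume t [simp]: "t \<in> arrs C" "tgt C t = src C (c \<cdot> \<beta>)"
      and ct: "(c \<cdot> \<beta>) \<cdot> t = nul C (src C t) (tgt C (c \<cdot> \<beta>))"
    obtain t' where t' [simp]: "t' \<in> arrs C" "src C t' = src C t" "tgt C t' = src C k"
      "k \<cdot> t' = \<beta> \<cdot> t"
      by (rule ses_lift[OF assms(2), of "\<beta> \<cdot> t"]) (use ct in simp_all)
    \<comment> \<open>\<open>t'\<close> need not lift through the epi \<open>e\<close>. After
      composition with the epi \<open>p\<close> it does, by \<open>q\<close>, and this suffices to
      see that \<open>d \<cdot> t\<close> vanishes.\<close>
    obtain p q where pq: "is_pullback C t' e p q" "is_epi C e \<Longrightarrow> is_epi C p"
      by (rule pullback_exists[of t' e]) simp_all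
    have p [simp]: "p \<in> arrs C" "q \<in> arrs C" "src C p = src C q" "tgt C p = src C t"
      "tgt C q = tgt C a" "e \<cdot> q = t' \<cdot> p"
      using pullbackD[OF pq(1)] by simp_all
    have "\<beta> \<cdot> (t \<cdot> p -. \<alpha> \<cdot> q) = nul C (src C q) (tgt C \<beta>)"
      by (simp add: reassoc[OF t'(4)])
    then obtain s where s [simp]: "s \<in> arrs C" "src C s = src C q" "tgt C s = src C a"
      and s': "(\<alpha> \<cdot> a) \<cdot> s = t \<cdot> p -. \<alpha> \<cdot> q"
      using ses_lift[OF ses, of "t \<cdot> p -. \<alpha> \<cdot> q"] by auto
    have "t \<cdot> p = (\<alpha> \<cdot> a) \<cdot> s +. \<alpha> \<cdot> q" unfolding s' by simp
    then have "(d \<cdot> t) \<cdot> p = d \<cdot> ((\<alpha> \<cdot> a) \<cdot> s +. \<alpha> \<cdot> q)" by simp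
    also have "\<dots> = nul C (src C q) (tgt C d)" by simp
    finally have "(d \<cdot> t) \<cdot> p = nul C (src C q) (tgt C d)" .
    then have "d \<cdot> t = nul C (src C t) (tgt C d)"
      by - (rule is_epiD[of p], use pq(2) in simp_all)
    then show "\<exists>h\<in>arrs C. src C h = src C t \<and> tgt C h = src C \<alpha> \<and> \<alpha> \<cdot> h = t"
      using ses_lift[OF d, of t] by auto
  qed simp_all
  moreover have "is_epi C (c \<cdot> \<beta>)" using is_epi_cmp[of \<beta> c] sesD(7)[OF ses] by simp
  ultimately have "short_exact C \<alpha> (c \<cdot> \<beta>)" using epi_kernel_cokernel by blast
  then show ?thesis using ab ses unfolding weave_def by simp
qed

text \<open>The witness of the target extension is pulled back along \<open>v\<close>. This keeps
  its left end, and the square formed by \<open>u\<close> and \<open>v\<close> supplies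
  \<open>\<alpha>\<close>.\<close>

lemma weave_pullback:
  assumes 1: "short_exact C a e" "short_exact C k c" "tgt C e = src C k"
    and 2: "short_exact C a' e'" "short_exact C k' c'" "tgt C e' = src C k'"
    and u: "src C a' = src C a" "u \<in> Mor C (tgt C a) (tgt C a')" "v \<in> Mor C (tgt C k) (tgt C k')"
      "u \<cdot> a = a'" "v \<cdot> (k \<cdot> e) = (k' \<cdot> e') \<cdot> u"
    and w: "weave C a' (k' \<cdot> e') c' \<alpha>' \<beta>'"
  obtains \<alpha> \<beta> where "weave C a (k \<cdot> e) c \<alpha> \<beta>"
proof -
  note [simp] = sesD[OF 1(1)] sesD[OF 1(2)] 1(3) sesD[OF 2(1)] sesD[OF 2(2)] 2(3) u(1) MorD[OF u(2)]
    MorD[OF u(3)] u(4)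
  have w' [simp]: "\<alpha>' \<in> arrs C" "\<beta>' \<in> arrs C" "src C \<alpha>' = tgt C a'" "src C \<beta>' = tgt C \<alpha>'"
    "tgt C \<beta>' = tgt C k'"
    "\<beta>' \<cdot> \<alpha>' = k' \<cdot> e'" and ses: "short_exact C (\<alpha>' \<cdot> a') \<beta>'"
    using w unfolding weave_def by simp_all
  obtain i \<beta> f where 3: "short_exact C i \<beta>" "src C i = src C (\<alpha>' \<cdot> a')" "tgt C \<beta> = src C v"
    "is_pullback C v \<beta>' \<beta> f" "f \<cdot> i = \<alpha>' \<cdot> a'"
    by (rule ses_pullback[OF ses, of v]) simp_all
  note [simp] = sesD(1,2,4)[OF 3(1)] 3(2,3,5)
  have sb [simp]: "src C \<beta> = tgt C i" "f \<in> arrs C" "src C f = tgt C i" "tgt C f = tgt C \<alpha>'"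
    using pullbackD[OF 3(4)] sesD(3)[OF 3(1)] by simp_all
  have e: "v \<cdot> (k \<cdot> e) = \<beta>' \<cdot> (\<alpha>' \<cdot> u)" using u(5) by (simp add: reassoc[OF w'(6)])
  obtain \<alpha> where al [simp]: "\<alpha> \<in> arrs C" "src C \<alpha> = tgt C a" "tgt C \<alpha> = tgt C i" "\<beta> \<cdot> \<alpha> = k \<cdot> e"
    "f \<cdot> \<alpha> = \<alpha>' \<cdot> u"
    by (rule pullback_lift[OF 3(4), of "k \<cdot> e" "\<alpha>' \<cdot> u"]) (use e in simp_all)
  have "\<alpha> \<cdot> a = i"
    by (rule pullback_unique[OF 3(4)]) (simp_all add: reassoc[OF al(4)] reassoc[OF al(5)])
  then have "weave C a (k \<cdot> e) c \<alpha> \<beta>"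
    by (intro weave_half[OF 1]) (use 3(1) in simp_all)
  then show ?thesis by (rule that)
qed

lemma weave_pushout:
  assumes 1: "short_exact C a e" "short_exact C k c" "tgt C e = src C k"
    and 2: "short_exact C a' e'" "short_exact C k' c'" "tgt C e' = src C k'"
    and u: "tgt C c' = tgt C c" "u \<in> Mor C (tgt C a) (tgt C a')" "v \<in> Mor C (tgt C k) (tgt C k')"
      "c' \<cdot> v = c" "v \<cdot> (k \<cdot> e) = (k' \<cdot> e') \<cdot> u"
    and w: "weave C a (k \<cdot> e) c \<alpha> \<beta>"
  obtains \<alpha>' \<beta>' where "weave C a' (k' \<cdot> e') c' \<alpha>' \<beta>'"
proof -
  note [simp] = sesD[OF 1(1)] sesD[OF 1(2)] 1(3) sesD[OF 2(1)] sesD[OF 2(2)] 2(3) MorD[OF u(2)]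
    MorD[OF u(3)]
  obtain \<beta>' \<alpha>' where "weave (opc C) c' (cmp (opc C) e' k') a' \<beta>' \<alpha>'"
    by (rule abelian_category.weave_pullback[OF abelian_category_opc[OF abelian_category_axioms],
      of c' k' e' a' c k e a v u \<beta> \<alpha>])
      (use assms in simp_all)
  then show ?thesis by (intro that) simp_all
qed

lemma Ext_vanishes_imp_splices:
  assumes "Ext_vanishes C 2 X Y" shows "splices C X Y"
  unfolding splices_def
proof (intro allI impI, elim conjE)
  fix a e k c assume 1: "short_exact C a e" "short_exact C k c" "src C a = Y" "tgt C e = src C k"
    "tgt C c = X"
  define woven where "woven fs \<longleftrightarrow> yoneda_extension C 2 X Y fs \<and>
      (\<exists>\<alpha> \<beta>. weave C (fs ! 0) (fs ! 1) (fs ! 2) \<alpha> \<beta>)" for fs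
  obtain z where z: "is_zero C z" using zero_exists by blast
  have z1: "f = nul C x z" if "f \<in> arrs C" "src C f = x" "tgt C f = z" for f x
    using z that nul_arr[of x z] unfolding is_zero_def Mor_def by blast
  have z2: "f = nul C z x" if "f \<in> arrs C" "src C f = z" "tgt C f = x" for f x
    using z that nul_arr[of z x] unfolding is_zero_def Mor_def by blast
  have e0: "short_exact C (idn C Y) (nul C Y z)"
  proof (rule epi_kernel_cokernel)
    show "is_epi C (nul C Y z)" by (rule is_epiI) (simp_all add: z2)
    show "is_kernel C (nul C Y z) (idn C Y)"
      by (rule kernelI, rule is_monoI) auto
  qed
  have k0: "short_exact C (nul C z X) (idn C X)"
  proof (rule epi_kernel_cokernel)
    show "is_epi C (idn C X)" by (rule is_epi_idn)
    show "is_kernel C (idn C X) (nul C z X)"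
    proof (rule kernelI, rule is_monoI)
      fix g assume "g \<in> arrs C" "tgt C g = src C (idn C X)"
        "idn C X \<cdot> g = nul C (src C g) (tgt C (idn C X))"
      then show "\<exists>h\<in>arrs C. src C h = src C g \<and> tgt C h = src C (nul C z X) \<and> nul C z X \<cdot> h = g"
        by (intro bexI[of _ "nul C (src C g) z"]) simp_all
    qed (simp_all add: z1)
  qed
  obtain s i0 j0 p0 q0 where b: "is_biproduct C Y X s i0 j0 p0 q0" using biproduct_exists by blast
  note [simp] = biproductD[OF b]
  \<comment> \<open>The trivial two-step extension has the zero object as its middle image, and the
    biproduct weaves it.\<close>
  have "weave C (idn C Y) (nul C z X \<cdot> nul C Y z) (idn C X) i0 q0"
    by (rule weave_half[OF e0 k0]) (simp_all add: biproduct_ses[OF b])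
  moreover have "yoneda_extension C 2 X Y [idn C Y, nul C z X \<cdot> nul C Y z, idn C X]"
    unfolding yoneda_extension2 using e0 k0 by (intro exI conjI) (rule refl, assumption+, simp_all)
  ultimately have base: "woven [idn C Y, nul C z X \<cdot> nul C Y z, idn C X]" unfolding woven_def
    by auto
  have step: "woven fs" if fg: "(fs, gs) \<in> yoneda_morphism C 2 X Y \<union> (yoneda_morphism C 2 X Y)\<inverse>"
    and "woven gs" for fs gs
  proof -
    from that have fs: "yoneda_extension C 2 X Y fs" by (auto simp: yoneda_morphism_def)
    then obtain a e k c where 2: "fs = [a, k \<cdot> e, c]" "short_exact C a e" "short_exact C k c"
      "tgt C e = src C k" "src C a = Y" "tgt C c = X" unfolding yoneda_extension2 by blast
    from that obtain a' e' k' c' where 3: "gs = [a', k' \<cdot> e', c']" "short_exact C a' e'"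
      "short_exact C k' c'"
      "tgt C e' = src C k'" "src C a' = Y" "tgt C c' = X" unfolding yoneda_extension2 woven_def
      by blast
    from that 3(1) obtain \<alpha>' \<beta>' where w: "weave C a' (k' \<cdot> e') c' \<alpha>' \<beta>'" unfolding woven_def by auto
    note [simp] = sesD[OF 2(2)] sesD[OF 2(3)] 2(4-6) sesD[OF 3(2)] sesD[OF 3(3)] 3(4-6)
    \<comment> \<open>A weave is transported backwards along a morphism of extensions by pullback
      and forwards by pushout.\<close>
    have "\<exists>\<alpha> \<beta>. weave C a (k \<cdot> e) c \<alpha> \<beta>"
    using fg
    proof
      assume "(fs, gs) \<in> yoneda_morphism C 2 X Y"
      then obtain u :: "nat \<Rightarrow> 'b" where u: "u 0 = idn C Y" "u 3 = idn C X"
        "u 1 \<in> Mor C (tgt C a) (tgt C a')"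
        "u 2 \<in> Mor C (tgt C k) (tgt C k')" "u 1 \<cdot> a = a' \<cdot> u 0" "u 2 \<cdot> (k \<cdot> e) = (k' \<cdot> e') \<cdot> u 1"
        by (auto simp: yoneda_morphism_def 2(1) 3(1)
          numeral_2_eq_2 numeral_3_eq_3 all_conj_distrib le_Suc_eq imp_conjL)
      show ?thesis
        by (rule weave_pullback[OF 2(2-4) 3(2-4) _ u(3,4) _ u(6) w])
          (use u(1,5) MorD[OF u(3)] in auto)
    next
      assume "(fs, gs) \<in> (yoneda_morphism C 2 X Y)\<inverse>"
      then obtain u :: "nat \<Rightarrow> 'b" where u: "u 0 = idn C Y" "u 3 = idn C X"
        "u 1 \<in> Mor C (tgt C a') (tgt C a)"
        "u 2 \<in> Mor C (tgt C k') (tgt C k)" "u 3 \<cdot> c' = c \<cdot> u 2" "u 2 \<cdot> (k' \<cdot> e') = (k \<cdot> e) \<cdot> u 1"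
        by (auto simp: yoneda_morphism_def 2(1) 3(1)
          numeral_2_eq_2 numeral_3_eq_3 all_conj_distrib le_Suc_eq imp_conjL)
      show ?thesis
        by (rule weave_pushout[OF 3(2-4) 2(2-4) _ u(3,4) _ u(6) w])
          (use u(2,5) MorD[OF u(4)] in auto)
    qed
    then show ?thesis using fs 2(1) unfolding woven_def by simp
  qed
  have "woven [a, k \<cdot> e, c]"
    by (rule Ext_vanishes_zigzag[where Pr = woven
      and gs = "[idn C Y, nul C z X \<cdot> nul C Y z, idn C X]", OF assms])
      (use base step 1 in \<open>auto simp: yoneda_extension2 woven_def\<close>)
  then show "\<exists>\<alpha> \<beta>. weave C a (k \<cdot> e) c \<alpha> \<beta>" unfolding woven_def by simp
qed

end

section \<open>Cotorsion pairs\<close>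

text \<open>What is used of a complete hereditary cotorsion pair, in a form that visibly dualizes.\<close>

definition good_pair :: "('o, 'a) cat \<Rightarrow> 'o set \<Rightarrow> 'o set \<Rightarrow> bool" where
  "good_pair C \<X> \<Y> \<longleftrightarrow> (\<forall>X\<in>\<X>. \<forall>Y\<in>\<Y>. splits C X Y \<and> splices C X Y) \<and>
     (\<forall>X. (\<forall>Y\<in>\<Y>. splits C X Y) \<longrightarrow> X \<in> \<X>) \<and> (\<forall>Y. (\<forall>X\<in>\<X>. splits C X Y) \<longrightarrow> Y \<in> \<Y>) \<and>
     complete_pair C \<X> \<Y>"

lemma complete_pair_opc: "complete_pair C \<X> \<Y> \<Longrightarrow> complete_pair (opc C) \<Y> \<X>"
  unfolding complete_pair_def short_exact_opc opc_simps by blast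

lemma thick_opc: "thick C \<W> \<Longrightarrow> thick (opc C) \<W>" if "abelian_category C"
  unfolding thick_def short_exact_opc opc_simps using abelian_category.sesD(3)[OF that] by metis

text \<open>Passage to \<open>opc C\<close> exchanges cofibrant with fibrant objects, and thereby
  the two cotorsion pairs.\<close>

definition opm :: "'o triple \<Rightarrow> 'o triple" where
  "opm M = \<lparr>cofs = fibs M, trivs = trivs M, fibs = cofs M\<rparr>"

lemma opm_simps [simp]: "cofs (opm M) = fibs M" "trivs (opm M) = trivs M" "fibs (opm M) = cofs M"
  by (simp_all add: opm_def)

lemma core_maps_opc [simp]: "core_maps (opc C) (opm M) x y = core_maps C M y x"
  by (auto simp: core_maps_def core_def)

context abelian_category
begin

lemma good_pair_opc: "good_pair C \<X> \<Y> \<Longrightarrow> good_pair (opc C) \<Y> \<X>"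
  unfolding good_pair_def using complete_pair_opc by (simp add: complete_pair_opc)

lemma splits_retraction:
  assumes "splits C X Y" "short_exact C i p" "src C i = Y" "tgt C p = X"
  obtains r where "r \<in> arrs C" "src C r = tgt C i" "tgt C r = Y" "r \<cdot> i = idn C Y"
  using assms unfolding splits_def by blast

lemma good_pairD:
  assumes "good_pair C \<X> \<Y>" "X \<in> \<X>" "Y \<in> \<Y>" shows "splits C X Y" "splices C X Y"
  using assms unfolding good_pair_def by blast+

text \<open>An extension \<open>(j, q)\<close> of the middle term restricts to an extension of
  \<open>src C i\<close> by \<open>Y\<close>, which has a retraction. That retraction extends along
  \<open>k\<close>, whose cokernel is \<open>tgt C p\<close>, to a retraction of
  \<open>j\<close>.\<close>

lemma good_pair_extension:
  assumes "good_pair C \<X> \<Y>" "short_exact C i p" "src C i \<in> \<X>" "tgt C p \<in> \<X>"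
  shows "tgt C i \<in> \<X>"
proof -
  have "splits C (tgt C i) Y" if Y: "Y \<in> \<Y>" for Y
    unfolding splits_def
  proof (intro allI impI, elim conjE)
    fix j q assume 1: "short_exact C j q" "src C j = Y" "tgt C q = tgt C i"
    note [simp] = sesD[OF assms(2)] sesD[OF 1(1)] 1(2,3)
    obtain k u v where 2: "short_exact C k (p \<cdot> q)" "short_exact C u v" "src C u = src C j"
      "tgt C u = src C k" "tgt C v = src C i" "k \<cdot> u = j"
      by (rule comp_ses_epi[OF 1(1) assms(2)]) simp_all
    note [simp] = sesD(1,2)[OF 2(1)] sesD(1,2)[OF 2(2)] 2(3-6)
    have k [simp]: "tgt C k = tgt C j" using sesD(3)[OF 2(1)] by simp
    obtain r where [simp]: "r \<in> arrs C" "src C r = tgt C u" "tgt C r = Y" "r \<cdot> u = idn C Y"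
      by (rule splits_retraction[OF good_pairD(1)[OF assms(1,3) Y] 2(2)]) simp_all
    obtain t where [simp]: "t \<in> arrs C" "src C t = tgt C j" "tgt C t = Y" and t: "t \<cdot> k = r"
      by (rule splits_extend[OF _ 2(1), of Y r]) (use good_pairD(1)[OF assms(1,4) Y] in simp_all)
    have "t \<cdot> j = (t \<cdot> k) \<cdot> u" by simp
    also have "\<dots> = idn C Y" by (simp only: t) simp
    finally show "\<exists>r\<in>arrs C. src C r = tgt C j \<and> tgt C r = Y \<and> r \<cdot> j = idn C Y"
      by (intro bexI[of _ t]) simp_all
  qed
  then show ?thesis using assms(1) unfolding good_pair_def by blast
qed

text \<open>Splicing an extension of \<open>src C i\<close> by \<open>Y\<close> with
  \<open>(i, p)\<close> gives a two-step extension of \<open>tgt C p\<close> by \<open>Y\<close>.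
  The weave for it contains an extension of \<open>tgt C i\<close> by \<open>Y\<close>; a retraction
  of that one, composed with \<open>\<alpha>\<close>, retracts \<open>j\<close>.\<close>

lemma good_pair_kernel:
  assumes "good_pair C \<X> \<Y>" "short_exact C i p" "tgt C i \<in> \<X>" "tgt C p \<in> \<X>"
  shows "src C i \<in> \<X>"
proof -
  have "splits C (src C i) Y" if Y: "Y \<in> \<Y>" for Y
    unfolding splits_def
  proof (intro allI impI, elim conjE)
    fix j q assume 1: "short_exact C j q" "src C j = Y" "tgt C q = src C i"
    note [simp] = sesD[OF assms(2)] sesD[OF 1(1)] 1(2,3)
    obtain \<alpha> \<beta> where w: "weave C j (i \<cdot> q) p \<alpha> \<beta>"
      using good_pairD(2)[OF assms(1,4) Y] 1 assms(2) unfolding splices_def by blast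
    then have [simp]: "\<alpha> \<in> arrs C" "\<beta> \<in> arrs C" "src C \<alpha> = tgt C j" "src C \<beta> = tgt C \<alpha>"
      "tgt C \<beta> = tgt C i"
      and s: "short_exact C (\<alpha> \<cdot> j) \<beta>" by (simp_all add: weave_def)
    obtain r where "r \<in> arrs C" "src C r = tgt C (\<alpha> \<cdot> j)" "tgt C r = Y" "r \<cdot> (\<alpha> \<cdot> j) = idn C Y"
      by (rule splits_retraction[OF good_pairD(1)[OF assms(1,3) Y] s]) simp_all
    then show "\<exists>r\<in>arrs C. src C r = tgt C j \<and> tgt C r = Y \<and> r \<cdot> j = idn C Y"
      by (intro bexI[of _ "r \<cdot> \<alpha>"]) simp_all
  qed
  then show ?thesis using assms(1) unfolding good_pair_def by blast
qed

end

section \<open>Model structures and null maps\<close>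

locale model = abelian_category +
  fixes M :: "'a triple"
  assumes pair1: "good_pair C (cofs M) (trivs M \<inter> fibs M)"
    and pair2: "good_pair C (cofs M \<inter> trivs M) (fibs M)"
    and thick: "thick C (trivs M)"

text \<open>The last use of Yoneda Ext: from here on its vanishing is present only as
  \<open>splits\<close> and \<open>splices\<close>, which dualize by rewriting.\<close>

lemma hereditary_model_structure_model:
  assumes "abelian_category C" "hereditary_model_structure C M" shows "model C M"
proof -
  interpret abelian_category C by fact
  have "good_pair C \<X> \<Y>" if "cotorsion_pair C \<X> \<Y>" "complete_pair C \<X> \<Y>" "hereditary_pair C \<X> \<Y>"
    for \<X> \<Y>
    unfolding good_pair_def
  proof (intro conjI ballI allI impI that)
    have h: "Ext_vanishes C i X Y" if "X \<in> \<X>" "Y \<in> \<Y>" "1 \<le> i" for X Y i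
      using that \<open>hereditary_pair C \<X> \<Y>\<close> unfolding hereditary_pair_def by blast
    show "splits C X Y" "splices C X Y" if "X \<in> \<X>" "Y \<in> \<Y>" for X Y
      using Ext_vanishes_imp_splits[OF h[of X Y 1]] Ext_vanishes_imp_splices[OF h[of X Y 2]] that
        by simp_all
    show "X \<in> \<X>" if "\<forall>Y\<in>\<Y>. splits C X Y" for X
      using \<open>cotorsion_pair C \<X> \<Y>\<close> that splits_imp_Ext_vanishes unfolding cotorsion_pair_def
        by blast
    show "Y \<in> \<Y>" if "\<forall>X\<in>\<X>. splits C X Y" for Y
      using \<open>cotorsion_pair C \<X> \<Y>\<close> that splits_imp_Ext_vanishes unfolding cotorsion_pair_def
        by blast
  qed
  then show ?thesis
    using assms(2) unfolding hereditary_model_structure_def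
    by (intro model.intro model_axioms.intro abelian_category_axioms) auto
qed

context model
begin

lemma model_opc: "model (opc C) (opm M)"
  by (intro model.intro model_axioms.intro abelian_category_opc abelian_category_axioms)
    (use good_pair_opc[OF pair1] good_pair_opc[OF pair2] thick_opc[OF abelian_category_axioms thick]
      in \<open>simp_all add: Int_commute\<close>)

lemma trivs_extension: "\<lbrakk>short_exact C i p; src C i \<in> trivs M; tgt C p \<in> trivs M\<rbrakk> \<Longrightarrow>
    tgt C i \<in> trivs M"
  using thick unfolding thick_def by blast

lemma cofs_extension: "\<lbrakk>short_exact C i p; src C i \<in> cofs M; tgt C p \<in> cofs M\<rbrakk> \<Longrightarrow> tgt C i \<in> cofs M"
  by (rule good_pair_extension[OF pair1])

lemma cofs_kernel: "\<lbrakk>short_exact C i p; tgt C i \<in> cofs M; tgt C p \<in> cofs M\<rbrakk> \<Longrightarrow> src C i \<in> cofs M"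
  by (rule good_pair_kernel[OF pair1])

lemma fibs_extension: "\<lbrakk>short_exact C i p; src C i \<in> fibs M; tgt C p \<in> fibs M\<rbrakk> \<Longrightarrow> tgt C i \<in> fibs M"
  using model.cofs_extension[OF model_opc, of p i] sesD(3)[of i p] by simp

lemma fibs_cokernel: "\<lbrakk>short_exact C i p; src C i \<in> fibs M; tgt C i \<in> fibs M\<rbrakk> \<Longrightarrow> tgt C p \<in> fibs M"
  using model.cofs_kernel[OF model_opc, of p i] sesD(3)[of i p] by simp

lemma splits1: "\<lbrakk>X \<in> cofs M; Y \<in> trivs M; Y \<in> fibs M\<rbrakk> \<Longrightarrow> splits C X Y"
  using pair1 unfolding good_pair_def by blast

lemma splits2: "\<lbrakk>X \<in> cofs M; X \<in> trivs M; Y \<in> fibs M\<rbrakk> \<Longrightarrow> splits C X Y"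
  using pair2 unfolding good_pair_def by blast

lemma cofibrant_replacement_exists:
  obtains i p where "short_exact C i p" "tgt C p = A" "src C i \<in> trivs M" "src C i \<in> fibs M"
    "tgt C i \<in> cofs M"
  using pair1 sesD(3) unfolding good_pair_def complete_pair_def by (metis IntE)

lemma fibrant_replacement_exists:
  obtains i p where "short_exact C i p" "src C i = A" "tgt C p \<in> trivs M" "tgt C p \<in> cofs M"
    "tgt C i \<in> fibs M"
  using pair2 unfolding good_pair_def complete_pair_def by (metis IntE)

lemma suspension_exists:
  obtains i p where "short_exact C i p" "src C i = A" "tgt C p \<in> cofs M" "tgt C i \<in> trivs M"
    "tgt C i \<in> fibs M"
  using pair1 unfolding good_pair_def complete_pair_def by (metis IntE)

text \<open>A cofibrant replacement is an extension of \<open>w\<close> by a trivially fibrant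
  object, so it inherits both properties of \<open>w\<close>.\<close>

lemma trivs_to_core:
  assumes "w \<in> trivs M" "w \<in> fibs M"
  obtains i p where "short_exact C i p" "tgt C p = w" "src C i \<in> trivs M" "src C i \<in> fibs M"
    "tgt C i \<in> core M"
proof -
  obtain i p where 1: "short_exact C i p" "tgt C p = w" "src C i \<in> trivs M" "src C i \<in> fibs M"
    "tgt C i \<in> cofs M"
    by (rule cofibrant_replacement_exists)
  then have "tgt C i \<in> core M" using assms fibs_extension[OF 1(1)] trivs_extension[OF 1(1)]
    by (simp add: core_def)
  then show ?thesis using that 1 by blast
qed

lemma core_nonempty: obtains w where "w \<in> core M"
proof -
  obtain i p where 1: "short_exact C i p" "src C i \<in> trivs M" "src C i \<in> fibs M"
    by (rule cofibrant_replacement_exists)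
  then show ?thesis using trivs_to_core that by metis
qed

section \<open>The ideal of maps through the core\<close>

lemma core_mapsI:
  "\<lbrakk>w \<in> core M; g \<in> arrs C; h \<in> arrs C; tgt C g = w; src C h = w; src C g = x; tgt C h = y\<rbrakk> \<Longrightarrow>
      h \<cdot> g \<in> core_maps C M x y"
  unfolding core_maps_def Mor_def by blast

lemma core_mapsE:
  assumes "f \<in> core_maps C M x y"
  obtains w g h where "w \<in> core M" "g \<in> arrs C" "h \<in> arrs C" "tgt C g = w" "src C h = w"
    "src C g = x" "tgt C h = y" "f = h \<cdot> g"
  using assms unfolding core_maps_def Mor_def by blast

lemma core_maps_Mor: "f \<in> core_maps C M x y \<Longrightarrow> f \<in> Mor C x y"
  by (auto simp: Mor_def elim!: core_mapsE)

lemma core_maps_cmp_left: "\<lbrakk>f \<in> core_maps C M x y; g \<in> arrs C; src C g = y; tgt C g = z\<rbrakk> \<Longrightarrow>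
    g \<cdot> f \<in> core_maps C M x z"
  by (elim core_mapsE, simp, subst cmp_assoc'[symmetric])
    (auto intro!: core_mapsI simp del: cmp_assoc')

lemma core_maps_cmp_right: "\<lbrakk>f \<in> core_maps C M x y; g \<in> arrs C; tgt C g = x; src C g = z\<rbrakk> \<Longrightarrow>
    f \<cdot> g \<in> core_maps C M z y"
  by (elim core_mapsE) (auto intro!: core_mapsI)

lemma nul_core_maps: "nul C x y \<in> core_maps C M x y"
proof -
  obtain w where "w \<in> core M" by (rule core_nonempty)
  then have "nul C w y \<cdot> nul C x w \<in> core_maps C M x y" by (intro core_mapsI) simp_all
  then show ?thesis by simp
qed

text \<open>The two factorizations combine through the biproduct of the core objects, which is in
  the core because all three classes are closed under extensions.\<close>

lemma hadd_core_maps: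
  assumes "f \<in> core_maps C M x y" "g \<in> core_maps C M x y" shows "f +. g \<in> core_maps C M x y"
proof -
  obtain w a b where 1 [simp]: "w \<in> core M" "a \<in> arrs C" "b \<in> arrs C" "tgt C a = w" "src C b = w"
    "src C a = x" "tgt C b = y" "f = b \<cdot> a"
    using assms(1) by (rule core_mapsE)
  obtain w' a' b' where 2 [simp]: "w' \<in> core M" "a' \<in> arrs C" "b' \<in> arrs C" "tgt C a' = w'"
    "src C b' = w'" "src C a' = x" "tgt C b' = y" "g = b' \<cdot> a'"
    using assms(2) by (rule core_mapsE)
  obtain s i j p q where b: "is_biproduct C w w' s i j p q" using biproduct_exists by blast
  note [simp] = biproductD[OF b]
  note [simp] = reassoc[OF biproductD(13)[OF b]] reassoc[OF biproductD(14)[OF b]]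
    reassoc[OF biproductD(15)[OF b]] reassoc[OF biproductD(16)[OF b]]
  have "s \<in> core M" using 1(1) 2(1) trivs_extension[OF biproduct_ses[OF b]]
    cofs_extension[OF biproduct_ses[OF b]]
    fibs_extension[OF biproduct_ses[OF b]] by (simp add: core_def)
  then have "(b \<cdot> p +. b' \<cdot> q) \<cdot> (i \<cdot> a +. j \<cdot> a') \<in> core_maps C M x y"
    by (rule core_mapsI) simp_all
  then show ?thesis by simp
qed

lemma hneg_core_maps: "f \<in> core_maps C M x y \<Longrightarrow> hneg C f \<in> core_maps C M x y"
  by (elim core_mapsE) (auto intro!: core_mapsI simp flip: hneg_cmp)

text \<open>Equality in the stable Hom groups as a relation on arrows. Parallelism is built in, so
  that chains of \<open>\<approx>\<close> carry their typing along.\<close>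

definition stabeq (infix \<open>\<approx>\<close> 50) where
  "f \<approx> g \<longleftrightarrow> f \<in> arrs C \<and> g \<in> arrs C \<and> src C f = src C g \<and> tgt C f = tgt C g \<and>
      f -. g \<in> core_maps C M (src C g) (tgt C g)"

lemma stabeqD: assumes "f \<approx> g" shows "f \<in> arrs C" "g \<in> arrs C" "src C f = src C g"
  "tgt C f = tgt C g"
  using assms by (simp_all add: stabeq_def)

lemma stabeq_refl: "f \<in> arrs C \<Longrightarrow> f \<approx> f"
  by (simp add: stabeq_def nul_core_maps)

lemma stabeq_sym: assumes "f \<approx> g" shows "g \<approx> f"
proof -
  note [simp] = stabeqD[OF assms]
  have "hneg C (f -. g) \<in> core_maps C M (src C g) (tgt C g)"
    using assms by (intro hneg_core_maps) (simp add: stabeq_def)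
  moreover have "hneg C (f -. g) = g -. f" by (simp add: hsub_def hadd_commute)
  ultimately show ?thesis by (simp add: stabeq_def)
qed

lemma stabeq_trans [trans]: assumes "f \<approx> g" "g \<approx> h" shows "f \<approx> h"
proof -
  note [simp] = stabeqD[OF assms(1)] stabeqD[OF assms(2)]
  have "(f -. g) +. (g -. h) \<in> core_maps C M (src C g) (tgt C g)"
    using assms by (intro hadd_core_maps) (simp_all add: stabeq_def)
  moreover have "(f -. g) +. (g -. h) = f -. h" by (simp add: hsub_def)
  ultimately show ?thesis by (simp add: stabeq_def)
qed

lemma stabeq_trans_eq [trans]: "\<lbrakk>f \<approx> g; g = h\<rbrakk> \<Longrightarrow> f \<approx> h" "\<lbrakk>f = g; g \<approx> h\<rbrakk> \<Longrightarrow> f \<approx> h"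
  by simp_all

lemma stabeq_cmp_left: "\<lbrakk>f \<approx> g; h \<in> arrs C; src C h = tgt C g\<rbrakk> \<Longrightarrow> h \<cdot> f \<approx> h \<cdot> g"
  using core_maps_cmp_left[of "f -. g" "src C g" "tgt C g" h] by (simp add: stabeq_def)

lemma stabeq_cmp_right: "\<lbrakk>f \<approx> g; h \<in> arrs C; tgt C h = src C g\<rbrakk> \<Longrightarrow> f \<cdot> h \<approx> g \<cdot> h"
  using core_maps_cmp_right[of "f -. g" "src C g" "tgt C g" h] by (simp add: stabeq_def)

lemma stabeq_cmp: assumes "f \<approx> g" "h \<approx> k" "src C h = tgt C f" shows "h \<cdot> f \<approx> k \<cdot> g"
proof (rule stabeq_trans)
  show "h \<cdot> f \<approx> h \<cdot> g" using assms stabeqD by (intro stabeq_cmp_left) metis+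
  show "h \<cdot> g \<approx> k \<cdot> g" using assms stabeqD by (intro stabeq_cmp_right) metis+
qed

end

section \<open>Integer-indexed families of short exact sequences\<close>

text \<open>Dependent choice is run upwards and downwards from \<open>N\<close> separately. Both
  branches remember the value \<open>x0\<close> at \<open>N\<close>, so that \<open>R\<close> also
  holds across the seam.\<close>

lemma int_family:
  fixes N :: int
  assumes "P N x0" and up: "\<And>n x. \<lbrakk>N \<le> n; P n x\<rbrakk> \<Longrightarrow> \<exists>y. P (n + 1) y \<and> R n x y"
    and down: "\<And>n y. \<lbrakk>n < N; P (n + 1) y\<rbrakk> \<Longrightarrow> \<exists>x. P n x \<and> R n x y"
  shows "\<exists>x. x N = x0 \<and> (\<forall>n. P n (x n)) \<and> (\<forall>n. R n (x n) (x (n + 1)))"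
proof -
  obtain g where g: "\<And>k. P (N + int k) (g k)" "g 0 = x0" "\<And>k. R (N + int k) (g k) (g (Suc k))"
    using dependent_nat_choice[of "\<lambda>k x. P (N + int k) x \<and> (k = 0 \<longrightarrow> x = x0)"
      "\<lambda>k x y. R (N + int k) x y"]
      assms(1) up[of "N + int k" for k] by (auto simp: algebra_simps)
  obtain h where h: "\<And>k. P (N - int k) (h k)" "h 0 = x0" "\<And>k. R (N - int k - 1) (h (Suc k)) (h k)"
    using dependent_nat_choice[of "\<lambda>k x. P (N - int k) x \<and> (k = 0 \<longrightarrow> x = x0)"
      "\<lambda>k x y. R (N - int k - 1) y x"]
      assms(1) down[of "N - int k - 1" for k] by (auto simp: algebra_simps)
  define x where "x n = (if N \<le> n then g (nat (n - N)) else h (nat (N - n)))" for n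
  have "P n (x n)" for n
    using g(1)[of "nat (n - N)"] h(1)[of "nat (N - n)"] by (cases "N \<le> n") (simp_all add: x_def)
  moreover have "R n (x n) (x (n + 1))" for n
  proof (cases "N \<le> n")
    case True
    then have "nat (n + 1 - N) = Suc (nat (n - N))" by simp
    with True g(3)[of "nat (n - N)"] show ?thesis by (simp add: x_def)
  next
    case False
    \<comment> \<open>For \<open>n = N - 1\<close> the successor falls into the upper branch; since
      \<open>g 0\<close> and \<open>h 0\<close> agree, it can be read in the lower one.\<close>
    then have *: "nat (N - n) = Suc (nat (N - n - 1))" "x (n + 1) = h (nat (N - n - 1))"
      using g(2) h(2) by (auto simp: x_def) (metis add.commute diff_diff_add)
    with False h(3)[of "nat (N - n - 1)"] show ?thesis by (simp add: x_def)
  qed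
  moreover have "x N = x0" by (simp add: x_def g)
  ultimately show ?thesis by blast
qed

text \<open>The middle arrow stays existential: the end maps do not determine it, and only they are
  used as stable classes.\<close>

definition ses_map :: "('o, 'a) cat \<Rightarrow> 'a \<Rightarrow> 'a \<Rightarrow> 'a \<Rightarrow> 'a \<Rightarrow> 'a \<Rightarrow> 'a \<Rightarrow> bool" where
  "ses_map C i p i' p' f c \<longleftrightarrow> f \<in> Mor C (src C i) (src C i') \<and> c \<in> Mor C (tgt C p) (tgt C p') \<and>
     (\<exists>v\<in>Mor C (tgt C i) (tgt C i'). v \<cdot> i = i' \<cdot> f \<and> c \<cdot> p = p' \<cdot> v)"
  for C (structure)

section \<open>Extending and lifting between short exact sequences\<close>

context model
begin

lemma extend_cofs:
  assumes "short_exact C i p" "tgt C p \<in> cofs M" "f \<in> arrs C" "src C f = src C i"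
    "tgt C f \<in> trivs M" "tgt C f \<in> fibs M"
  obtains t where "t \<in> arrs C" "src C t = tgt C i" "tgt C t = tgt C f" "t \<cdot> i = f"
  by (rule splits_extend[OF splits1[OF assms(2,5,6)] assms(1,3,4)]) simp_all

lemma extend_triv_cofs:
  assumes "short_exact C i p" "tgt C p \<in> cofs M" "tgt C p \<in> trivs M" "f \<in> arrs C"
    "src C f = src C i" "tgt C f \<in> fibs M"
  obtains t where "t \<in> arrs C" "src C t = tgt C i" "tgt C t = tgt C f" "t \<cdot> i = f"
  by (rule splits_extend[OF splits2[OF assms(2,3,6)] assms(1,4,5)]) simp_all

lemma lift_triv_fibs:
  assumes "short_exact C i p" "src C i \<in> trivs M" "src C i \<in> fibs M" "f \<in> arrs C"
    "tgt C f = tgt C p" "src C f \<in> cofs M"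
  obtains t where "t \<in> arrs C" "src C t = src C f" "tgt C t = tgt C i" "p \<cdot> t = f"
  by (rule splits_lift[OF splits1[OF assms(6,2,3)] assms(1,4,5)]) simp_all

lemma lift_fibs:
  assumes "short_exact C i p" "src C i \<in> fibs M" "f \<in> arrs C" "tgt C f = tgt C p" "src C f \<in> cofs M"
    "src C f \<in> trivs M"
  obtains t where "t \<in> arrs C" "src C t = src C f" "tgt C t = tgt C i" "p \<cdot> t = f"
  by (rule splits_lift[OF splits2[OF assms(5,6,2)] assms(1,3,4)]) simp_all

text \<open>The trivial object in the middle is moved into the core. A fibrant replacement of it is
  still trivial, and \<open>h\<close> extends to that because its target is fibrant; a cofibrant
  replacement of the result lies in the core, and the map from \<open>src C g\<close> lifts to it
  because \<open>src C g\<close> is cofibrant.\<close>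

lemma null_factor:
  assumes [simp]: "g \<in> arrs C" "h \<in> arrs C" "tgt C g = src C h"
    and "src C h \<in> trivs M" "src C g \<in> cofs M" "tgt C h \<in> fibs M"
  shows "h \<cdot> g \<in> core_maps C M (src C g) (tgt C h)"
proof -
  obtain i p where ip: "short_exact C i p" "src C i = src C h" "tgt C p \<in> trivs M"
    "tgt C p \<in> cofs M" "tgt C i \<in> fibs M"
    by (rule fibrant_replacement_exists)
  then have w: "tgt C i \<in> trivs M" using trivs_extension[OF ip(1)] assms(4) by simp
  note [simp] = sesD(1,2)[OF ip(1)] ip(2)
  obtain t where t [simp]: "t \<in> arrs C" "src C t = tgt C i" "tgt C t = tgt C h" "t \<cdot> i = h"
    by (rule extend_triv_cofs[OF ip(1,4,3), of h]) (simp_all add: assms(6))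
  obtain j q where jq: "short_exact C j q" "tgt C q = tgt C i" "src C j \<in> trivs M"
    "src C j \<in> fibs M" "tgt C j \<in> core M"
    by (rule trivs_to_core[OF w ip(5)])
  note [simp] = sesD(1-3)[OF jq(1)] jq(2)
  obtain s where s [simp]: "s \<in> arrs C" "src C s = src C g" "tgt C s = tgt C j" "q \<cdot> s = i \<cdot> g"
    by (rule lift_triv_fibs[OF jq(1,3,4), of "i \<cdot> g"]) (simp_all add: assms(5))
  have "(t \<cdot> q) \<cdot> s \<in> core_maps C M (src C g) (tgt C h)"
    by (rule core_mapsI[OF jq(5)]) simp_all
  moreover have "(t \<cdot> q) \<cdot> s = h \<cdot> g" by (simp add: reassoc[OF t(4)])
  ultimately show ?thesis by simp
qed

text \<open>The core object is trivially fibrant, so the factor \<open>g\<close> into it extends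
  along \<open>i\<close>.\<close>

lemma core_maps_extend:
  assumes "f \<in> core_maps C M x y" "short_exact C i p" "src C i = x" "tgt C p \<in> cofs M"
  obtains t where "t \<in> core_maps C M (tgt C i) y" "t \<cdot> i = f"
proof -
  obtain w g h where 1 [simp]: "w \<in> core M" "g \<in> arrs C" "h \<in> arrs C" "tgt C g = w" "src C h = w"
    "src C g = x" "tgt C h = y" "f = h \<cdot> g"
    using assms(1) by (rule core_mapsE)
  obtain t where "t \<in> arrs C" "src C t = tgt C i" "tgt C t = w" "t \<cdot> i = g"
    by (rule extend_cofs[OF assms(2,4), of g]) (use 1(1) assms(3) in \<open>simp_all add: core_def\<close>)
  then show ?thesis
    using sesD(1)[OF assms(2)] by (intro that[of "h \<cdot> t"] core_mapsI[OF 1(1)]) simp_all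
qed

lemma ses_map_opc:
  assumes "short_exact C i p" "short_exact C i' p'"
  shows "ses_map (opc C) p' i' p i c f \<longleftrightarrow> ses_map C i p i' p' f c"
  using sesD(3)[OF assms(1)] sesD(3)[OF assms(2)] unfolding ses_map_def Mor_opc opc_simps by metis

lemma core_maps_lift:
  assumes "f \<in> core_maps C M x y" "short_exact C i p" "tgt C p = y" "src C i \<in> fibs M"
  obtains t where "t \<in> core_maps C M x (tgt C i)" "p \<cdot> t = f"
  using model.core_maps_extend[OF model_opc, of f y x p i] assms sesD(3)[OF assms(2)] by auto

lemma ses_map_right_exists:
  assumes "short_exact C i p" "short_exact C i' p'" "tgt C p \<in> cofs M" "tgt C i' \<in> trivs M"
    "tgt C i' \<in> fibs M"
    and "f \<in> Mor C (src C i) (src C i')"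
  obtains c where "ses_map C i p i' p' f c"
proof -
  note [simp] = sesD[OF assms(1)] sesD[OF assms(2)] MorD[OF assms(6)]
  obtain v where v [simp]: "v \<in> arrs C" "src C v = tgt C i" "tgt C v = tgt C i'" "v \<cdot> i = i' \<cdot> f"
    by (rule extend_cofs[OF assms(1,3), of "i' \<cdot> f"]) (simp_all add: assms(4,5))
  obtain c where "c \<in> arrs C" "tgt C c = tgt C p'" "src C c = tgt C p" "c \<cdot> p = p' \<cdot> v"
    by (rule ses_colift[OF assms(1), of "p' \<cdot> v"]) simp_all
  then have "ses_map C i p i' p' f c" unfolding ses_map_def
    by (intro conjI bexI[of _ v]) (simp_all add: Mor_def)
  then show ?thesis by (rule that)
qed

text \<open>The null map \<open>f\<close> extends to \<open>t\<close> on the middle term. The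
  difference \<open>v -. i' \<cdot> t\<close> vanishes on \<open>i\<close>, so it descends to some
  \<open>r\<close>, and \<open>c = p' \<cdot> r\<close> passes through the trivial object
  \<open>tgt C i'\<close>.\<close>

lemma ses_map_null_right:
  assumes "short_exact C i p" "short_exact C i' p'" "tgt C p \<in> cofs M" "tgt C i' \<in> trivs M"
    "tgt C p' \<in> fibs M"
    and fc: "ses_map C i p i' p' f c" "f \<in> core_maps C M (src C i) (src C i')"
  shows "c \<in> core_maps C M (tgt C p) (tgt C p')"
proof -
  note [simp] = sesD[OF assms(1)] sesD[OF assms(2)]
  obtain v where v [simp]: "v \<in> arrs C" "src C v = tgt C i" "tgt C v = tgt C i'" "v \<cdot> i = i' \<cdot> f"
    "c \<cdot> p = p' \<cdot> v"
    "c \<in> arrs C" "src C c = tgt C p" "tgt C c = tgt C p'"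
    using fc(1) by (auto simp: ses_map_def Mor_def)
  obtain t where t: "t \<in> core_maps C M (tgt C i) (src C i')" "t \<cdot> i = f"
    by (rule core_maps_extend[OF fc(2) assms(1) _ assms(3)]) simp_all
  note [simp] = MorD[OF core_maps_Mor[OF t(1)]] t(2) MorD[OF core_maps_Mor[OF fc(2)]]
  obtain r where r [simp]: "r \<in> arrs C" "tgt C r = tgt C i'" "src C r = tgt C p"
    "r \<cdot> p = v -. i' \<cdot> t"
    by (rule ses_colift[OF assms(1), of "v -. i' \<cdot> t"]) simp_all
  have "c = p' \<cdot> r" by (rule is_epiD[OF sesD(7)[OF assms(1)]]) simp_all
  then show ?thesis using null_factor[of r p'] assms by simp
qed

lemma ses_map_comp:
  assumes "short_exact C i p" "short_exact C i' p'" "short_exact C i'' p''"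
    "ses_map C i p i' p' f c" "ses_map C i' p' i'' p'' g d"
  shows "ses_map C i p i'' p'' (g \<cdot> f) (d \<cdot> c)"
proof -
  note [simp] = sesD(1-3)[OF assms(1)] sesD(1-3)[OF assms(2)] sesD(1-3)[OF assms(3)]
  obtain v where [simp]: "v \<in> arrs C" "src C v = tgt C i" "tgt C v = tgt C i'" "c \<in> arrs C"
    "src C c = tgt C p" "tgt C c = tgt C p'"
    "f \<in> arrs C" "src C f = src C i" "tgt C f = src C i'" and v: "v \<cdot> i = i' \<cdot> f" "c \<cdot> p = p' \<cdot> v"
    using assms(4) by (auto simp: ses_map_def Mor_def)
  obtain u where [simp]: "u \<in> arrs C" "src C u = tgt C i'" "tgt C u = tgt C i''" "d \<in> arrs C"
    "src C d = tgt C p'" "tgt C d = tgt C p''"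
    "g \<in> arrs C" "src C g = src C i'" "tgt C g = src C i''"
    and u: "u \<cdot> i' = i'' \<cdot> g" "d \<cdot> p' = p'' \<cdot> u"
    using assms(5) by (auto simp: ses_map_def Mor_def)
  show ?thesis unfolding ses_map_def
    by (intro conjI bexI[of _ "u \<cdot> v"]) (simp_all add: Mor_def v reassoc[OF u(1)] reassoc[OF u(2)])
qed

lemma ses_map_hsub:
  assumes "short_exact C i p" "short_exact C i' p'" "ses_map C i p i' p' f c"
    "ses_map C i p i' p' g d"
  shows "ses_map C i p i' p' (f -. g) (c -. d)"
proof -
  note [simp] = sesD(1-3)[OF assms(1)] sesD(1-3)[OF assms(2)]
  obtain v where [simp]: "v \<in> arrs C" "src C v = tgt C i" "tgt C v = tgt C i'" "c \<in> arrs C"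
    "src C c = tgt C p" "tgt C c = tgt C p'"
    "f \<in> arrs C" "src C f = src C i" "tgt C f = src C i'" and v: "v \<cdot> i = i' \<cdot> f" "c \<cdot> p = p' \<cdot> v"
    using assms(3) by (auto simp: ses_map_def Mor_def)
  obtain u where [simp]: "u \<in> arrs C" "src C u = tgt C i" "tgt C u = tgt C i'" "d \<in> arrs C"
    "src C d = tgt C p" "tgt C d = tgt C p'"
    "g \<in> arrs C" "src C g = src C i" "tgt C g = src C i'" and u: "u \<cdot> i = i' \<cdot> g" "d \<cdot> p = p' \<cdot> u"
    using assms(4) by (auto simp: ses_map_def Mor_def)
  show ?thesis unfolding ses_map_def
    by (intro conjI bexI[of _ "v -. u"]) (simp_all add: Mor_def v u)
qed

lemma ses_map_hadd:
  assumes "short_exact C i p" "short_exact C i' p'" "ses_map C i p i' p' f c"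
    "ses_map C i p i' p' g d"
  shows "ses_map C i p i' p' (f +. g) (c +. d)"
proof -
  note [simp] = sesD(1-3)[OF assms(1)] sesD(1-3)[OF assms(2)]
  obtain v where [simp]: "v \<in> arrs C" "src C v = tgt C i" "tgt C v = tgt C i'" "c \<in> arrs C"
    "src C c = tgt C p" "tgt C c = tgt C p'"
    "f \<in> arrs C" "src C f = src C i" "tgt C f = src C i'" and v: "v \<cdot> i = i' \<cdot> f" "c \<cdot> p = p' \<cdot> v"
    using assms(3) by (auto simp: ses_map_def Mor_def)
  obtain u where [simp]: "u \<in> arrs C" "src C u = tgt C i" "tgt C u = tgt C i'" "d \<in> arrs C"
    "src C d = tgt C p" "tgt C d = tgt C p'"
    "g \<in> arrs C" "src C g = src C i" "tgt C g = src C i'" and u: "u \<cdot> i = i' \<cdot> g" "d \<cdot> p = p' \<cdot> u"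
    using assms(4) by (auto simp: ses_map_def Mor_def)
  show ?thesis unfolding ses_map_def
    by (intro conjI bexI[of _ "v +. u"]) (simp_all add: Mor_def v u)
qed

lemma ses_map_left_exists:
  assumes "short_exact C i p" "short_exact C i' p'" "src C i' \<in> fibs M" "tgt C i \<in> trivs M"
    "tgt C i \<in> cofs M"
    and "c \<in> Mor C (tgt C p) (tgt C p')"
  obtains f where "ses_map C i p i' p' f c"
proof -
  obtain f where "ses_map (opc C) p' i' p i c f"
    by (rule model.ses_map_right_exists[OF model_opc, of p' i' p i c])
      (use assms sesD(3) in simp_all)
  then show ?thesis using ses_map_opc[OF assms(1,2)] that by blast
qed

lemma ses_map_null_left:
  assumes "short_exact C i p" "short_exact C i' p'" "src C i' \<in> fibs M" "tgt C i \<in> trivs M"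
    "src C i \<in> cofs M"
    and fc: "ses_map C i p i' p' f c" "c \<in> core_maps C M (tgt C p) (tgt C p')"
  shows "f \<in> core_maps C M (src C i) (src C i')"
proof -
  have "ses_map (opc C) p' i' p i c f" using fc ses_map_opc[OF assms(1,2)] by blast
  then show ?thesis
    using model.ses_map_null_right[OF model_opc, of p' i' p i c f] assms sesD(3)[OF assms(1)]
      by simp
qed

text \<open>The objects of the family are \<open>X\<^sub>n = tgt (b n)\<close>, and \<open>X\<^sub>n\<^sub>+\<^sub>1 \<rightarrow> W\<^sub>n \<rightarrow> X\<^sub>n\<close> is given by \<open>a n\<close> and \<open>b n\<close>.\<close>

definition zseq :: "(int \<Rightarrow> 'b) \<Rightarrow> (int \<Rightarrow> 'b) \<Rightarrow> bool" where
  "zseq a b \<longleftrightarrow> (\<forall>n. short_exact C (a n) (b n) \<and> src C (a n) = tgt C (b (n + 1)) \<and>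
      tgt C (a n) \<in> trivs M)"

definition zmap :: "(int \<Rightarrow> 'b) \<Rightarrow> (int \<Rightarrow> 'b) \<Rightarrow> (int \<Rightarrow> 'b) \<Rightarrow> (int \<Rightarrow> 'b) \<Rightarrow> (int \<Rightarrow> 'b) \<Rightarrow> bool" where
  "zmap a b a' b' \<phi> \<longleftrightarrow> (\<forall>n. ses_map C (a n) (b n) (a' n) (b' n) (\<phi> (n + 1)) (\<phi> n))"

section \<open>Morphisms of families and one-sided equivalences\<close>

lemma zseqD:
  assumes "zseq a b"
  shows "short_exact C (a n) (b n)" "src C (a n) = tgt C (b (n + 1))" "tgt C (a n) \<in> trivs M"
  using assms by (auto simp: zseq_def)

lemma zseq_cofs: "\<lbrakk>zseq a b; \<And>n. tgt C (b n) \<in> cofs M\<rbrakk> \<Longrightarrow> tgt C (a n) \<in> cofs M"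
  using cofs_extension[OF zseqD(1)] zseqD(2) by metis

lemma zseq_fibs: "\<lbrakk>zseq a b; \<And>n. tgt C (b n) \<in> fibs M\<rbrakk> \<Longrightarrow> tgt C (a n) \<in> fibs M"
  using fibs_extension[OF zseqD(1)] zseqD(2) by metis

lemma zseq_shift: "zseq a b \<Longrightarrow> zseq (\<lambda>k. a (k + m)) (\<lambda>k. b (k + m))"
  by (simp add: zseq_def ac_simps)

lemma zmap_shift:
  assumes "zmap a b a' b' \<phi>"
  shows "zmap (\<lambda>k. a (k + m)) (\<lambda>k. b (k + m)) (\<lambda>k. a' (k + m)) (\<lambda>k. b' (k + m)) (\<lambda>k. \<phi> (k + m))"
  unfolding zmap_def
proof
  fix n
  have e: "n + 1 + m = n + m + 1" by simp
  show "ses_map C (a (n + m)) (b (n + m)) (a' (n + m)) (b' (n + m)) (\<phi> (n + 1 + m)) (\<phi> (n + m))"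
    unfolding e using assms by (simp only: zmap_def)
qed

lemma zmapD: assumes "zmap a b a' b' \<phi>"
  shows "ses_map C (a n) (b n) (a' n) (b' n) (\<phi> (n + 1)) (\<phi> n)"
    "\<phi> n \<in> Mor C (tgt C (b n)) (tgt C (b' n))"
  using assms by (auto simp: zmap_def ses_map_def)

text \<open>From \<open>f\<close> the family is continued to higher indices by lifting middle terms
  and to lower ones by extending them; a cofibrant source family and a fibrant target family permit
  both.\<close>

lemma zmap_exists:
  assumes "zseq a b" "zseq a' b'" and Q: "\<And>n. tgt C (b n) \<in> cofs M"
    and R: "\<And>n. tgt C (b' n) \<in> fibs M"
    and "f \<in> Mor C (tgt C (b N)) (tgt C (b' N))"
  obtains \<phi> where "zmap a b a' b' \<phi>" "\<phi> N = f"
proof -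
  have "\<exists>\<phi>. \<phi> N = f \<and> (\<forall>n. \<phi> n \<in> Mor C (tgt C (b n)) (tgt C (b' n))) \<and>
      (\<forall>n. ses_map C (a n) (b n) (a' n) (b' n) (\<phi> (n + 1)) (\<phi> n))"
  proof (rule int_family[where P = "\<lambda>n x. x \<in> Mor C (tgt C (b n)) (tgt C (b' n))"
    and R = "\<lambda>n x y. ses_map C (a n) (b n) (a' n) (b' n) y x", OF assms(5)])
    fix n x assume x: "x \<in> Mor C (tgt C (b n)) (tgt C (b' n))"
    obtain y where "ses_map C (a n) (b n) (a' n) (b' n) y x"
      by (rule ses_map_left_exists[OF zseqD(1)[OF assms(1)] zseqD(1)[OF assms(2)]
        _ zseqD(3)[OF assms(1)] zseq_cofs[OF assms(1) Q] x])
        (simp_all add: R zseqD(2)[OF assms(2)])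
    then show "\<exists>y. y \<in> Mor C (tgt C (b (n + 1))) (tgt C (b' (n + 1))) \<and>
        ses_map C (a n) (b n) (a' n) (b' n) y x"
      by (auto simp: ses_map_def zseqD(2)[OF assms(1)] zseqD(2)[OF assms(2)])
  next
    fix n y assume "y \<in> Mor C (tgt C (b (n + 1))) (tgt C (b' (n + 1)))"
    then have y: "y \<in> Mor C (src C (a n)) (src C (a' n))"
      by (simp add: zseqD(2)[OF assms(1)] zseqD(2)[OF assms(2)])
    obtain x where "ses_map C (a n) (b n) (a' n) (b' n) y x"
      by (rule ses_map_right_exists[OF zseqD(1)[OF assms(1)] zseqD(1)[OF assms(2)]
        Q zseqD(3)[OF assms(2)] zseq_fibs[OF assms(2) R] y])
    then show "\<exists>x. x \<in> Mor C (tgt C (b n)) (tgt C (b' n)) \<and> ses_map C (a n) (b n) (a' n) (b' n) y x"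
      by (auto simp: ses_map_def)
  qed
  then show ?thesis using that unfolding zmap_def by blast
qed

lemma zmap_null:
  assumes "zseq a b" "zseq a' b'" and Q: "\<And>n. tgt C (b n) \<in> cofs M"
    and R: "\<And>n. tgt C (b' n) \<in> fibs M"
    and "zmap a b a' b' \<phi>" "\<phi> N \<in> core_maps C M (tgt C (b N)) (tgt C (b' N))"
  shows "\<phi> n \<in> core_maps C M (tgt C (b n)) (tgt C (b' n))"
proof -
  have step: "\<phi> (n + 1) \<in> core_maps C M (tgt C (b (n + 1))) (tgt C (b' (n + 1))) \<longleftrightarrow>
     \<phi> n \<in> core_maps C M (tgt C (b n)) (tgt C (b' n))" for n
    using ses_map_null_right[OF zseqD(1)[OF assms(1)] zseqD(1)[OF assms(2)] Q zseqD(3)[OF assms(2)]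
      R zmapD(1)[OF assms(5)], of n]
      ses_map_null_left[OF zseqD(1)[OF assms(1)] zseqD(1)[OF assms(2)] _ zseqD(3)[OF assms(1)]
        _ zmapD(1)[OF assms(5)], of n]
    by (auto simp: Q R zseqD(2)[OF assms(1)] zseqD(2)[OF assms(2)])
  show ?thesis
  proof (induction n rule: int_induct[where k = N])
    case base
    show ?case by (rule assms(6))
  next
    case (step1 i)
    then show ?case using step[of i] by simp
  next
    case (step2 i)
    then show ?case using step[of "i - 1"] by simp
  qed
qed

lemma zmap_hsub:
  "\<lbrakk>zseq a b; zseq a' b'; zmap a b a' b' \<phi>; zmap a b a' b' \<psi>\<rbrakk> \<Longrightarrow> zmap a b a' b' (\<lambda>n. \<phi> n -. \<psi> n)"
  unfolding zmap_def using ses_map_hsub zseqD(1) by blast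

lemma zmap_hadd:
  "\<lbrakk>zseq a b; zseq a' b'; zmap a b a' b' \<phi>; zmap a b a' b' \<psi>\<rbrakk> \<Longrightarrow> zmap a b a' b' (\<lambda>n. \<phi> n +. \<psi> n)"
  unfolding zmap_def using ses_map_hadd zseqD(1) by blast

lemma zmap_comp:
  "\<lbrakk>zseq a b; zseq a' b'; zseq a'' b''; zmap a b a' b' \<phi>; zmap a' b' a'' b'' \<psi>\<rbrakk> \<Longrightarrow>
      zmap a b a'' b'' (\<lambda>n. \<psi> n \<cdot> \<phi> n)"
  unfolding zmap_def using ses_map_comp zseqD(1) by blast

lemma zmap_cong:
  assumes "zseq a b" "zseq a' b'" and Q: "\<And>n. tgt C (b n) \<in> cofs M"
    and R: "\<And>n. tgt C (b' n) \<in> fibs M"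
    and "zmap a b a' b' \<phi>" "zmap a b a' b' \<psi>" "\<phi> N \<approx> \<psi> N"
  shows "\<phi> n \<approx> \<psi> n"
proof -
  have m: "\<phi> n -. \<psi> n \<in> core_maps C M (tgt C (b n)) (tgt C (b' n)) \<longleftrightarrow> \<phi> n \<approx> \<psi> n" for n
    using zmapD(2)[OF assms(5), of n] zmapD(2)[OF assms(6), of n] by (auto simp: Mor_def stabeq_def)
  show ?thesis
    using zmap_null[OF assms(1-4) zmap_hsub[OF assms(1,2,5,6)], of N n] m assms(7) by simp
qed

lemma loop_exists:
  obtains i p where "short_exact C i p" "tgt C p = A" "src C i \<in> fibs M" "tgt C i \<in> cofs M"
    "tgt C i \<in> trivs M"
  using pair2 sesD(3) unfolding good_pair_def complete_pair_def by (metis IntE)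

text \<open>Places a fibrant test object at a chosen index of a family, so that tests against it can
  be moved to other indices. For lower indices fibrancy is preserved by
  \<open>fibs_cokernel\<close>.\<close>

lemma zseq_fibs_exists:
  assumes "y \<in> fibs M"
  obtains a b where "zseq a b" "tgt C (b N) = y" "\<And>n. tgt C (b n) \<in> fibs M"
proof -
  have "\<exists>Y. Y N = y \<and> (\<forall>n :: int. Y n \<in> fibs M) \<and> (\<forall>n. \<exists>i p. short_exact C i p \<and>
      src C i = Y (n + 1) \<and> tgt C p = Y n \<and> tgt C i \<in> trivs M)"
  proof (rule int_family[where N = N and P = "\<lambda>n Y. Y \<in> fibs M"
    and R = "\<lambda>n Y Z. \<exists>i p. short_exact C i p \<and> src C i = Z \<and> tgt C p = Y \<and>
      tgt C i \<in> trivs M", OF assms])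
    fix Y assume "Y \<in> fibs M"
    obtain i p where "short_exact C i p" "tgt C p = Y" "src C i \<in> fibs M" "tgt C i \<in> cofs M"
      "tgt C i \<in> trivs M"
      by (rule loop_exists)
    then show "\<exists>Z. Z \<in> fibs M \<and> (\<exists>i p. short_exact C i p \<and> src C i = Z \<and> tgt C p = Y \<and>
        tgt C i \<in> trivs M)" by blast
  next
    fix Z assume "Z \<in> fibs M"
    obtain i p where "short_exact C i p" "src C i = Z" "tgt C p \<in> cofs M" "tgt C i \<in> trivs M"
      "tgt C i \<in> fibs M"
      by (rule suspension_exists)
    then show "\<exists>Y. Y \<in> fibs M \<and> (\<exists>i p. short_exact C i p \<and> src C i = Z \<and> tgt C p = Y \<and>
        tgt C i \<in> trivs M)"
      using fibs_cokernel[of i p] \<open>Z \<in> fibs M\<close> by blast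
  qed
  then obtain Y where Y: "Y N = y" "\<And>n. Y n \<in> fibs M"
    "\<forall>n. \<exists>i p. short_exact C i p \<and> src C i = Y (n + 1) \<and> tgt C p = Y n \<and> tgt C i \<in> trivs M" by blast
  from choice[OF Y(3)] obtain a where a:
    "\<forall>n. \<exists>p. short_exact C (a n) p \<and> src C (a n) = Y (n + 1) \<and> tgt C p = Y n \<and>
      tgt C (a n) \<in> trivs M"
    by blast
  from choice[OF a] obtain b where
    "\<And>n. short_exact C (a n) (b n) \<and> src C (a n) = Y (n + 1) \<and> tgt C (b n) = Y n \<and>
      tgt C (a n) \<in> trivs M"
    by blast
  then show ?thesis using Y by (intro that[of a b]) (simp_all add: zseq_def)
qed

text \<open>Maps that become invertible in the homotopy category, tested on one side only so that no
  bifibrancy of source or target is needed.\<close>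

definition pre_equiv :: "'b \<Rightarrow> bool" where
  "pre_equiv w \<longleftrightarrow> (\<forall>y\<in>fibs M. (\<forall>h\<in>Mor C (tgt C w) y. h \<cdot> w \<in> core_maps C M (src C w) y \<longrightarrow>
      h \<in> core_maps C M (tgt C w) y) \<and>
     (\<forall>z\<in>Mor C (src C w) y. \<exists>h\<in>Mor C (tgt C w) y. h \<cdot> w \<approx> z))"

definition post_equiv :: "'b \<Rightarrow> bool" where
  "post_equiv w \<longleftrightarrow> (\<forall>x\<in>cofs M. (\<forall>h\<in>Mor C x (src C w). w \<cdot> h \<in> core_maps C M x (tgt C w) \<longrightarrow>
      h \<in> core_maps C M x (src C w)) \<and>
     (\<forall>z\<in>Mor C x (tgt C w). \<exists>h\<in>Mor C x (src C w). w \<cdot> h \<approx> z))"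

text \<open>The test object \<open>y\<close> is put at index \<open>n\<close> of a fibrant family. A
  map to it spreads to a morphism of families, the test is decided at index \<open>N\<close>, and
  the answer is transported back to \<open>n\<close>.\<close>

lemma pre_equiv_zmap:
  assumes z: "zseq a b" "zseq a' b'" and Q: "\<And>n. tgt C (b n) \<in> cofs M" "\<And>n. tgt C (b' n) \<in> cofs M"
    and w: "zmap a b a' b' w" "pre_equiv (w N)"
  shows "pre_equiv (w n)"
  unfolding pre_equiv_def
proof (intro ballI conjI impI)
  fix y assume y: "y \<in> fibs M"
  obtain c d where cd: "zseq c d" "tgt C (d n) = y" "\<And>n. tgt C (d n) \<in> fibs M"
    using zseq_fibs_exists[OF y] by blast
  have wm: "src C (w k) = tgt C (b k)" "tgt C (w k) = tgt C (b' k)" for k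
    using zmapD(2)[OF w(1), of k] by (simp_all add: Mor_def)
  fix h assume h: "h \<in> Mor C (tgt C (w n)) y" "h \<cdot> w n \<in> core_maps C M (src C (w n)) y"
  obtain \<phi> where f: "zmap a' b' c d \<phi>" "\<phi> n = h"
    using zmap_exists[OF z(2) cd(1) Q(2) cd(3), of h n] h wm cd(2) by auto
  have "\<phi> N \<cdot> w N \<in> core_maps C M (tgt C (b N)) (tgt C (d N))"
    using zmap_null[OF z(1) cd(1) Q(1) cd(3) zmap_comp[OF z cd(1) w(1) f(1)], of n N] h(2) wm cd(2)
      f(2) by simp
  then have "\<phi> N \<in> core_maps C M (tgt C (b' N)) (tgt C (d N))"
    using w(2) cd(3) zmapD(2)[OF f(1), of N] unfolding pre_equiv_def wm by blast
  then show "h \<in> core_maps C M (tgt C (w n)) y"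
    using zmap_null[OF z(2) cd(1) Q(2) cd(3) f(1), of N n] f(2) cd(2) wm by simp
next
  fix y assume y: "y \<in> fibs M"
  obtain c d where cd: "zseq c d" "tgt C (d n) = y" "\<And>n. tgt C (d n) \<in> fibs M"
    using zseq_fibs_exists[OF y] by blast
  have wm: "src C (w k) = tgt C (b k)" "tgt C (w k) = tgt C (b' k)" for k
    using zmapD(2)[OF w(1), of k] by (simp_all add: Mor_def)
  fix z' assume "z' \<in> Mor C (src C (w n)) y"
  then obtain \<zeta> where \<zeta>: "zmap a b c d \<zeta>" "\<zeta> n = z'"
    using zmap_exists[OF z(1) cd(1) Q(1) cd(3), of z' n] wm cd(2) by auto
  obtain h where h: "h \<in> Mor C (tgt C (b' N)) (tgt C (d N))" "h \<cdot> w N \<approx> \<zeta> N"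
    using w(2) cd(3) zmapD(2)[OF \<zeta>(1), of N] unfolding pre_equiv_def wm by blast
  obtain \<phi> where f: "zmap a' b' c d \<phi>" "\<phi> N = h"
    using zmap_exists[OF z(2) cd(1) Q(2) cd(3) h(1)] by auto
  have "\<phi> n \<cdot> w n \<approx> \<zeta> n"
    using zmap_cong[OF z(1) cd(1) Q(1) cd(3) zmap_comp[OF z cd(1) w(1) f(1)] \<zeta>(1), of N n] h(2) f(2)
      by simp
  then show "\<exists>h\<in>Mor C (tgt C (w n)) y. h \<cdot> w n \<approx> z'"
    using \<zeta>(2) zmapD(2)[OF f(1), of n] cd(2) wm by auto
qed

lemma stabeq_opc: "model.stabeq (opc C) (opm M) f g \<longleftrightarrow> stabeq f g"
  using model.stabeq_def[OF model_opc, of f g] by (auto simp: stabeq_def)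

lemma post_equiv_opc: "model.pre_equiv (opc C) (opm M) w \<longleftrightarrow> post_equiv w"
  using model.pre_equiv_def[OF model_opc, of w] by (simp add: post_equiv_def stabeq_opc)

text \<open>The opposite family runs backwards, and its object at index \<open>i\<close> is the
  source of \<open>a (- i)\<close>, which is the object of the original family at
  \<open>1 - i\<close>. Hence morphisms of families are reindexed by \<open>1 - i\<close> and not by
  \<open>- i\<close>.\<close>

lemma zseq_opc: assumes "zseq a b" shows "model.zseq (opc C) (opm M) (\<lambda>i. b (- i)) (\<lambda>i. a (- i))"
  unfolding model.zseq_def[OF model_opc]
  using zseqD(1,3)[OF assms] zseqD(2)[OF assms, of "- n - 1" for n] sesD(3)[OF zseqD(1)[OF assms]]
    by simp

lemma zmap_opc:
  assumes "zseq a b" "zseq a' b'" "zmap a b a' b' \<phi>"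
  shows "model.zmap (opc C) (\<lambda>i. b' (- i)) (\<lambda>i. a' (- i)) (\<lambda>i. b (- i)) (\<lambda>i. a (- i)) (\<lambda>i. \<phi> (1 -
      i))"
  unfolding model.zmap_def[OF model_opc]
  using ses_map_opc[OF zseqD(1)[OF assms(1)] zseqD(1)[OF assms(2)]] zmapD(1)[OF assms(3), of "- n"
    for n]
  by (simp add: add.commute)

lemma post_equiv_zmap:
  assumes z: "zseq a b" "zseq a' b'" and R: "\<And>n. tgt C (b n) \<in> fibs M" "\<And>n. tgt C (b' n) \<in> fibs M"
    and w: "zmap a b a' b' w" "post_equiv (w N)"
  shows "post_equiv (w n)"
  using model.pre_equiv_zmap[OF model_opc zseq_opc[OF z(2)] zseq_opc[OF z(1)]
    _ _ zmap_opc[OF z w(1)], of "1 - N" "1 - n"]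
    R w(2) zseqD(2)[OF z(1)] zseqD(2)[OF z(2)] by (simp add: post_equiv_opc)

end

section \<open>Bifibrant replacements\<close>

text \<open>\<open>pullback_exists\<close> speaks only of the pullback that it builds; the
  comparison arrow \<open>h\<close> from that one carries the property over to any other.\<close>

lemma (in abelian_category) pullback_epi:
  assumes "is_pullback C f g p q" "is_epi C f" shows "is_epi C q"
proof -
  note [simp] = pullbackD(1-4,6-9)[OF assms(1)]
  obtain p' q' where 1: "is_pullback C g f p' q'" "is_epi C f \<Longrightarrow> is_epi C p'"
    by (rule pullback_exists[of g f]) (simp_all add: pullbackD(5)[OF assms(1)])
  have [simp]: "p' \<in> arrs C" "q' \<in> arrs C" "src C p' = src C q'" "tgt C p' = src C g"
    "tgt C q' = src C f" "g \<cdot> p' = f \<cdot> q'"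
    using pullbackD[OF 1(1)] by simp_all
  obtain h where h [simp]: "h \<in> arrs C" "src C h = src C p'" "tgt C h = src C q" "p \<cdot> h = q'"
    "q \<cdot> h = p'"
    by (rule pullback_lift[OF assms(1), of q' p']) simp_all
  have "is_epi C (q \<cdot> h)" using 1(2) assms(2) by simp
  then show ?thesis by (rule is_epi_cmpD) simp_all
qed

section \<open>Replacing short exact sequences with prescribed ends\<close>

context model
begin

text \<open>A horseshoe lemma with both end replacements prescribed. Pulling back along
  \<open>qz\<close> installs the right end; installing the left end meets an obstruction in Ext^2 of
  a cofibrant object by a trivially fibrant one. The weave that kills it provides the middle term,
  whose map to \<open>tgt C i\<close> has as kernel an extension of the two given kernels.\<close>

lemma cofibrant_ses_replacement:
  assumes "short_exact C i p" "short_exact C kx qx" "short_exact C kz qz" "tgt C qx = src C i"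
    "tgt C qz = tgt C p"
    and "src C kx \<in> trivs M" "src C kx \<in> fibs M" "src C kz \<in> trivs M" "src C kz \<in> fibs M"
      "src C qx \<in> cofs M" "src C qz \<in> cofs M"
  obtains i0 p0 k a where "short_exact C i0 p0" "src C i0 = src C qx" "tgt C p0 = src C qz"
    "short_exact C k a"
    "src C k \<in> trivs M" "src C k \<in> fibs M" "tgt C a = tgt C i" "src C a = tgt C i0"
    "a \<cdot> i0 = i \<cdot> qx" "qz \<cdot> p0 = p \<cdot> a" "tgt C i0 \<in> cofs M"
proof -
  note [simp] = sesD[OF assms(1)] sesD(1,2,4,5)[OF assms(2)] sesD(1,2,4,5)[OF assms(3)]
    sesD(3)[OF assms(2), symmetric]
    sesD(3)[OF assms(3), symmetric] assms(4,5)
  obtain i1 p1 f where 1: "short_exact C i1 p1" "src C i1 = src C i" "tgt C p1 = src C qz"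
    "is_pullback C qz p p1 f" "f \<cdot> i1 = i"
    by (rule ses_pullback[OF assms(1), of qz]) simp_all
  have [simp]: "f \<in> arrs C" "src C f = tgt C i1" "tgt C f = tgt C i" and e: "qz \<cdot> p1 = p \<cdot> f"
    using pullbackD[OF 1(4)] sesD(3)[OF 1(1)] by simp_all
  note [simp] = sesD[OF 1(1)] 1(2,3)
  obtain k1 where k1: "is_kernel C f k1" "src C k1 = src C kz"
    using pullback_kernel[OF is_pullback_sym[OF 1(4)], of kz] assms(3)
      by (auto simp: short_exact_def)
  have s1: "short_exact C k1 f" using epi_kernel_cokernel[OF _ k1(1)] pullback_epi[OF 1(4)]
    sesD(7)[OF assms(3)] by blast
  have "splices C (tgt C p1) (src C kx)"
    using good_pairD(2)[OF pair1, of "src C qz" "src C kx"] assms(6,7,11) by simp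
  moreover have "tgt C qx = src C i1" by simp
  \<comment> \<open>The obstruction is the splice of \<open>(kx, qx)\<close> with
    \<open>(i1, p1)\<close>. The second sequence of its weave has the wanted ends
    \<open>src C qx\<close> and \<open>src C qz\<close>.\<close>
  ultimately obtain \<alpha> \<beta> where w: "weave C kx (i1 \<cdot> qx) p1 \<alpha> \<beta>"
    using 1(1) assms(2) unfolding splices_def by blast
  then have [simp]: "\<alpha> \<in> arrs C" "\<beta> \<in> arrs C" "src C \<alpha> = src C qx" "src C \<beta> = tgt C \<alpha>"
    "tgt C \<beta> = tgt C i1"
    and ba: "\<beta> \<cdot> \<alpha> = i1 \<cdot> qx" and s2: "short_exact C (\<alpha> \<cdot> kx) \<beta>" and s3: "short_exact C \<alpha> (p1 \<cdot> \<beta>)"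
    by (simp_all add: weave_def)
  obtain k u v where 2: "short_exact C k (f \<cdot> \<beta>)" "short_exact C u v" "src C u = src C (\<alpha> \<cdot> kx)"
    "tgt C u = src C k" "tgt C v = src C k1"
    by (rule comp_ses_epi[OF s2 s1]) (use sesD(3)[OF s1] in simp_all)
  have "src C k \<in> trivs M" "src C k \<in> fibs M"
    using trivs_extension[OF 2(2)] fibs_extension[OF 2(2)] 2 k1 assms(6-9) by simp_all
  moreover have "(f \<cdot> \<beta>) \<cdot> \<alpha> = i \<cdot> qx" using 1(5) by (simp add: ba reassoc)
  moreover have "qz \<cdot> p1 \<cdot> \<beta> = p \<cdot> f \<cdot> \<beta>" by (simp add: reassoc[OF e])
  moreover have "tgt C \<alpha> \<in> cofs M" using cofs_extension[OF s3] assms(10,11) by simp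
  ultimately show ?thesis using s3 2(1) by (intro that[of \<alpha> "p1 \<cdot> \<beta>" k "f \<cdot> \<beta>"]) simp_all
qed

text \<open>Maps to fibrant objects extend along \<open>j\<close>. A null \<open>h \<cdot> j\<close>
  extends to a null \<open>t\<close>, and \<open>h -. t\<close> factors through the trivial
  cokernel.\<close>

lemma pre_equiv_triv_cofibration:
  assumes "short_exact C j p" "tgt C p \<in> cofs M" "tgt C p \<in> trivs M" "src C j \<in> cofs M"
  shows "pre_equiv j"
  unfolding pre_equiv_def
proof (intro ballI conjI impI)
  note [simp] = sesD[OF assms(1)]
  have c: "tgt C j \<in> cofs M" using cofs_extension[OF assms(1)] assms by simp
  fix y assume y: "y \<in> fibs M"
  show "\<exists>h\<in>Mor C (tgt C j) y. h \<cdot> j \<approx> z" if z: "z \<in> Mor C (src C j) y" for z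
  proof -
    note [simp] = MorD[OF z]
    obtain t where [simp]: "t \<in> arrs C" "src C t = tgt C j" "tgt C t = tgt C z" "t \<cdot> j = z"
      by (rule extend_triv_cofs[OF assms(1-3), of z]) (simp_all add: y)
    show ?thesis by (rule bexI[of _ t]) (simp_all add: Mor_def stabeq_refl)
  qed
  fix h assume h: "h \<in> Mor C (tgt C j) y" "h \<cdot> j \<in> core_maps C M (src C j) y"
  obtain t where t: "t \<in> core_maps C M (tgt C j) y" "t \<cdot> j = h \<cdot> j"
    using core_maps_extend[OF h(2) assms(1)] assms(2) by auto
  note [simp] = MorD[OF h(1)] MorD[OF core_maps_Mor[OF t(1)]]
  obtain r where r [simp]: "r \<in> arrs C" "tgt C r = y" "src C r = tgt C p" and rp: "r \<cdot> p = h -. t"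
    by (rule ses_colift[OF assms(1), of "h -. t"]) (simp_all add: t(2))
  have "r \<cdot> p \<in> core_maps C M (tgt C j) y" using null_factor[of p r] assms(3) c y by simp
  then have "(h -. t) +. t \<in> core_maps C M (tgt C j) y" unfolding rp using t(1)
    by (rule hadd_core_maps)
  then show "h \<in> core_maps C M (tgt C j) y" by simp
qed

text \<open>The identity minus \<open>\<sigma> \<cdot> q\<close> factors through the trivial kernel
  of \<open>q\<close>, so \<open>h\<close> and \<open>(h \<cdot> \<sigma>) \<cdot> q\<close> differ
  by a null map.\<close>

lemma pre_equiv_section:
  assumes "short_exact C k q" "src C k \<in> trivs M" "src C q \<in> cofs M"
    and s: "\<sigma> \<in> arrs C" "src C \<sigma> = tgt C q" "tgt C \<sigma> = src C q" "q \<cdot> \<sigma> = idn C (tgt C q)"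
  shows "pre_equiv \<sigma>"
  unfolding pre_equiv_def
proof (intro ballI conjI impI)
  note [simp] = sesD[OF assms(1)] s
  fix y assume y: "y \<in> fibs M"
  show "\<exists>h\<in>Mor C (tgt C \<sigma>) y. h \<cdot> \<sigma> \<approx> z" if z: "z \<in> Mor C (src C \<sigma>) y" for z
    using MorD[OF z] by (intro bexI[of _ "z \<cdot> q"]) (simp_all add: Mor_def stabeq_refl)
  fix h assume h: "h \<in> Mor C (tgt C \<sigma>) y" "h \<cdot> \<sigma> \<in> core_maps C M (src C \<sigma>) y"
  note [simp] = MorD[OF h(1)]
  obtain t where t [simp]: "t \<in> arrs C" "src C t = tgt C k" "tgt C t = src C k"
    and kt: "k \<cdot> t = idn C (tgt C k) -. \<sigma> \<cdot> q"
    by (rule ses_lift[OF assms(1), of "idn C (tgt C k) -. \<sigma> \<cdot> q"]) (simp_all add: reassoc[OF s(4)])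
  have 1: "(h \<cdot> k) \<cdot> t \<in> core_maps C M (tgt C k) y" using null_factor[of t "h \<cdot> k"] assms(2,3) y
    by simp
  have 2: "(h \<cdot> \<sigma>) \<cdot> q \<in> core_maps C M (tgt C k) y" using h(2)
    by (rule core_maps_cmp_right) simp_all
  have "(h \<cdot> k) \<cdot> t +. (h \<cdot> \<sigma>) \<cdot> q = h" using kt by simp
  then show "h \<in> core_maps C M (tgt C \<sigma>) y" using hadd_core_maps[OF 1 2] by simp
qed

lemma pre_equiv_comp:
  assumes "pre_equiv f" "pre_equiv g" and [simp]: "f \<in> arrs C" "g \<in> arrs C" "src C g = tgt C f"
  shows "pre_equiv (g \<cdot> f)"
  unfolding pre_equiv_def
proof (intro ballI conjI impI)
  fix y assume y: "y \<in> fibs M"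
  show "h \<in> core_maps C M (tgt C (g \<cdot> f)) y"
    if "h \<in> Mor C (tgt C (g \<cdot> f)) y" "h \<cdot> g \<cdot> f \<in> core_maps C M (src C (g \<cdot> f)) y" for h
  proof -
    have "(h \<cdot> g) \<cdot> f \<in> core_maps C M (src C f) y" "h \<cdot> g \<in> Mor C (tgt C f) y" using that
      by (simp_all add: Mor_def)
    then have "h \<cdot> g \<in> core_maps C M (tgt C f) y" using assms(1) y unfolding pre_equiv_def by blast
    then show ?thesis using assms(2) y that unfolding pre_equiv_def by simp
  qed
  fix z assume "z \<in> Mor C (src C (g \<cdot> f)) y"
  then have "z \<in> Mor C (src C f) y" by simp
  then obtain h where h: "h \<in> Mor C (tgt C f) y" "h \<cdot> f \<approx> z"
    using assms(1) y unfolding pre_equiv_def by blast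
  have "h \<in> Mor C (src C g) y" using h(1) by simp
  then obtain h' where h': "h' \<in> Mor C (tgt C g) y" "h' \<cdot> g \<approx> h"
    using assms(2) y unfolding pre_equiv_def by blast
  have "(h' \<cdot> g) \<cdot> f \<approx> h \<cdot> f" by (rule stabeq_cmp_right[OF h'(2)]) (simp_all add: MorD[OF h(1)])
  also note h(2)
  finally show "\<exists>h\<in>Mor C (tgt C (g \<cdot> f)) y. h \<cdot> g \<cdot> f \<approx> z"
    using h'(1) by (intro bexI[of _ h']) (simp_all add: Mor_def)
qed

lemma fibrant_ses_replacement:
  assumes "short_exact C i p" "short_exact C jx cx" "short_exact C jz cz" "src C jx = src C i"
    "src C jz = tgt C p"
    and "tgt C cx \<in> trivs M" "tgt C cx \<in> cofs M" "tgt C cz \<in> trivs M" "tgt C cz \<in> cofs M"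
      "tgt C jx \<in> fibs M" "tgt C jz \<in> fibs M"
  obtains i0 p0 b c where "short_exact C i0 p0" "src C i0 = tgt C jx" "tgt C p0 = tgt C jz"
    "short_exact C b c"
    "tgt C c \<in> trivs M" "tgt C c \<in> cofs M" "src C b = tgt C i" "tgt C b = tgt C i0"
    "b \<cdot> i = i0 \<cdot> jx" "jz \<cdot> p = p0 \<cdot> b" "tgt C i0 \<in> fibs M"
proof -
  obtain p0 i0 c b where 1: "short_exact (opc C) p0 i0" "src (opc C) p0 = src (opc C) jz"
    "tgt (opc C) i0 = src (opc C) jx" "short_exact (opc C) c b"
    "src (opc C) c \<in> trivs (opm M)" "src (opc C) c \<in> fibs (opm M)" "tgt (opc C) b = tgt (opc C) p"
    "src (opc C) b = tgt (opc C) p0"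
    "cmp (opc C) b p0 = cmp (opc C) p jz" "cmp (opc C) jx i0 = cmp (opc C) i b"
    "tgt (opc C) p0 \<in> cofs (opm M)"
    by (rule model.cofibrant_ses_replacement[OF model_opc, of p i cz jz cx jx])
      (use assms sesD(3)[OF assms(1)] in simp_all)
  then show ?thesis using sesD(3)[of i0 p0] sesD(3)[OF assms(1)]
    by (intro that[of i0 p0 b c]) simp_all
qed

lemma post_equiv_triv_fibration:
  assumes "short_exact C k q" "src C k \<in> fibs M" "src C k \<in> trivs M" "tgt C q \<in> fibs M"
  shows "post_equiv q"
  using model.pre_equiv_triv_cofibration[OF model_opc, of q k] assms by (simp add: post_equiv_opc)

lemma post_equiv_retraction:
  assumes "short_exact C j p" "tgt C p \<in> trivs M" "tgt C j \<in> fibs M"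
    and "\<rho> \<in> arrs C" "tgt C \<rho> = src C j" "src C \<rho> = tgt C j" "\<rho> \<cdot> j = idn C (src C j)"
  shows "post_equiv \<rho>"
  using model.pre_equiv_section[OF model_opc, of p j \<rho>] assms by (simp add: post_equiv_opc)

lemma post_equiv_comp:
  assumes "post_equiv f" "post_equiv g" "f \<in> arrs C" "g \<in> arrs C" "src C g = tgt C f"
  shows "post_equiv (g \<cdot> f)"
  using model.pre_equiv_comp[OF model_opc, of g f] assms by (simp add: post_equiv_opc)

end

locale model_replacement = model +
  fixes K :: "('a, 'b) repl"
  assumes replacement: "replacement_choice C M K"
begin

abbreviation "Q A \<equiv> Qob C K A"
abbreviation "RQ A \<equiv> RQob C K A"
abbreviation "qm A \<equiv> cofr K A"
abbreviation "rm A \<equiv> fibr K (Qob C K A)"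

lemma cofr_ses:
  obtains k where "short_exact C k (qm A)" "src C k \<in> trivs M" "src C k \<in> fibs M" "tgt C k = Q A"
  using replacement sesD(3) unfolding replacement_choice_def cofibrant_replacement_def Qob_def
    by (metis IntE)

lemma fibr_ses:
  obtains p where "short_exact C (rm A) p" "tgt C p \<in> trivs M" "tgt C p \<in> cofs M" "src C p = RQ A"
  using replacement sesD(3) unfolding replacement_choice_def fibrant_replacement_def RQob_def
    by (metis IntE)

lemma repl_arr [simp]: "qm A \<in> arrs C" "src C (qm A) = Q A" "tgt C (qm A) = A"
   "rm A \<in> arrs C" "src C (rm A) = Q A" "tgt C (rm A) = RQ A"
proof -
  obtain k where k: "short_exact C k (qm A)" by (rule cofr_ses)
  obtain p where p: "short_exact C (rm A) p" by (rule fibr_ses)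
  show "qm A \<in> arrs C" "rm A \<in> arrs C" using sesD(1,2) k p by blast+
  show "src C (qm A) = Q A" "tgt C (qm A) = A" "src C (rm A) = Q A" "tgt C (rm A) = RQ A"
    using replacement unfolding replacement_choice_def cofibrant_replacement_def
      fibrant_replacement_def Qob_def RQob_def by simp_all
qed

lemma Q_cofs [simp]: "Q A \<in> cofs M"
  using replacement unfolding replacement_choice_def cofibrant_replacement_def Qob_def by simp

lemma RQ_fibs [simp]: "RQ A \<in> fibs M"
  using replacement unfolding replacement_choice_def fibrant_replacement_def RQob_def by blast

lemma RQ_cofs [simp]: "RQ A \<in> cofs M"
proof -
  obtain p where p: "short_exact C (rm A) p" "tgt C p \<in> trivs M" "tgt C p \<in> cofs M" "src C p = RQ A"
    by (rule fibr_ses)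
  show ?thesis using cofs_extension[OF p(1)] p(3) by simp
qed

lemma bifibrant_sequence_iff:
  "bifibrant_sequence C M K (i, p) (i', p') \<longleftrightarrow>
     short_exact C i' p' \<and> src C i' = RQ (src C i) \<and> tgt C p' = RQ (tgt C p) \<and> tgt C i' \<in> core M \<and>
     (\<exists>i0 p0 a b. short_exact C i0 p0 \<and> src C i0 = Q (src C i) \<and> tgt C p0 = Q (tgt C p) \<and>
        cofibrant_replacement C M (tgt C i) a \<and> src C a = tgt C i0 \<and>
        a \<cdot> i0 = i \<cdot> qm (src C i) \<and> qm (tgt C p) \<cdot> p0 = p \<cdot> a \<and>
        fibrant_replacement C M (tgt C i0) b \<and> tgt C b = tgt C i' \<and>
        b \<cdot> i0 = i' \<cdot> rm (src C i) \<and> rm (tgt C p) \<cdot> p0 = p' \<cdot> b)"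
  by (simp add: bifibrant_sequence_def Let_def)

lemma bifibrant_sequence_exists:
  assumes "short_exact C i p" "tgt C i \<in> trivs M"
  obtains i' p' where "bifibrant_sequence C M K (i, p) (i', p')"
proof -
  obtain kx where kx: "short_exact C kx (qm (src C i))" "src C kx \<in> trivs M" "src C kx \<in> fibs M"
    by (rule cofr_ses)
  obtain kz where kz: "short_exact C kz (qm (tgt C p))" "src C kz \<in> trivs M" "src C kz \<in> fibs M"
    by (rule cofr_ses)
  obtain i0 p0 k a where 1: "short_exact C i0 p0" "src C i0 = Q (src C i)" "tgt C p0 = Q (tgt C p)"
    "short_exact C k a"
    "src C k \<in> trivs M" "src C k \<in> fibs M" "tgt C a = tgt C i" "src C a = tgt C i0"
    "a \<cdot> i0 = i \<cdot> qm (src C i)"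
    "qm (tgt C p) \<cdot> p0 = p \<cdot> a" "tgt C i0 \<in> cofs M"
    by (rule cofibrant_ses_replacement[OF assms(1) kx(1) kz(1)]) (use kx kz in simp_all)
  obtain px where px: "short_exact C (rm (src C i)) px" "tgt C px \<in> trivs M" "tgt C px \<in> cofs M"
    by (rule fibr_ses)
  obtain pz where pz: "short_exact C (rm (tgt C p)) pz" "tgt C pz \<in> trivs M" "tgt C pz \<in> cofs M"
    by (rule fibr_ses)
  obtain i' p' b c where 2: "short_exact C i' p'" "src C i' = RQ (src C i)"
    "tgt C p' = RQ (tgt C p)" "short_exact C b c"
    "tgt C c \<in> trivs M" "tgt C c \<in> cofs M" "src C b = tgt C i0" "tgt C b = tgt C i'"
    "b \<cdot> i0 = i' \<cdot> rm (src C i)"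
    "rm (tgt C p) \<cdot> p0 = p' \<cdot> b" "tgt C i' \<in> fibs M"
    by (rule fibrant_ses_replacement[OF 1(1) px(1) pz(1)]) (use 1(2,3) px pz in simp_all)
  have "tgt C i0 \<in> trivs M" using trivs_extension[OF 1(4)] sesD(3)[OF 1(4)] 1(5,7,8) assms(2)
    by simp
  then have "tgt C b \<in> trivs M" using trivs_extension[OF 2(4)] 2(5,7) by simp
  moreover have "tgt C b \<in> cofs M" using cofs_extension[OF 2(4)] 2(6,7) 1(11) by simp
  ultimately have "tgt C i' \<in> core M" using 2(8,11) by (simp add: core_def)
  moreover have "cofibrant_replacement C M (tgt C i) a"
    using 1(4-8,11) unfolding cofibrant_replacement_def by auto
  moreover have "fibrant_replacement C M (tgt C i0) b"
    using 2(4-8,11) unfolding fibrant_replacement_def by auto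
  ultimately have "bifibrant_sequence C M K (i, p) (i', p')"
    unfolding bifibrant_sequence_iff using 1 2 by blast
  then show ?thesis by (rule that)
qed

lemma bifibrant_sequenceD:
  assumes "bifibrant_sequence C M K (i, p) (i', p')"
  shows "short_exact C i' p'" "src C i' = RQ (src C i)" "tgt C p' = RQ (tgt C p)"
    "tgt C i' \<in> trivs M" "tgt C i' \<in> cofs M" "tgt C i' \<in> fibs M"
  using assms by (auto simp: bifibrant_sequence_iff core_def)

lemma pre_equiv_rm: "pre_equiv (rm A)"
proof -
  obtain p where "short_exact C (rm A) p" "tgt C p \<in> trivs M" "tgt C p \<in> cofs M" by (rule fibr_ses)
  then show ?thesis by (intro pre_equiv_triv_cofibration[of _ p]) simp_all
qed

text \<open>Makes suspension and loop independent of the middle replacement. The cofibrant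
  comparison \<open>v0\<close> respects the left ends and the maps to the given sequence strictly,
  so the induced \<open>c0\<close> lies over \<open>qm\<close> and differs from the identity by a
  map through its trivial kernel. The bifibrant comparison \<open>c\<close> agrees with
  \<open>c0\<close> along \<open>rm\<close> up to a map through the core, and \<open>rm\<close> can
  be cancelled stably.\<close>

lemma bifibrant_sequence_unique:
  assumes s: "short_exact C i p" and 1: "bifibrant_sequence C M K (i, p) (i1, p1)"
    and 2: "bifibrant_sequence C M K (i, p) (i2, p2)"
  obtains c where "ses_map C i1 p1 i2 p2 (idn C (RQ (src C i))) c" "c \<approx> idn C (RQ (tgt C p))"
proof -
  let ?X = "src C i" and ?Z = "tgt C p"
  note [simp] = sesD[OF s] sesD(1-5)[OF bifibrant_sequenceD(1)[OF 1]] bifibrant_sequenceD(2-6)[OF 1]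
    sesD(1-5)[OF bifibrant_sequenceD(1)[OF 2]] bifibrant_sequenceD(2-6)[OF 2]
  obtain j1 r1 a1 b1 where e1: "short_exact C j1 r1" "src C j1 = Q ?X" "tgt C r1 = Q ?Z"
    "cofibrant_replacement C M (tgt C i) a1"
    "src C a1 = tgt C j1" "a1 \<cdot> j1 = i \<cdot> qm ?X" "qm ?Z \<cdot> r1 = p \<cdot> a1"
    "fibrant_replacement C M (tgt C j1) b1" "tgt C b1 = tgt C i1"
    "b1 \<cdot> j1 = i1 \<cdot> rm ?X" "rm ?Z \<cdot> r1 = p1 \<cdot> b1"
    using 1 unfolding bifibrant_sequence_iff by blast
  obtain j2 r2 a2 b2 where e2: "short_exact C j2 r2" "src C j2 = Q ?X" "tgt C r2 = Q ?Z"
    "cofibrant_replacement C M (tgt C i) a2"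
    "src C a2 = tgt C j2" "a2 \<cdot> j2 = i \<cdot> qm ?X" "qm ?Z \<cdot> r2 = p \<cdot> a2"
    "fibrant_replacement C M (tgt C j2) b2" "tgt C b2 = tgt C i2"
    "b2 \<cdot> j2 = i2 \<cdot> rm ?X" "rm ?Z \<cdot> r2 = p2 \<cdot> b2"
    using 2 unfolding bifibrant_sequence_iff by blast
  obtain k2 where k2: "short_exact C k2 a2" "src C k2 \<in> trivs M" "src C k2 \<in> fibs M"
    "tgt C a2 = tgt C i"
    using e2(4) unfolding cofibrant_replacement_def by blast
  have a1 [simp]: "a1 \<in> arrs C" "tgt C a1 = tgt C i" "src C a1 \<in> cofs M" "b1 \<in> arrs C"
    "src C b1 = tgt C j1" "b2 \<in> arrs C" "src C b2 = tgt C j2"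
    using e1(4,8) e2(8) sesD(1,2) unfolding cofibrant_replacement_def fibrant_replacement_def
      by blast+
  note [simp] = sesD(1-5)[OF e1(1)] sesD(1-5)[OF e2(1)] e1(2,3,5,9) e2(2,3,5,9)
    sesD(1,2,4,5)[OF k2(1)] k2(4)
  have [simp]: "tgt C k2 = tgt C j2" using sesD(3)[OF k2(1)] by simp
  have "idn C (RQ ?X) \<in> Mor C (src C i1) (src C i2)" using idn_Mor by simp
  then obtain c where c: "ses_map C i1 p1 i2 p2 (idn C (RQ ?X)) c"
    using ses_map_right_exists[OF bifibrant_sequenceD(1)[OF 1] bifibrant_sequenceD(1)[OF 2]] by auto
  then obtain v where [simp]: "v \<in> arrs C" "src C v = tgt C i1" "tgt C v = tgt C i2" "c \<in> arrs C"
    "src C c = RQ ?Z" "tgt C c = RQ ?Z"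
    and v: "v \<cdot> i1 = i2" "c \<cdot> p1 = p2 \<cdot> v" by (auto simp: ses_map_def Mor_def)
  obtain x where [simp]: "x \<in> arrs C" "src C x = tgt C j1" "tgt C x = tgt C k2" and x: "a2 \<cdot> x = a1"
    by (rule lift_triv_fibs[OF k2(1-3), of a1]) (use a1(3) in simp_all)
  obtain t where [simp]: "t \<in> arrs C" "src C t = Q ?X" "tgt C t = src C k2"
    and t: "k2 \<cdot> t = x \<cdot> j1 -. j2"
    by (rule ses_lift[OF k2(1), of "x \<cdot> j1 -. j2"]) (simp_all add: reassoc[OF x] e1(6) e2(6))
  obtain t' where [simp]: "t' \<in> arrs C" "src C t' = tgt C j1" "tgt C t' = src C k2"
    and t': "t' \<cdot> j1 = t"
    by (rule extend_cofs[OF e1(1), of t]) (use k2(2,3) in simp_all)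
  \<comment> \<open>The lift \<open>x\<close> of \<open>a1\<close> through \<open>a2\<close> need
    not carry \<open>j1\<close> to \<open>j2\<close>. The defect lands in the kernel of
    \<open>a2\<close>, which is trivially fibrant, so it extends along \<open>j1\<close> and is
    subtracted without disturbing the composite with \<open>a2\<close>.\<close>
  define v0 where "v0 = x -. k2 \<cdot> t'"
  have v0 [simp]: "v0 \<in> arrs C" "src C v0 = tgt C j1" "tgt C v0 = tgt C j2"
    and v0': "v0 \<cdot> j1 = j2" "a2 \<cdot> v0 = a1"
    by (simp_all add: v0_def t t' x hsub_hsub)
  obtain c0 where [simp]: "c0 \<in> arrs C" "tgt C c0 = Q ?Z" "src C c0 = Q ?Z"
    and c0: "c0 \<cdot> r1 = r2 \<cdot> v0"
    by (rule ses_colift[OF e1(1), of "r2 \<cdot> v0"]) (simp_all add: v0')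
  obtain kz where kz: "short_exact C kz (qm ?Z)" "src C kz \<in> trivs M" "src C kz \<in> fibs M"
    "tgt C kz = Q ?Z" by (rule cofr_ses)
  note [simp] = sesD(1)[OF kz(1)] kz(4)
  have "qm ?Z \<cdot> c0 = qm ?Z"
    by (rule is_epiD[OF sesD(7)[OF e1(1)]]) (simp_all add: c0 e1(7) reassoc[OF e2(7)] v0')
  then obtain s where [simp]: "s \<in> arrs C" "src C s = Q ?Z" "tgt C s = src C kz"
    and s: "kz \<cdot> s = c0 -. idn C (Q ?Z)"
    using ses_lift[OF kz(1), of "c0 -. idn C (Q ?Z)"] by auto
  obtain t2 where [simp]: "t2 \<in> arrs C" "tgt C t2 = tgt C i2" "src C t2 = Q ?Z"
    and t2: "t2 \<cdot> r1 = v \<cdot> b1 -. b2 \<cdot> v0"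
    by (rule ses_colift[OF e1(1), of
      "v \<cdot> b1 -. b2 \<cdot> v0"]) (simp_all add: e1(10) v0' e2(10) reassoc[OF v(1)])
  have "c \<cdot> rm ?Z -. rm ?Z \<cdot> c0 = p2 \<cdot> t2"
    by (rule is_epiD[OF sesD(7)[OF e1(1)]]) (simp_all add: t2 e1(11) c0 reassoc[OF v(2)]
      reassoc[OF e2(11)])
  moreover have "p2 \<cdot> t2 \<in> core_maps C M (Q ?Z) (RQ ?Z)" using null_factor[of t2 p2] by simp
  ultimately have "c \<cdot> rm ?Z \<approx> rm ?Z \<cdot> c0" by (simp add: stabeq_def)
  also have "(rm ?Z \<cdot> kz) \<cdot> s \<in> core_maps C M (Q ?Z) (RQ ?Z)"
    using null_factor[of s "rm ?Z \<cdot> kz"] kz(2) by simp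
  then have "rm ?Z \<cdot> c0 \<approx> rm ?Z" using s by (simp add: stabeq_def)
  finally have "(c -. idn C (RQ ?Z)) \<cdot> rm ?Z \<in> core_maps C M (Q ?Z) (RQ ?Z)"
    by (simp add: stabeq_def)
  then have "c -. idn C (RQ ?Z) \<in> core_maps C M (RQ ?Z) (RQ ?Z)"
    using pre_equiv_rm[of ?Z] unfolding pre_equiv_def by (simp add: Mor_def)
  then have "c \<approx> idn C (RQ ?Z)" by (simp add: stabeq_def)
  with c show ?thesis by (rule that)
qed

text \<open>A cofibrant \<open>A\<close> is a direct summand of \<open>QA\<close>, and \<open>QB\<close> is one of \<open>RQB\<close> for fibrant \<open>B\<close>. This gives
  honest arrows \<open>A \<rightarrow> RQA\<close> and \<open>RQB \<rightarrow> B\<close> instead of zigzags.\<close>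

definition unit_map :: "'a \<Rightarrow> 'b \<Rightarrow> bool" where
  "unit_map A m \<longleftrightarrow> (\<exists>\<sigma>\<in>Mor C A (Q A). qm A \<cdot> \<sigma> = idn C A \<and> m = rm A \<cdot> \<sigma>)"

definition counit_map :: "'a \<Rightarrow> 'b \<Rightarrow> bool" where
  "counit_map B q \<longleftrightarrow> (\<exists>\<rho>\<in>Mor C (RQ B) (Q B). \<rho> \<cdot> rm B = idn C (Q B) \<and> q = qm B \<cdot> \<rho>)"

lemma unit_map_exists: assumes "A \<in> cofs M" obtains m where "unit_map A m"
proof -
  obtain k where k: "short_exact C k (qm A)" "src C k \<in> trivs M" "src C k \<in> fibs M" "tgt C k = Q A"
    by (rule cofr_ses)
  obtain \<sigma> where "\<sigma> \<in> arrs C" "src C \<sigma> = A" "tgt C \<sigma> = tgt C k" "qm A \<cdot> \<sigma> = idn C A"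
    by (rule lift_triv_fibs[OF k(1-3), of "idn C A"]) (simp_all add: assms)
  then show ?thesis using k(4) by (intro that[of "rm A \<cdot> \<sigma>"]) (auto simp: unit_map_def Mor_def)
qed

lemma counit_map_exists: assumes "B \<in> fibs M" obtains q where "counit_map B q"
proof -
  obtain k where k: "short_exact C k (qm B)" "src C k \<in> trivs M" "src C k \<in> fibs M" "tgt C k = Q B"
    by (rule cofr_ses)
  have "Q B \<in> fibs M" using fibs_extension[OF k(1)] k assms by simp
  moreover obtain p where p: "short_exact C (rm B) p" "tgt C p \<in> trivs M" "tgt C p \<in> cofs M"
    "src C p = RQ B" by (rule fibr_ses)
  ultimately obtain \<rho> where "\<rho> \<in> arrs C" "src C \<rho> = RQ B" "tgt C \<rho> = Q B" "\<rho> \<cdot> rm B = idn C (Q B)"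
    using extend_triv_cofs[OF p(1) p(3,2), of "idn C (Q B)"] by auto
  then show ?thesis by (intro that[of "qm B \<cdot> \<rho>"]) (auto simp: counit_map_def Mor_def)
qed

lemma unit_map_Mor: "unit_map A m \<Longrightarrow> m \<in> Mor C A (RQ A)"
  by (auto simp: unit_map_def Mor_def)

lemma counit_map_Mor: "counit_map B q \<Longrightarrow> q \<in> Mor C (RQ B) B"
  by (auto simp: counit_map_def Mor_def)

lemma unit_map_pre_equiv: assumes "unit_map A m" shows "pre_equiv m"
proof -
  obtain \<sigma> where [simp]: "\<sigma> \<in> arrs C" "src C \<sigma> = A" "tgt C \<sigma> = Q A" "qm A \<cdot> \<sigma> = idn C A"
    and m: "m = rm A \<cdot> \<sigma>"
    using assms by (auto simp: unit_map_def Mor_def)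
  obtain k where k: "short_exact C k (qm A)" "src C k \<in> trivs M" "src C k \<in> fibs M" "tgt C k = Q A"
    by (rule cofr_ses)
  have "pre_equiv \<sigma>" by (rule pre_equiv_section[OF k(1,2)]) simp_all
  then show ?thesis unfolding m by (rule pre_equiv_comp) (simp_all add: pre_equiv_rm)
qed

lemma counit_map_post_equiv: assumes "counit_map B q" "B \<in> fibs M" shows "post_equiv q"
proof -
  obtain \<rho> where [simp]: "\<rho> \<in> arrs C" "src C \<rho> = RQ B" "tgt C \<rho> = Q B" "\<rho> \<cdot> rm B = idn C (Q B)"
    and q: "q = qm B \<cdot> \<rho>"
    using assms by (auto simp: counit_map_def Mor_def)
  obtain p where p: "short_exact C (rm B) p" "tgt C p \<in> trivs M" "tgt C p \<in> cofs M" "src C p = RQ B"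
    by (rule fibr_ses)
  obtain k where k: "short_exact C k (qm B)" "src C k \<in> trivs M" "src C k \<in> fibs M" "tgt C k = Q B"
    by (rule cofr_ses)
  have "post_equiv \<rho>" by (rule post_equiv_retraction[OF p(1,2)]) simp_all
  moreover have "post_equiv (qm B)"
    by (rule post_equiv_triv_fibration[OF k(1,3,2)]) (simp add: assms)
  ultimately show ?thesis unfolding q by (intro post_equiv_comp) simp_all
qed

section \<open>Lifts to replacements and naturality of units and counits\<close>

lemma bifibrant_lift_exists:
  assumes "f \<in> Mor C A B" obtains f'' where "f'' \<in> bifibrant_lifts C K f"
proof -
  note [simp] = MorD[OF assms]
  obtain k where k: "short_exact C k (qm B)" "src C k \<in> trivs M" "src C k \<in> fibs M" "tgt C k = Q B"
    by (rule cofr_ses)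
  obtain p where p: "short_exact C (rm A) p" "tgt C p \<in> trivs M" "tgt C p \<in> cofs M" "src C p = RQ A"
    by (rule fibr_ses)
  obtain f' where f' [simp]: "f' \<in> arrs C" "src C f' = Q A" "tgt C f' = Q B" "qm B \<cdot> f' = f \<cdot> qm A"
    using lift_triv_fibs[OF k(1-3), of "f \<cdot> qm A"] k(4) by auto
  obtain f'' where "f'' \<in> arrs C" "src C f'' = RQ A" "tgt C f'' = RQ B" "f'' \<cdot> rm A = rm B \<cdot> f'"
    using extend_triv_cofs[OF p(1) p(3,2), of "rm B \<cdot> f'"] by auto
  then have "f'' \<in> bifibrant_lifts C K f"
    unfolding bifibrant_lifts_def Let_def mem_Collect_eq
    by (intro conjI bexI[of _ f']) (simp_all add: Mor_def)
  then show ?thesis by (rule that)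
qed

text \<open>Both ways from \<open>A'\<close> to \<open>Q A\<close> become \<open>f\<close> after
  \<open>qm A\<close>, so their difference factors through its trivial kernel; since
  \<open>A'\<close> is cofibrant and \<open>RQ A\<close> fibrant, it becomes null in
  \<open>RQ A\<close>.\<close>

lemma unit_map_natural:
  assumes A: "A' \<in> cofs M" and m: "unit_map A m" "unit_map A' m'"
    and f: "f \<in> Mor C A' A" "f'' \<in> bifibrant_lifts C K f"
  shows "f'' \<cdot> m' \<approx> m \<cdot> f"
proof -
  note [simp] = MorD[OF f(1)]
  obtain \<sigma> where [simp]: "\<sigma> \<in> arrs C" "src C \<sigma> = A" "tgt C \<sigma> = Q A" and s: "qm A \<cdot> \<sigma> = idn C A"
    and [simp]: "m = rm A \<cdot> \<sigma>"
    using m(1) by (auto simp: unit_map_def Mor_def)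
  obtain \<sigma>' where [simp]: "\<sigma>' \<in> arrs C" "src C \<sigma>' = A'" "tgt C \<sigma>' = Q A'"
    and s': "qm A' \<cdot> \<sigma>' = idn C A'" and [simp]: "m' = rm A' \<cdot> \<sigma>'"
    using m(2) by (auto simp: unit_map_def Mor_def)
  obtain f' where [simp]: "f' \<in> arrs C" "src C f' = Q A'" "tgt C f' = Q A" "f'' \<in> arrs C"
    "src C f'' = RQ A'" "tgt C f'' = RQ A"
    and f': "qm A \<cdot> f' = f \<cdot> qm A'" "f'' \<cdot> rm A' = rm A \<cdot> f'"
    using f(2) unfolding bifibrant_lifts_def Let_def by (auto simp: Mor_def)
  obtain k where k: "short_exact C k (qm A)" "src C k \<in> trivs M" "src C k \<in> fibs M" "tgt C k = Q A"
    by (rule cofr_ses)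
  note [simp] = sesD(1)[OF k(1)] k(4)
  obtain t where [simp]: "t \<in> arrs C" "src C t = A'" "tgt C t = src C k"
    and t: "k \<cdot> t = f' \<cdot> \<sigma>' -. \<sigma> \<cdot> f"
    by (rule ses_lift[OF k(1), of "f' \<cdot> \<sigma>' -. \<sigma> \<cdot> f"]) (simp_all add: reassoc[OF f'(1)]
      s' reassoc[OF s])
  have "(rm A \<cdot> k) \<cdot> t \<in> core_maps C M A' (RQ A)" using null_factor[of t "rm A \<cdot> k"] k(2) A by simp
  then show ?thesis by (simp add: t stabeq_def reassoc[OF f'(2)])
qed

lemma counit_map_natural:
  assumes B: "B' \<in> fibs M" and q: "counit_map B q" "counit_map B' q'"
    and g: "g \<in> Mor C B B'" "g'' \<in> bifibrant_lifts C K g"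
  shows "q' \<cdot> g'' \<approx> g \<cdot> q"
proof -
  note [simp] = MorD[OF g(1)]
  obtain \<rho> where [simp]: "\<rho> \<in> arrs C" "src C \<rho> = RQ B" "tgt C \<rho> = Q B"
    and r: "\<rho> \<cdot> rm B = idn C (Q B)" and [simp]: "q = qm B \<cdot> \<rho>"
    using q(1) by (auto simp: counit_map_def Mor_def)
  obtain \<rho>' where [simp]: "\<rho>' \<in> arrs C" "src C \<rho>' = RQ B'" "tgt C \<rho>' = Q B'"
    and r': "\<rho>' \<cdot> rm B' = idn C (Q B')" and [simp]: "q' = qm B' \<cdot> \<rho>'"
    using q(2) by (auto simp: counit_map_def Mor_def)
  obtain g' where [simp]: "g' \<in> arrs C" "src C g' = Q B" "tgt C g' = Q B'" "g'' \<in> arrs C"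
    "src C g'' = RQ B" "tgt C g'' = RQ B'"
    and g': "qm B' \<cdot> g' = g \<cdot> qm B" "g'' \<cdot> rm B = rm B' \<cdot> g'"
    using g(2) unfolding bifibrant_lifts_def Let_def by (auto simp: Mor_def)
  obtain p where p: "short_exact C (rm B) p" "tgt C p \<in> trivs M" "tgt C p \<in> cofs M" "src C p = RQ B"
    by (rule fibr_ses)
  note [simp] = sesD(2)[OF p(1)] p(4)
  obtain t where [simp]: "t \<in> arrs C" "tgt C t = B'" "src C t = tgt C p"
    and t: "t \<cdot> p = q' \<cdot> g'' -. g \<cdot> q"
    by (rule ses_colift[OF p(1), of "q' \<cdot> g'' -. g \<cdot> q"]) (simp_all add: g' r reassoc[OF r'])
  have "t \<cdot> p \<in> core_maps C M (RQ B) B'" using null_factor[of p t] p(2) B by simp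
  then show ?thesis unfolding t by (simp add: stabeq_def)
qed

end

section \<open>The homotopy category, suspension and loop\<close>

text \<open>Evaluates the operations that are defined as unions over choices: some choice exists,
  and all give the same class.\<close>

lemma UN_constant_eq: "\<lbrakk>S \<noteq> {}; \<And>x. x \<in> S \<Longrightarrow> F x = c\<rbrakk> \<Longrightarrow> (\<Union>x\<in>S. F x) = c"
  by blast

context model
begin

lemma stable_class_eq_Collect:
  assumes "f \<in> Mor C x y" shows "stable_class C M x y f = {g \<in> Mor C x y. g \<approx> f}"
proof -
  note [simp] = MorD[OF assms]
  have 1: "g \<in> Mor C x y \<and> g \<approx> f" if h: "h \<in> core_maps C M x y" and g: "g = h +. f" for g h
    using that MorD[OF core_maps_Mor[OF h]] by (simp add: Mor_def stabeq_def)
  have 2: "\<exists>h\<in>core_maps C M x y. g = h +. f" if "g \<in> Mor C x y" "g \<approx> f" for g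
    using that by (intro bexI[of _ "g -. f"]) (simp_all add: stabeq_def Mor_def)
  show ?thesis unfolding stable_class_def r_coset_def using 1 2 by auto
qed

lemma stable_class_cong:
  assumes "f \<approx> g" "g \<in> Mor C x y" shows "stable_class C M x y f = stable_class C M x y g"
proof -
  have "f \<in> Mor C x y" using stabeqD[OF assms(1)] MorD[OF assms(2)] by (intro MorI) auto
  then show ?thesis
    using assms stabeq_sym stabeq_trans unfolding stable_class_eq_Collect[OF assms(2)]
    by (subst stable_class_eq_Collect) blast+
qed

end

context model_replacement
begin

lemma Ho_comp_class:
  assumes "g \<in> Mor C y (RQ B)" "f \<in> Mor C (RQ A) y"
  shows "Ho_comp C M K A B (stable_class C M y (RQ B) g) (stable_class C M (RQ A) y f) =
      stable_class C M (RQ A) (RQ B) (g \<cdot> f)"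
proof -
  have f: "stable_class C M (RQ A) y f = {f' \<in> Mor C (RQ A) y. f' \<approx> f}"
    and g: "stable_class C M y (RQ B) g = {g' \<in> Mor C y (RQ B). g' \<approx> g}"
    using assms by (simp_all add: stable_class_eq_Collect)
  have ne: "f \<in> stable_class C M (RQ A) y f" "g \<in> stable_class C M y (RQ B) g"
    unfolding f g using assms stabeq_refl[OF MorD(1)[OF assms(1)]]
      stabeq_refl[OF MorD(1)[OF assms(2)]] by simp_all
  have eq: "stable_class C M (RQ A) (RQ B) (g' \<cdot> f') = stable_class C M (RQ A) (RQ B) (g \<cdot> f)"
    if "g' \<in> stable_class C M y (RQ B) g" "f' \<in> stable_class C M (RQ A) y f" for g' f'
    using that assms unfolding f g by (intro stable_class_cong stabeq_cmp) (auto simp: Mor_def)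
  show ?thesis unfolding Ho_comp_def using ne eq by blast
qed

text \<open>Any two lifts of \<open>f\<close> agree stably after the unit of \<open>A'\<close>, by
  naturality, and the unit can be cancelled. This serves the contravariant argument;
  \<open>Ho_arr_fibs\<close> serves the covariant one by means of counits.\<close>

lemma Ho_arr_cofs:
  assumes "A' \<in> cofs M" "A \<in> cofs M" "f \<in> Mor C A' A" "f'' \<in> bifibrant_lifts C K f"
  shows "Ho_arr C M K f = stable_class C M (RQ A') (RQ A) f''"
proof -
  obtain m where m: "unit_map A m" using unit_map_exists assms by blast
  obtain m' where m': "unit_map A' m'" using unit_map_exists assms by blast
  note [simp] = MorD[OF assms(3)] MorD[OF unit_map_Mor[OF m']]
  have lift: "g \<in> Mor C (RQ A') (RQ A)" if "g \<in> bifibrant_lifts C K f" for g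
    using that by (simp add: bifibrant_lifts_def Let_def)
  have "g \<approx> f''" if g: "g \<in> bifibrant_lifts C K f" for g
  proof -
    have [simp]: "g \<in> arrs C" "src C g = RQ A'" "tgt C g = RQ A" "f'' \<in> arrs C" "src C f'' = RQ A'"
      "tgt C f'' = RQ A"
      using lift[OF g] lift[OF assms(4)] by (auto simp: Mor_def)
    have "g \<cdot> m' \<approx> f'' \<cdot> m'"
      using unit_map_natural[OF assms(1) m m' assms(3)] g assms(4) stabeq_sym stabeq_trans by blast
    then have "(g -. f'') \<cdot> m' \<in> core_maps C M A' (RQ A)" by (simp add: stabeq_def)
    then have "g -. f'' \<in> core_maps C M (RQ A') (RQ A)"
      using unit_map_pre_equiv[OF m'] unfolding pre_equiv_def by (simp add: Mor_def)
    then show "g \<approx> f''" by (simp add: stabeq_def)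
  qed
  then show ?thesis
    unfolding Ho_arr_def using assms(4) lift
      by (intro UN_constant_eq) (auto intro!: stable_class_cong)
qed

lemma Ho_arr_fibs:
  assumes "B' \<in> fibs M" "B \<in> fibs M" "f \<in> Mor C B B'" "f'' \<in> bifibrant_lifts C K f"
  shows "Ho_arr C M K f = stable_class C M (RQ B) (RQ B') f''"
proof -
  obtain q where q: "counit_map B q" using counit_map_exists assms by blast
  obtain q' where q': "counit_map B' q'" using counit_map_exists assms by blast
  note [simp] = MorD[OF assms(3)] MorD[OF counit_map_Mor[OF q']]
  have lift: "g \<in> Mor C (RQ B) (RQ B')" if "g \<in> bifibrant_lifts C K f" for g
    using that by (simp add: bifibrant_lifts_def Let_def)
  have "g \<approx> f''" if g: "g \<in> bifibrant_lifts C K f" for g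
  proof -
    have [simp]: "g \<in> arrs C" "src C g = RQ B" "tgt C g = RQ B'" "f'' \<in> arrs C" "src C f'' = RQ B"
      "tgt C f'' = RQ B'"
      using lift[OF g] lift[OF assms(4)] by (auto simp: Mor_def)
    have "q' \<cdot> g \<approx> q' \<cdot> f''"
      using counit_map_natural[OF assms(1) q q' assms(3)] g assms(4) stabeq_sym stabeq_trans
        by blast
    then have "q' \<cdot> (g -. f'') \<in> core_maps C M (RQ B) B'" by (simp add: stabeq_def)
    then have "g -. f'' \<in> core_maps C M (RQ B) (RQ B')"
      using counit_map_post_equiv[OF q' assms(1)] unfolding post_equiv_def by (simp add: Mor_def)
    then show "g \<approx> f''" by (simp add: stabeq_def)
  qed
  then show ?thesis
    unfolding Ho_arr_def using assms(4) lift
      by (intro UN_constant_eq) (auto intro!: stable_class_cong)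
qed

text \<open>The comparisons from \<open>bifibrant_sequence_unique\<close> are the identity on the
  left and stably the identity on the right. Composing with them makes both morphisms run between
  the same two sequences, where their difference is null at one end iff it is null at the
  other.\<close>

lemma bifibrant_sequence_compare:
  assumes S: "short_exact C i p" "bifibrant_sequence C M K (i, p) (i1, p1)"
    "bifibrant_sequence C M K (i, p) (i2, p2)"
    and T: "short_exact C j q" "bifibrant_sequence C M K (j, q) (j1, q1)"
      "bifibrant_sequence C M K (j, q) (j2, q2)"
    and m: "ses_map C i1 p1 j1 q1 f c" "ses_map C i2 p2 j2 q2 f' c'"
  shows "f \<approx> f' \<longleftrightarrow> c \<approx> c'"
proof -
  note i1 [simp] = bifibrant_sequenceD[OF S(2)] and i2 [simp] = bifibrant_sequenceD[OF S(3)]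
    and j1 [simp] = bifibrant_sequenceD[OF T(2)] and j2 [simp] = bifibrant_sequenceD[OF T(3)]
  have [simp]: "f \<in> arrs C" "src C f = RQ (src C i)" "tgt C f = RQ (src C j)" "f' \<in> arrs C"
    "src C f' = RQ (src C i)" "tgt C f' = RQ (src C j)"
    "c \<in> arrs C" "src C c = RQ (tgt C p)" "tgt C c = RQ (tgt C q)" "c' \<in> arrs C"
    "src C c' = RQ (tgt C p)" "tgt C c' = RQ (tgt C q)"
    using m by (auto simp: ses_map_def Mor_def)
  obtain e where e: "ses_map C i2 p2 i1 p1 (idn C (RQ (src C i))) e" "e \<approx> idn C (RQ (tgt C p))"
    using bifibrant_sequence_unique[OF S(1,3,2)] by blast
  obtain d where d: "ses_map C j1 q1 j2 q2 (idn C (RQ (src C j))) d" "d \<approx> idn C (RQ (tgt C q))"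
    using bifibrant_sequence_unique[OF T] by blast
  have [simp]: "e \<in> arrs C" "src C e = RQ (tgt C p)" "tgt C e = RQ (tgt C p)" "d \<in> arrs C"
    "src C d = RQ (tgt C q)" "tgt C d = RQ (tgt C q)"
    using stabeqD[OF e(2)] stabeqD[OF d(2)] by simp_all
  have "ses_map C i2 p2 j2 q2 (idn C (RQ (src C j)) \<cdot> (f \<cdot> idn C (RQ (src C i)))) (d \<cdot> (c \<cdot> e))"
    by (intro ses_map_comp[OF _ _ _ _ d(1)] ses_map_comp[OF _ _ _ e(1) m(1)]) simp_all
  then have "ses_map C i2 p2 j2 q2 f (d \<cdot> (c \<cdot> e))" by simp
  then have s: "ses_map C i2 p2 j2 q2 (f -. f') (d \<cdot> (c \<cdot> e) -. c')"
    by (rule ses_map_hsub[OF i2(1) j2(1) _ m(2)])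
  have "c \<cdot> e \<approx> c \<cdot> idn C (RQ (tgt C p))" using e(2) by (rule stabeq_cmp_left) simp_all
  then have "d \<cdot> (c \<cdot> e) \<approx> idn C (RQ (tgt C q)) \<cdot> (c \<cdot> idn C (RQ (tgt C p)))" using d(2)
    by (rule stabeq_cmp) simp
  then have dce: "d \<cdot> (c \<cdot> e) \<approx> c" by simp
  have "f \<approx> f' \<longleftrightarrow> d \<cdot> (c \<cdot> e) \<approx> c'"
    using ses_map_null_right[OF i2(1) j2(1) _ j2(4) _ s] ses_map_null_left[OF i2(1) j2(1) _ i2(4)
      _ s]
    by (auto simp: stabeq_def)
  then show ?thesis using dce stabeq_sym stabeq_trans by blast
qed

end

section \<open>Powers of loop and suspension\<close>

locale model_loop = model_replacement +
  fixes s l :: "'a \<Rightarrow> 'b \<times> 'b"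
  assumes susp_choice: "suspension_choice C M s" and loop_choice: "loop_choice C M l"
begin

abbreviation "Om n A \<equiv> Omega_ob C s l n A"

lemma Om_nonneg: "0 \<le> n \<Longrightarrow> Om n A = (loop C l ^^ nat n) A"
  by (auto simp: Omega_ob_def Sigma_ob_def)

lemma Om_nonpos: "n \<le> 0 \<Longrightarrow> Om n A = (susp C s ^^ nat (- n)) A"
  by (auto simp: Omega_ob_def Sigma_ob_def)

lemma Om_0 [simp]: "Om 0 A = A"
  by (simp add: Om_nonneg)

text \<open>For \<open>n < 0\<close> the chosen sequence starts at \<open>\<Omega>\<^sup>n\<^sup>+\<^sup>1 A\<close> and defines \<open>\<Omega>\<^sup>n A\<close> as its suspension.\<close>

definition base_seq :: "'a \<Rightarrow> int \<Rightarrow> 'b \<times> 'b" where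
  "base_seq A n = (if 0 \<le> n then l (Om n A) else s (Om (n + 1) A))"

lemma base_seq:
  "short_exact C (fst (base_seq A n)) (snd (base_seq A n))"
  "src C (fst (base_seq A n)) = Om (n + 1) A"
  "tgt C (snd (base_seq A n)) = Om n A" "tgt C (fst (base_seq A n)) \<in> trivs M"
proof -
  have 1: "Om (n + 1) A = loop C l (Om n A)" if "0 \<le> n"
    using that by (simp add: Om_nonneg nat_add_distrib)
  have 2: "Om n A = susp C s (Om (n + 1) A)" if "n < 0"
  proof -
    have "nat (- n) = Suc (nat (- n - 1))" using that by simp
    then show ?thesis using that by (simp add: Om_nonpos)
  qed
  show "short_exact C (fst (base_seq A n)) (snd (base_seq A n))"
    "src C (fst (base_seq A n)) = Om (n + 1) A"
    "tgt C (snd (base_seq A n)) = Om n A" "tgt C (fst (base_seq A n)) \<in> trivs M"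
    using susp_choice loop_choice 1 2
    by (auto simp: base_seq_def suspension_choice_def loop_choice_def loop_def susp_def)
qed

definition bif_seq :: "'a \<Rightarrow> int \<Rightarrow> 'b \<times> 'b" where
  "bif_seq A n = (SOME ab. bifibrant_sequence C M K (base_seq A n) ab)"

abbreviation "ba A n \<equiv> fst (bif_seq A n)"
abbreviation "bb A n \<equiv> snd (bif_seq A n)"

lemma bif_seq: "bifibrant_sequence C M K (base_seq A n) (ba A n, bb A n)"
proof -
  obtain i p where "bifibrant_sequence C M K (fst (base_seq A n), snd (base_seq A n)) (i, p)"
    by (rule bifibrant_sequence_exists[OF base_seq(1,4)])
  then have "bifibrant_sequence C M K (base_seq A n) (bif_seq A n)"
    unfolding bif_seq_def by (simp add: someI)
  then show ?thesis by simp
qed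

lemma bif_seq': "bifibrant_sequence C M K (fst (base_seq A n), snd (base_seq A n)) (ba A n, bb A n)"
  using bif_seq by (simp only: prod.collapse)

lemma bb_tgt [simp]: "tgt C (bb A n) = RQ (Om n A)"
  by (simp only: bifibrant_sequenceD(3)[OF bif_seq'] base_seq(3))

lemma bif_zseq: "zseq (ba A) (bb A)"
  using bifibrant_sequenceD(1,2,4)[OF bif_seq', of A] by (simp add: zseq_def base_seq(2))

text \<open>For \<open>0 \<le> n\<close> the bifibrant sequence at index \<open>n\<close> comes from
  the loop sequence \<open>l\<close>, so the step of \<open>\<phi>\<close> is one admissible choice;
  by \<open>bifibrant_sequence_compare\<close> all others give the same class.\<close>

lemma loop_map_step:
  assumes n: "0 \<le> n" and phi: "zmap (ba A') (bb A') (ba A) (bb A) \<phi>"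
  shows "loop_map C M K l (Om n A') (Om n A) (stable_class C M (RQ (Om n A')) (RQ (Om n A)) (\<phi> n)) =
    stable_class C M (RQ (Om (n + 1) A')) (RQ (Om (n + 1) A)) (\<phi> (n + 1))"
proof -
  have b: "base_seq X n = l (Om n X)" "loop C l (Om n X) = Om (n + 1) X" for X
    using n base_seq(2)[of X n] by (simp_all add: base_seq_def loop_def)
  have pm: "\<phi> k \<in> Mor C (RQ (Om k A')) (RQ (Om k A))" for k using zmapD(2)[OF phi, of k] by simp
  note step = zmapD(1)[OF phi, of n]
  have cls: "stable_class C M (RQ (Om n A')) (RQ (Om n A)) (\<phi> n) =
      {g \<in> Mor C (RQ (Om n A')) (RQ (Om n A)). g \<approx> \<phi> n}"
    by (rule stable_class_eq_Collect[OF pm])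
  show ?thesis
    unfolding loop_map_def b
  proof (rule UN_constant_eq, goal_cases)
    case 1
    have 1: "\<phi> n \<in> stable_class C M (RQ (Om n A')) (RQ (Om n A)) (\<phi> n)"
      unfolding cls using pm[of n] stabeq_refl[OF MorD(1)[OF pm]] by simp
    obtain v where v: "v \<in> Mor C (tgt C (ba A' n)) (tgt C (ba A n))"
      "v \<cdot> ba A' n = ba A n \<cdot> \<phi> (n + 1)" "\<phi> n \<cdot> bb A' n = bb A n \<cdot> v"
      using step unfolding ses_map_def by blast
    have 2: "bifibrant_sequence C M K (l (Om n A')) (ba A' n, bb A' n)"
      "bifibrant_sequence C M K (l (Om n A)) (ba A n, bb A n)"
      using bif_seq[of A' n] bif_seq[of A n] unfolding b by simp_all
    show ?case
      unfolding Collect_empty_eq not_all not_not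
      by (rule exI[of _ "\<phi> (n + 1)"], intro conjI pm, rule bexI[OF _ 1], rule exI[of _
        "ba A' n"], rule exI[of _ "bb A' n"],
        rule exI[of _ "ba A n"], rule exI[of _ "bb A n"], rule bexI[OF _ v(1)])
          (use 2 v in simp_all)
  next
    case (2 c)
    then obtain f i p i' p' v where c: "c \<in> Mor C (RQ (Om (n + 1) A')) (RQ (Om (n + 1) A))"
      and f: "f \<in> Mor C (RQ (Om n A')) (RQ (Om n A))" "f \<approx> \<phi> n"
      and v: "v \<in> Mor C (tgt C i) (tgt C i')" and S: "bifibrant_sequence C M K (l (Om n A')) (i, p)"
      and T: "bifibrant_sequence C M K (l (Om n A)) (i', p')"
        and e: "p' \<cdot> v = f \<cdot> p" "i' \<cdot> c = v \<cdot> i"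
      unfolding cls by blast
    have S': "bifibrant_sequence C M K (fst (base_seq A' n), snd (base_seq A' n)) (i, p)"
      and T': "bifibrant_sequence C M K (fst (base_seq A n), snd (base_seq A n)) (i', p')"
      using S T by (simp_all add: b)
    have "ses_map C i p i' p' c f"
      unfolding ses_map_def using c f v e bifibrant_sequenceD(2,3)[OF S']
        bifibrant_sequenceD(2,3)[OF T'] base_seq(2,3) by auto
    then have "c \<approx> \<phi> (n + 1)"
      using bifibrant_sequence_compare[OF base_seq(1) S' bif_seq' base_seq(1) T' bif_seq' _ step]
        f(2) by blast
    then show ?case
      by (rule stable_class_cong[OF _ pm])
  qed
qed

text \<open>For \<open>n < 0\<close> the sequence at index \<open>n\<close> is the suspension
  sequence of the object at \<open>n + 1\<close>, so the suspension reads the step of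
  \<open>\<phi>\<close> from its left end to its right end, lowering the index.\<close>

lemma susp_map_step:
  assumes n: "n < 0" and phi: "zmap (ba A') (bb A') (ba A) (bb A) \<phi>"
  shows "susp_map C M K s (Om (n + 1) A') (Om (n + 1) A) (stable_class C M (RQ (Om (n + 1) A')) (RQ
      (Om (n + 1) A)) (\<phi> (n + 1))) =
    stable_class C M (RQ (Om n A')) (RQ (Om n A)) (\<phi> n)"
proof -
  have b: "base_seq X n = s (Om (n + 1) X)" "susp C s (Om (n + 1) X) = Om n X" for X
    using n base_seq(3)[of X n] by (simp_all add: base_seq_def susp_def)
  have pm: "\<phi> k \<in> Mor C (RQ (Om k A')) (RQ (Om k A))" for k using zmapD(2)[OF phi, of k] by simp
  note step = zmapD(1)[OF phi, of n]
  have cls: "stable_class C M (RQ (Om (n + 1) A')) (RQ (Om (n + 1) A)) (\<phi> (n + 1)) =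
    {g \<in> Mor C (RQ (Om (n + 1) A')) (RQ (Om (n + 1) A)). g \<approx> \<phi> (n + 1)}"
    by (rule stable_class_eq_Collect[OF pm])
  show ?thesis
    unfolding susp_map_def b
  proof (rule UN_constant_eq, goal_cases)
    case 1
    have 1: "\<phi> (n + 1) \<in> stable_class C M (RQ (Om (n + 1) A')) (RQ (Om (n + 1) A)) (\<phi> (n + 1))"
      unfolding cls using pm[of "n + 1"] stabeq_refl[OF MorD(1)[OF pm]] by simp
    obtain v where v: "v \<in> Mor C (tgt C (ba A' n)) (tgt C (ba A n))"
      "v \<cdot> ba A' n = ba A n \<cdot> \<phi> (n + 1)" "\<phi> n \<cdot> bb A' n = bb A n \<cdot> v"
      using step unfolding ses_map_def by blast
    have 2: "bifibrant_sequence C M K (s (Om (n + 1) A')) (ba A' n, bb A' n)"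
      "bifibrant_sequence C M K (s (Om (n + 1) A)) (ba A n, bb A n)"
      using bif_seq[of A' n] bif_seq[of A n] unfolding b by simp_all
    show ?case
      unfolding Collect_empty_eq not_all not_not
      by (rule exI[of _ "\<phi> n"], intro conjI pm, rule bexI[OF _ 1], rule exI[of _
        "ba A' n"], rule exI[of _ "bb A' n"],
        rule exI[of _ "ba A n"], rule exI[of _ "bb A n"], rule bexI[OF _ v(1)])
          (use 2 v in simp_all)
  next
    case (2 c)
    then obtain f i p i' p' v where c: "c \<in> Mor C (RQ (Om n A')) (RQ (Om n A))"
      and f: "f \<in> Mor C (RQ (Om (n + 1) A')) (RQ (Om (n + 1) A))" "f \<approx> \<phi> (n + 1)"
      and v: "v \<in> Mor C (tgt C i) (tgt C i')"
        and S: "bifibrant_sequence C M K (s (Om (n + 1) A')) (i, p)"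
      and T: "bifibrant_sequence C M K (s (Om (n + 1) A)) (i', p')"
        and e: "v \<cdot> i = i' \<cdot> f" "c \<cdot> p = p' \<cdot> v"
      unfolding cls by blast
    have S': "bifibrant_sequence C M K (fst (base_seq A' n), snd (base_seq A' n)) (i, p)"
      and T': "bifibrant_sequence C M K (fst (base_seq A n), snd (base_seq A n)) (i', p')"
      using S T by (simp_all add: b)
    have "ses_map C i p i' p' f c"
      unfolding ses_map_def using c f v e bifibrant_sequenceD(2,3)[OF S']
        bifibrant_sequenceD(2,3)[OF T'] base_seq(2,3) by auto
    then have "c \<approx> \<phi> n"
      using bifibrant_sequence_compare[OF base_seq(1) S' bif_seq' base_seq(1) T' bif_seq' _ step]
        f(2) by blast
    then show ?case
      by (rule stable_class_cong[OF _ pm])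
  qed
qed

text \<open>One morphism of families computes all powers: iterated loops climb from index 0,
  iterated suspensions descend from it.\<close>

lemma Omega_map_class:
  assumes phi: "zmap (ba A') (bb A') (ba A) (bb A) \<phi>"
  shows "Omega_map C M K s l n A' A (stable_class C M (RQ A') (RQ A) (\<phi> 0)) =
      stable_class C M (RQ (Om n A')) (RQ (Om n A)) (\<phi> n)"
proof -
  have up: "loop_pow_map C M K l k A' A (stable_class C M (RQ A') (RQ A) (\<phi> 0)) =
    stable_class C M (RQ (Om (int k) A')) (RQ (Om (int k) A)) (\<phi> (int k))" for k
  proof (induction k)
    case (Suc k)
    have "(loop C l ^^ k) X = Om (int k) X" for X by (simp add: Om_nonneg)
    then show ?case using Suc.IH loop_map_step[OF _ phi, of "int k"] by (simp add: add.commute)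
  qed simp
  have down: "susp_pow_map C M K s k A' A (stable_class C M (RQ A') (RQ A) (\<phi> 0)) =
    stable_class C M (RQ (Om (- int k) A')) (RQ (Om (- int k) A)) (\<phi> (- int k))" for k
  proof (induction k)
    case (Suc k)
    have e: "(susp C s ^^ k) X = Om (- int k) X" for X by (simp add: Om_nonpos)
    \<comment> \<open>The suspension step is stated from \<open>n + 1\<close> to \<open>n\<close>;
      here \<open>n\<close> is \<open>- int (Suc k)\<close>.\<close>
    have i: "- int k = - int (Suc k) + 1" by simp
    have "susp_pow_map C M K s (Suc k) A' A (stable_class C M (RQ A') (RQ A) (\<phi> 0)) =
      susp_map C M K s (Om (- int k) A') (Om (- int k) A) (stable_class C M (RQ (Om (- int k) A'))
        (RQ (Om (- int k) A)) (\<phi> (- int k)))"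
      by (simp only: susp_pow_map.simps e Suc.IH)
    also have "\<dots> = stable_class C M (RQ (Om (- int (Suc k)) A')) (RQ (Om (- int (Suc k)) A)) (\<phi> (-
        int (Suc k)))"
      unfolding i by (rule susp_map_step[OF _ phi]) simp
    finally show ?case .
  qed simp
  show ?thesis
  proof (cases "n \<le> 0")
    case True
    then show ?thesis using down[of "nat (- n)"] by (simp add: Omega_map_def Sigma_map_def)
  next
    case False
    then show ?thesis using up[of "nat n"] by (simp add: Omega_map_def Sigma_map_def)
  qed
qed

end

section \<open>Syzygies of resolutions\<close>

text \<open>The differentials factor as \<open>d\<^sub>i = k\<^sub>i e\<^sub>i\<close> through the syzygies \<open>K\<^sub>i = tgt (e i)\<close>, with \<open>K\<^sub>0 = A\<close>.\<close>

definition resolution_factors ::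
  "('o, 'a) cat \<Rightarrow> 'o triple \<Rightarrow> 'o \<Rightarrow> ('o, 'a) zcomplex \<Rightarrow> (int \<Rightarrow> 'a) \<Rightarrow> (int \<Rightarrow> 'a) \<Rightarrow> bool" where
  "resolution_factors C M A P k e \<longleftrightarrow> e 0 = aug P \<and> k 0 = coaug P \<and> tgt C (e 0) = A \<and>
     (\<forall>i. dif P i = k i \<cdot> e i \<and> short_exact C (k (i + 1)) (e i) \<and> src C (e i) = ob P i \<and> tgt C (k i)
       = ob P (i - 1) \<and>
        src C (k i) = tgt C (e i) \<and> ob P i \<in> trivs M) \<and>
     (\<forall>i\<ge>0. ob P i \<in> cofs M) \<and> (\<forall>i<0. ob P i \<in> fibs M) \<and> (\<forall>i<0. tgt C (e i) \<in> cofs M)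
       \<and> (\<forall>i>0. tgt C (e i) \<in> fibs M)"
  for C (structure)

context model
begin

lemma epi_cancel_cokernel:
  assumes "short_exact C k p" "is_epi C e" "tgt C e = src C k"
  shows "is_cokernel C (k \<cdot> e) p"
  using abelian_category.kernel_mono_cmp[OF abelian_category_opc[OF abelian_category_axioms],
    of k p e] assms
  by (simp add: short_exact_def)

text \<open>At index 0 the factorization must be the given one through \<open>A\<close>; elsewhere
  exactness supplies one. At index 1 the mono is taken as a kernel of \<open>aug P\<close>, since
  fibrancy is assumed for that kernel; it is also a kernel of \<open>dif P 0\<close> because
  \<open>coaug P\<close> is mono.\<close>

lemma resolution_factors_exist:
  assumes "M_resolution C M A P"
  obtains k e where "resolution_factors C M A P k e"
proof -
  have P: "\<And>i. dif P i \<in> Mor C (ob P i) (ob P (i - 1))" "aug P \<in> Mor C (ob P 0) A"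
    "coaug P \<in> Mor C A (ob P (- 1))"
    "dif P 0 = coaug P \<cdot> aug P" "\<And>i. exact C (dif P (i + 1)) (dif P i)" "exact C (dif P 1) (aug P)"
    "is_epi C (aug P)"
    "is_mono C (coaug P)" "exact C (coaug P) (dif P (- 1))" "\<And>i. 0 \<le> i \<Longrightarrow> ob P i \<in> cofs M \<inter> trivs M"
    "\<And>k. is_kernel C (aug P) k \<Longrightarrow> src C k \<in> fibs M"
    "\<And>i k. 1 \<le> i \<Longrightarrow> is_kernel C (dif P i) k \<Longrightarrow> src C k \<in> fibs M"
    "\<And>i. i \<le> - 1 \<Longrightarrow> ob P i \<in> trivs M \<inter> fibs M" "\<And>c. is_cokernel C (coaug P) c \<Longrightarrow> tgt C c \<in> cofs M"
    "\<And>i c. i \<le> - 1 \<Longrightarrow> is_cokernel C (dif P i) c \<Longrightarrow> tgt C c \<in> cofs M"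
    using assms unfolding M_resolution_def by blast+
  have "\<exists>ke. dif P i = fst ke \<cdot> snd ke \<and> is_mono C (fst ke) \<and> is_epi C (snd ke) \<and>
      tgt C (snd ke) = src C (fst ke) \<and>
     (i = 0 \<longrightarrow> ke = (coaug P, aug P)) \<and> (i = 1 \<longrightarrow> is_kernel C (aug P) (fst ke))
       \<and> (i \<noteq> 0 \<longrightarrow> is_kernel C (dif P (i - 1)) (fst ke))" for i
  proof -
    consider "i = 0" | "i = 1" | "i \<noteq> 0" "i \<noteq> 1" by blast
    then show ?thesis
    proof cases
      case 1
      then show ?thesis using P(2-4,7,8) by (intro exI[of _ "(coaug P, aug P)"]) (simp add: Mor_def)
    next
      case 2
      obtain k e where ke: "is_kernel C (aug P) k" "is_epi C e" "tgt C e = src C k"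
        "dif P 1 = k \<cdot> e"
        using P(6) unfolding exact_def by blast
      have "is_kernel C (dif P 0) k" unfolding P(4)
        using kernel_mono_cmp[OF ke(1) P(8)] P(2,3) by (simp add: Mor_def)
      then show ?thesis using 2 ke kernel_mono by (intro exI[of _ "(k, e)"]) simp
    next
      case 3
      obtain k e where ke: "is_kernel C (dif P (i - 1)) k" "is_epi C e" "tgt C e = src C k"
        "dif P i = k \<cdot> e"
        using P(5)[of "i - 1"] unfolding exact_def by auto
      then show ?thesis using 3 kernel_mono by (intro exI[of _ "(k, e)"]) simp
    qed
  qed
  then obtain ke where ke': "\<And>i. dif P i = fst (ke i) \<cdot> snd (ke i) \<and> is_mono C (fst (ke i)) \<and>
      is_epi C (snd (ke i)) \<and> tgt C (snd (ke i)) = src C (fst (ke i)) \<and>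
     (i = 0 \<longrightarrow> ke i = (coaug P, aug P)) \<and> (i = 1 \<longrightarrow> is_kernel C (aug P) (fst (ke i)))
       \<and> (i \<noteq> 0 \<longrightarrow> is_kernel C (dif P (i - 1)) (fst (ke i)))"
    by metis
  define k e where "k = fst \<circ> ke" and "e = snd \<circ> ke"
  have ke: "dif P i = k i \<cdot> e i" "is_mono C (k i)" "is_epi C (e i)" "tgt C (e i) = src C (k i)"
    and ke0: "k 0 = coaug P" "e 0 = aug P" and ke1: "is_kernel C (aug P) (k 1)"
      and ken: "i \<noteq> 0 \<Longrightarrow> is_kernel C (dif P (i - 1)) (k i)" for i
    using ke'[of i] ke'[of 0] ke'[of 1] by (simp_all add: k_def e_def)
  have arr [simp]: "k i \<in> arrs C" "e i \<in> arrs C" "src C (e i) = ob P i" "tgt C (k i) = ob P (i - 1)"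
    for i
    using P(1)[of i] ke[of i] is_mono_arr is_epi_arr by (auto simp: Mor_def)
  have ses: "short_exact C (k (i + 1)) (e i)" for i
  proof (rule epi_kernel_cokernel[OF ke(3)])
    have "is_kernel C (dif P i) (k (i + 1))"
    \<comment> \<open>\<open>k 0\<close> is prescribed rather than chosen as a kernel, so here
      exactness at the coaugmentation takes over.\<close>
    proof (cases "i = - 1")
      case True
      then show ?thesis using exact_mono_kernel[OF P(9,8)] ke0 by simp
    next
      case False
      then show ?thesis using ken[of "i + 1"] by simp
    qed
    then show "is_kernel C (e i) (k (i + 1))"
      unfolding ke(1) by (rule kernel_mono_cmpD[OF _ ke(2)]) (simp_all add: ke(4))
  qed
  have neg: "tgt C (e i) \<in> cofs M" if "i < 0" for i
  proof (cases "i = - 1")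
    case True
    then show ?thesis using ses[of "- 1"] ke0 P(14) by (simp add: short_exact_def)
  next
    case False
    have "is_cokernel C (dif P (i + 1)) (e i)"
      unfolding ke(1)[of "i + 1"] by (rule epi_cancel_cokernel[OF ses ke(3)]) (rule ke(4))
    then show ?thesis using P(15)[of "i + 1" "e i"] that False by simp
  qed
  have pos: "tgt C (e i) \<in> fibs M" if "i > 0" for i
  proof (cases "i = 1")
    case True
    then show ?thesis using ke1 P(11) ke(4) by simp
  next
    case False
    then show ?thesis using ken[of i] P(12)[of "i - 1" "k i"] ke(4) that by simp
  qed
  have "ob P i \<in> trivs M" for i using P(10,13)[of i] by (cases "0 \<le> i") auto
  then have "resolution_factors C M A P k e"
    unfolding resolution_factors_def using ke ke0 ses neg pos P(2,10,13) by (auto simp: Mor_def)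
  then show ?thesis by (rule that)
qed

lemma resolution_factorsD:
  assumes "resolution_factors C M A P k e"
  shows "e 0 = aug P" "k 0 = coaug P" "tgt C (e 0) = A" "dif P i = k i \<cdot> e i"
    "short_exact C (k (i + 1)) (e i)"
    "src C (e i) = ob P i" "tgt C (k i) = ob P (i - 1)" "src C (k i) = tgt C (e i)"
    "ob P i \<in> trivs M"
    "k i \<in> arrs C" "e i \<in> arrs C" "is_mono C (k i)" "is_epi C (e i)"
proof -
  show ses: "short_exact C (k (i + 1)) (e i)" for i using assms unfolding resolution_factors_def
    by blast
  show "e 0 = aug P" "k 0 = coaug P" "tgt C (e 0) = A" "dif P i = k i \<cdot> e i"
    "src C (e i) = ob P i" "tgt C (k i) = ob P (i - 1)" "src C (k i) = tgt C (e i)"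
    "ob P i \<in> trivs M"
    using assms unfolding resolution_factors_def by blast+
  show "k i \<in> arrs C" "is_mono C (k i)" using sesD(1,6)[OF ses[of "i - 1"]] by simp_all
  show "e i \<in> arrs C" "is_epi C (e i)" using sesD(2,7)[OF ses[of i]] by simp_all
qed

lemma resolution_factors_zseq: "resolution_factors C M A P k e \<Longrightarrow> zseq (\<lambda>i. k (i + 1)) e"
  unfolding zseq_def by (simp add: resolution_factorsD)

text \<open>In negative degrees this is part of a resolution. From \<open>A\<close> upwards each
  syzygy is the kernel of an epi between cofibrant objects, so \<open>cofs_kernel\<close> carries
  cofibrancy along.\<close>

lemma resolution_factors_cofs:
  assumes r: "resolution_factors C M A P k e" and "A \<in> cofs M" shows "tgt C (e n) \<in> cofs M"
proof (cases "n < 0")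
  case True
  then show ?thesis using r by (simp add: resolution_factors_def)
next
  case False
  then have "0 \<le> n" by simp
  then show ?thesis
  proof (induction n rule: int_ge_induct)
    case base
    show ?case using assms(2) resolution_factorsD(3)[OF r] by simp
  next
    case (step i)
    have "ob P i \<in> cofs M" using r step(1) by (simp add: resolution_factors_def)
    then show ?case using cofs_kernel[OF resolution_factorsD(5)[OF r, of i]]
      step resolution_factorsD[OF r] by simp
  qed
qed

lemma resolution_factors_fibs:
  assumes r: "resolution_factors C M A P k e" and "A \<in> fibs M" shows "tgt C (e n) \<in> fibs M"
proof (cases "n > 0")
  case True
  then show ?thesis using r by (simp add: resolution_factors_def)
next
  case False
  then have "n \<le> 0" by simp
  then show ?thesis
  proof (induction n rule: int_le_induct)
    case base
    show ?case using assms(2) resolution_factorsD(3)[OF r] by simp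
  next
    case (step i)
    have "ob P (i - 1) \<in> fibs M" using r step(1) by (simp add: resolution_factors_def)
    then show ?case
      using fibs_cokernel[OF resolution_factorsD(5)[OF r, of
        "i - 1"]] step resolution_factorsD(7,8)[OF r, of i] by simp
  qed
qed

text \<open>That \<open>e n \<cdot> u n\<close> vanishes on \<open>k' (n + 1)\<close> is tested
  after the epi \<open>e' (n + 1)\<close>, where it follows from the chain map equation; so it
  descends to the syzygies. At 0 the augmentation identifies the descended map with
  \<open>f\<close>.\<close>

lemma chain_lift_zmap:
  assumes r: "resolution_factors C M A P k e" and r': "resolution_factors C M A' P' k' e'"
    and u: "chain_lift C P' P f u" and f: "f \<in> Mor C A' A"
  obtains x where "zmap (\<lambda>i. k' (i + 1)) e' (\<lambda>i. k (i + 1)) e x" "x 0 = f"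
    "\<And>n. e n \<cdot> u n = x n \<cdot> e' n" "\<And>n. u (n - 1) \<cdot> k' n = k n \<cdot> x n"
proof -
  note [simp] = resolution_factorsD(6-8,10,11)[OF r] resolution_factorsD(6-8,10,11)[OF r']
    resolution_factorsD(3)[OF r] resolution_factorsD(3)[OF r'] MorD[OF f]
  have um [simp]: "u i \<in> arrs C" "src C (u i) = ob P' i" "tgt C (u i) = ob P i" and
    ud: "dif P i \<cdot> u i = u (i - 1) \<cdot> dif P' i" and u0: "e 0 \<cdot> u 0 = f \<cdot> e' 0" for i
    using u unfolding chain_lift_def resolution_factorsD(1)[OF r] resolution_factorsD(1)[OF r']
      by (auto simp: Mor_def)
  have "\<exists>x\<in>arrs C. src C x = tgt C (e' n) \<and> tgt C x = tgt C (e n) \<and> x \<cdot> e' n = e n \<cdot> u n \<and>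
      u (n - 1) \<cdot> k' n = k n \<cdot> x \<and> (n = 0 \<longrightarrow> x = f)" for n
  proof -
    note s = resolution_factorsD(5)[OF r, of n] and s' = resolution_factorsD(5)[OF r', of n]
    note [simp] = sesD(3-5)[OF s] sesD(4,5)[OF s']
    have "e n \<cdot> (u n \<cdot> k' (n + 1)) = nul C (tgt C (e' (n + 1))) (tgt C (e n))"
    proof (rule is_epiD[OF resolution_factorsD(13)[OF r', of "n + 1"]])
      have "u n \<cdot> (k' (n + 1) \<cdot> e' (n + 1)) = (k (n + 1) \<cdot> e (n + 1)) \<cdot> u (n + 1)"
        using ud[of "n + 1"] unfolding resolution_factorsD(4)[OF r] resolution_factorsD(4)[OF r']
          by simp
      then show "(e n \<cdot> (u n \<cdot> k' (n + 1))) \<cdot> e' (n + 1) =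
          nul C (tgt C (e' (n + 1))) (tgt C (e n)) \<cdot> e' (n + 1)"
        by simp
    qed simp_all
    then obtain x where x [simp]: "x \<in> arrs C" "tgt C x = tgt C (e n)" "src C x = tgt C (e' n)"
      and xe: "x \<cdot> e' n = e n \<cdot> u n"
      using ses_colift[OF s', of "e n \<cdot> u n"] by auto
    have "u (n - 1) \<cdot> k' n = k n \<cdot> x"
    proof (rule is_epiD[OF resolution_factorsD(13)[OF r', of n]])
      have "(u (n - 1) \<cdot> k' n) \<cdot> e' n = (k n \<cdot> e n) \<cdot> u n"
        using ud[of n] unfolding resolution_factorsD(4)[OF r] resolution_factorsD(4)[OF r'] by simp
      then show "(u (n - 1) \<cdot> k' n) \<cdot> e' n = (k n \<cdot> x) \<cdot> e' n" by (simp add: xe)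
    qed simp_all
    moreover have "x = f" if "n = 0"
      by (rule is_epiD[OF resolution_factorsD(13)[OF r', of n]])
        (use that xe u0 in simp_all)
    ultimately show ?thesis using xe by (intro bexI[of _ x]) simp_all
  qed
  then obtain x where x: "\<And>n. x n \<in> arrs C \<and> src C (x n) = tgt C (e' n) \<and>
      tgt C (x n) = tgt C (e n) \<and> x n \<cdot> e' n = e n \<cdot> u n \<and>
      u (n - 1) \<cdot> k' n = k n \<cdot> x n \<and> (n = 0 \<longrightarrow> x n = f)"
    by metis
  have "zmap (\<lambda>i. k' (i + 1)) e' (\<lambda>i. k (i + 1)) e x"
    unfolding zmap_def ses_map_def
  proof (intro allI conjI)
    fix n show "\<exists>v\<in>Mor C (tgt C (k' (n + 1))) (tgt C (k (n + 1))). v \<cdot> k' (n + 1) =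
        k (n + 1) \<cdot> x (n + 1) \<and> x n \<cdot> e' n = e n \<cdot> v"
      using x[of n] x[of "n + 1"] by (intro bexI[of _ "u n"]) (simp_all add: Mor_def)
  qed (use x in \<open>simp_all add: Mor_def\<close>)
  then show ?thesis using x by (intro that[of x]) simp_all
qed

text \<open>\<open>zmap_exists\<close> does not apply, as the syzygies need not all be cofibrant in
  the source and fibrant in the target. The terms help out: for \<open>n \<ge> 0\<close> the
  trivially cofibrant \<open>ob P' n\<close> lifts against a fibrant kernel, for
  \<open>n < 0\<close> maps to the trivially fibrant \<open>ob P n\<close> extend over a cofibrant
  cokernel.\<close>

lemma chain_lift_exists:
  assumes r: "resolution_factors C M A P k e" and r': "resolution_factors C M A' P' k' e'"
    and f: "f \<in> Mor C A' A"
  obtains u where "chain_lift C P' P f u"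
proof -
  note [simp] = resolution_factorsD(6-8,10,11)[OF r] resolution_factorsD(6-8,10,11)[OF r']
    resolution_factorsD(3)[OF r] resolution_factorsD(3)[OF r'] MorD[OF f]
  define R where "R n x y \<longleftrightarrow> (\<exists>u\<in>Mor C (ob P' n) (ob P n). e n \<cdot> u = x \<cdot> e' n \<and>
      u \<cdot> k' (n + 1) = k (n + 1) \<cdot> y)" for n x y
  have "\<exists>x. x 0 = f \<and> (\<forall>n. x n \<in> Mor C (tgt C (e' n)) (tgt C (e n))) \<and> (\<forall>n. R n (x n) (x (n + 1)))"
  proof (rule int_family)
    show "f \<in> Mor C (tgt C (e' 0)) (tgt C (e 0))" using f by simp
  next
    fix n x assume n: "0 \<le> n" and x: "x \<in> Mor C (tgt C (e' n)) (tgt C (e n))"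
    note s = resolution_factorsD(5)[OF r, of n] and s' = resolution_factorsD(5)[OF r', of n]
    note [simp] = sesD(3-5)[OF s] sesD(4,5)[OF s'] MorD[OF x]
    obtain u where u [simp]: "u \<in> arrs C" "src C u = ob P' n" "tgt C u = ob P n"
      and eu: "e n \<cdot> u = x \<cdot> e' n"
      using lift_fibs[OF s, of "x \<cdot> e' n"] n r r' by (auto simp: resolution_factors_def)
    obtain y where "y \<in> arrs C" "src C y = tgt C (e' (n + 1))" "tgt C y = tgt C (e (n + 1))"
      "k (n + 1) \<cdot> y = u \<cdot> k' (n + 1)"
      by (rule ses_lift[OF s, of "u \<cdot> k' (n + 1)"]) (simp_all add: reassoc[OF eu])
    then show "\<exists>y. y \<in> Mor C (tgt C (e' (n + 1))) (tgt C (e (n + 1))) \<and> R n x y"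
      unfolding R_def using eu by (intro exI[of _ y] conjI bexI[of _ u]) (simp_all add: Mor_def)
  next
    fix n y assume n: "n < 0" and y: "y \<in> Mor C (tgt C (e' (n + 1))) (tgt C (e (n + 1)))"
    note s = resolution_factorsD(5)[OF r, of n] and s' = resolution_factorsD(5)[OF r', of n]
    note [simp] = sesD(4,5)[OF s] sesD(3-5)[OF s'] MorD[OF y]
    obtain u where u [simp]: "u \<in> arrs C" "src C u = ob P' n" "tgt C u = ob P n"
      and uk: "u \<cdot> k' (n + 1) = k (n + 1) \<cdot> y"
      using extend_cofs[OF s', of "k (n + 1) \<cdot> y"] n r r' by (auto simp: resolution_factors_def)
    obtain x where "x \<in> arrs C" "tgt C x = tgt C (e n)" "src C x = tgt C (e' n)"
      "x \<cdot> e' n = e n \<cdot> u"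
      by (rule ses_colift[OF s', of "e n \<cdot> u"]) (simp_all add: uk)
    then show "\<exists>x. x \<in> Mor C (tgt C (e' n)) (tgt C (e n)) \<and> R n x y"
      unfolding R_def using uk by (intro exI[of _ x] conjI bexI[of _ u]) (simp_all add: Mor_def)
  qed
  then obtain x where x: "x 0 = f" "\<And>n. x n \<in> Mor C (tgt C (e' n)) (tgt C (e n))"
    "\<And>n. R n (x n) (x (n + 1))" by blast
  from x(3) obtain u where u: "\<And>n. u n \<in> Mor C (ob P' n) (ob P n)" "\<And>n. e n \<cdot> u n = x n \<cdot> e' n"
    "\<And>n. u n \<cdot> k' (n + 1) = k (n + 1) \<cdot> x (n + 1)"
    unfolding R_def by metis
  have um [simp]: "u i \<in> arrs C" "src C (u i) = ob P' i" "tgt C (u i) = ob P i" "x i \<in> arrs C"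
    "src C (x i) = tgt C (e' i)" "tgt C (x i) = tgt C (e i)" for i
    using u(1)[of i] x(2)[of i] by (simp_all add: Mor_def)
  have u3: "u (i - 1) \<cdot> k' i = k i \<cdot> x i" for i using u(3)[of "i - 1"] by simp
  have "dif P i \<cdot> u i = u (i - 1) \<cdot> dif P' i" for i
    unfolding resolution_factorsD(4)[OF r] resolution_factorsD(4)[OF r']
      by (simp add: u(2) reassoc[OF u3])
  moreover have "aug P \<cdot> u 0 = f \<cdot> aug P'" "coaug P \<cdot> f = u (- 1) \<cdot> coaug P'"
    using u(2)[of 0] u3[of 0] x(1) resolution_factorsD(1,2)[OF r] resolution_factorsD(1,2)[OF r']
      by simp_all
  ultimately have "chain_lift C P' P f u" using u(1) unfolding chain_lift_def by blast
  then show ?thesis by (rule that)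
qed

end

section \<open>Isomorphisms of quotient groups\<close>

text \<open>The graph of an additive correspondence that induces an isomorphism from \<open>G Mod A\<close> to \<open>H Mod B\<close>.\<close>

definition coset_rel :: "('x, 'm) monoid_scheme \<Rightarrow> 'x set \<Rightarrow> ('y, 'n) monoid_scheme \<Rightarrow> 'y set \<Rightarrow> ('x \<Rightarrow>
    'y \<Rightarrow> bool) \<Rightarrow> bool" where
  "coset_rel G A H B \<rho> \<longleftrightarrow> comm_group G \<and> comm_group H \<and> subgroup A G \<and> subgroup B H \<and>
     (\<forall>x y. \<rho> x y \<longrightarrow> x \<in> carrier G \<and> y \<in> carrier H) \<and>
     (\<forall>x\<in>carrier G. \<exists>y. \<rho> x y) \<and> (\<forall>y\<in>carrier H. \<exists>x. \<rho> x y) \<and>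
     (\<forall>x y x' y'. \<rho> x y \<longrightarrow> \<rho> x' y' \<longrightarrow> \<rho> (x \<otimes>\<^bsub>G\<^esub> x') (y \<otimes>\<^bsub>H\<^esub> y')) \<and>
     (\<forall>x y. \<rho> x y \<longrightarrow> (x \<in> A \<longleftrightarrow> y \<in> B))"

lemma coset_rel_sym: "coset_rel G A H B (\<lambda>x y. \<rho> y x) \<Longrightarrow> coset_rel H B G A \<rho>"
  unfolding coset_rel_def by blast

lemma coset_rel_iso:
  assumes "coset_rel G A H B \<rho>"
  shows "\<exists>\<tau>. \<tau> \<in> iso (G Mod A) (H Mod B) \<and> (\<forall>x y. \<rho> x y \<longrightarrow> \<tau> (A #>\<^bsub>G\<^esub> x) = B #>\<^bsub>H\<^esub> y)"
proof -
  have G: "comm_group G" and H: "comm_group H" and A: "subgroup A G" and B: "subgroup B H"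
    and car: "\<And>x y. \<rho> x y \<Longrightarrow> x \<in> carrier G" "\<And>x y. \<rho> x y \<Longrightarrow> y \<in> carrier H"
    and left: "\<And>x. x \<in> carrier G \<Longrightarrow> \<exists>y. \<rho> x y" and right: "\<And>y. y \<in> carrier H \<Longrightarrow> \<exists>x. \<rho> x y"
    and mult: "\<And>x y x' y'. \<lbrakk>\<rho> x y; \<rho> x' y'\<rbrakk> \<Longrightarrow> \<rho> (x \<otimes>\<^bsub>G\<^esub> x') (y \<otimes>\<^bsub>H\<^esub> y')"
    and null: "\<And>x y. \<rho> x y \<Longrightarrow> x \<in> A \<longleftrightarrow> y \<in> B"
    using assms unfolding coset_rel_def by blast+
  interpret G: comm_group G by (rule G)
  interpret H: comm_group H by (rule H)
  interpret A: normal A G by (rule G.subgroup_imp_normal[OF A])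
  interpret B: normal B H by (rule H.subgroup_imp_normal[OF B])
  have eqG: "A #>\<^bsub>G\<^esub> x = A #>\<^bsub>G\<^esub> x' \<longleftrightarrow> x \<otimes>\<^bsub>G\<^esub> inv\<^bsub>G\<^esub> x' \<in> A" if "x \<in> carrier G" "x' \<in> carrier G"
    for x x'
    using that G.repr_independence[OF _ _ A, of x x'] G.repr_independenceD[OF A, of x x']
      A.rcos_module[OF G.is_group, of x' x] by auto
  have eqH: "B #>\<^bsub>H\<^esub> x = B #>\<^bsub>H\<^esub> x' \<longleftrightarrow> x \<otimes>\<^bsub>H\<^esub> inv\<^bsub>H\<^esub> x' \<in> B" if "x \<in> carrier H" "x' \<in> carrier H"
    for x x'
    using that H.repr_independence[OF _ _ B, of x x'] H.repr_independenceD[OF B, of x x']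
      B.rcos_module[OF H.is_group, of x' x] by auto
  have key: "A #>\<^bsub>G\<^esub> x = A #>\<^bsub>G\<^esub> x' \<longleftrightarrow> B #>\<^bsub>H\<^esub> y = B #>\<^bsub>H\<^esub> y'" if 1: "\<rho> x y" and 2: "\<rho> x' y'"
    for x y x' y'
  proof -
    note [simp] = car[OF 1] car[OF 2]
    \<comment> \<open>\<open>\<rho>\<close> is not assumed to respect inverses, but any partner
      \<open>w\<close> of the inverse of \<open>x'\<close> is inverse to \<open>y'\<close> modulo
      \<open>B\<close>.\<close>
    obtain w where w: "\<rho> (inv\<^bsub>G\<^esub> x') w" using left by force
    note [simp] = car(2)[OF w]
    have "y' \<otimes>\<^bsub>H\<^esub> w \<in> B" using null[OF mult[OF 2 w]] by simp
    moreover have "x \<otimes>\<^bsub>G\<^esub> inv\<^bsub>G\<^esub> x' \<in> A \<longleftrightarrow> y \<otimes>\<^bsub>H\<^esub> w \<in> B" by (rule null[OF mult[OF 1 w]])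
    moreover have "y \<otimes>\<^bsub>H\<^esub> w = (y \<otimes>\<^bsub>H\<^esub> inv\<^bsub>H\<^esub> y') \<otimes>\<^bsub>H\<^esub> (y' \<otimes>\<^bsub>H\<^esub> w)"
      by (simp add: H.m_assoc[symmetric]) (simp add: H.m_assoc)
    moreover have "(y \<otimes>\<^bsub>H\<^esub> w) \<otimes>\<^bsub>H\<^esub> inv\<^bsub>H\<^esub> w = y" by (simp add: H.m_assoc)
    then have "y \<otimes>\<^bsub>H\<^esub> inv\<^bsub>H\<^esub> y' = (y \<otimes>\<^bsub>H\<^esub> w) \<otimes>\<^bsub>H\<^esub> inv\<^bsub>H\<^esub> (y' \<otimes>\<^bsub>H\<^esub> w)"
      by (simp add: H.inv_mult_group H.m_assoc[symmetric])
    ultimately have "x \<otimes>\<^bsub>G\<^esub> inv\<^bsub>G\<^esub> x' \<in> A \<longleftrightarrow> y \<otimes>\<^bsub>H\<^esub> inv\<^bsub>H\<^esub> y' \<in> B"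
      using B.m_closed B.m_inv_closed by metis
    then show ?thesis by (simp add: eqG eqH)
  qed
  define \<tau> where "\<tau> \<xi> = (SOME \<eta>. \<exists>x y. \<rho> x y \<and> \<xi> = A #>\<^bsub>G\<^esub> x \<and> \<eta> = B #>\<^bsub>H\<^esub> y)" for \<xi>
  have \<tau>: "\<tau> (A #>\<^bsub>G\<^esub> x) = B #>\<^bsub>H\<^esub> y" if "\<rho> x y" for x y
    unfolding \<tau>_def by (rule some_equality) (use that key in blast)+
  have rep: "\<exists>x y. \<rho> x y \<and> \<xi> = A #>\<^bsub>G\<^esub> x" if "\<xi> \<in> carrier (G Mod A)" for \<xi>
    using that left unfolding carrier_FactGroup by blast
  have "\<tau> \<in> iso (G Mod A) (H Mod B)"
    unfolding iso_def
  proof (intro CollectI conjI homI bij_betw_imageI inj_onI)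
    fix \<xi> assume "\<xi> \<in> carrier (G Mod A)"
    then obtain x y where "\<rho> x y" "\<xi> = A #>\<^bsub>G\<^esub> x" using rep by blast
    then show "\<tau> \<xi> \<in> carrier (H Mod B)" using \<tau> car by (auto simp: carrier_FactGroup)
  next
    fix \<xi> \<xi>' assume "\<xi> \<in> carrier (G Mod A)" "\<xi>' \<in> carrier (G Mod A)"
    then obtain x y x' y' where 1: "\<rho> x y" "\<xi> = A #>\<^bsub>G\<^esub> x" "\<rho> x' y'" "\<xi>' = A #>\<^bsub>G\<^esub> x'"
      using rep by meson
    then show "\<tau> (\<xi> \<otimes>\<^bsub>G Mod A\<^esub> \<xi>') = \<tau> \<xi> \<otimes>\<^bsub>H Mod B\<^esub> \<tau> \<xi>'"
      using car \<tau>[OF 1(1)] \<tau>[OF 1(3)] \<tau>[OF mult[OF 1(1,3)]] by (simp add: A.rcos_sum B.rcos_sum)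
    show "\<xi> = \<xi>'" if "\<tau> \<xi> = \<tau> \<xi>'" using that 1 \<tau> key by simp
  next
    show "\<tau> ` carrier (G Mod A) = carrier (H Mod B)"
    proof (intro equalityI subsetI)
      fix \<eta> assume "\<eta> \<in> \<tau> ` carrier (G Mod A)"
      then obtain x y where "\<rho> x y" "\<eta> = B #>\<^bsub>H\<^esub> y" using rep \<tau> by force
      then show "\<eta> \<in> carrier (H Mod B)" using car unfolding carrier_FactGroup by blast
    next
      fix \<eta> assume "\<eta> \<in> carrier (H Mod B)"
      then obtain x y where "\<rho> x y" "\<eta> = B #>\<^bsub>H\<^esub> y" using right unfolding carrier_FactGroup by blast
      then show "\<eta> \<in> \<tau> ` carrier (G Mod A)"
        using car \<tau> unfolding carrier_FactGroup by (metis image_eqI)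
    qed
  qed
  then show ?thesis using \<tau> by blast
qed

text \<open>The isomorphism is determined by related representatives, so for naturality it is enough
  that the two image classes are represented by some related pair.\<close>

lemma natural_iso_of_coset_rel:
  assumes rel: "\<And>A B. \<lbrakk>A \<in> cofs M; B \<in> fibs M\<rbrakk> \<Longrightarrow> coset_rel (G A B) (N A B) (H A B) (L A B) (\<rho> A B)"
    and F1: "\<And>A B. F A B = G A B Mod N A B" and F2: "\<And>A B. F' A B = H A B Mod L A B"
    and nat: "\<And>A A' B B' f g x y. \<lbrakk>A \<in> cofs M; A' \<in> cofs M; B \<in> fibs M; B' \<in> fibs M; f \<in> Mor C A' A;
        g \<in> Mor C B B'; \<rho> A B x y\<rbrakk>
      \<Longrightarrow> \<exists>x' y'. \<rho> A' B' x' y' \<and> Fm f g (N A B #>\<^bsub>G A B\<^esub> x) = N A' B' #>\<^bsub>G A' B'\<^esub> x' \<and>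
             Fm' f g (L A B #>\<^bsub>H A B\<^esub> y) = L A' B' #>\<^bsub>H A' B'\<^esub> y'"
  shows "\<exists>\<tau>. natural_iso C M F Fm F' Fm' \<tau>"
proof -
  define good where "good A B \<tau> \<longleftrightarrow> \<tau> \<in> iso (G A B Mod N A B) (H A B Mod L A B) \<and>
    (\<forall>x y. \<rho> A B x y \<longrightarrow> \<tau> (N A B #>\<^bsub>G A B\<^esub> x) = L A B #>\<^bsub>H A B\<^esub> y)" for A B \<tau>
  define \<tau> where "\<tau> A B = (SOME \<tau>. good A B \<tau>)" for A B
  have good: "good A B (\<tau> A B)" if AB: "A \<in> cofs M" "B \<in> fibs M" for A B
  proof -
    have "\<exists>t. good A B t" unfolding good_def by (rule coset_rel_iso[OF rel[OF AB]])
    then show ?thesis unfolding \<tau>_def by (rule someI_ex)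
  qed
  have \<tau>: "\<tau> A B \<in> iso (G A B Mod N A B) (H A B Mod L A B)"
    "\<rho> A B x y \<Longrightarrow> \<tau> A B (N A B #>\<^bsub>G A B\<^esub> x) = L A B #>\<^bsub>H A B\<^esub> y" if "A \<in> cofs M" "B \<in> fibs M"
    for A B x y
    using good[OF that] unfolding good_def by blast+
  have "\<tau> A' B' (Fm f g \<xi>) = Fm' f g (\<tau> A B \<xi>)"
    if 1: "A \<in> cofs M" "A' \<in> cofs M" "B \<in> fibs M" "B' \<in> fibs M" "f \<in> Mor C A' A" "g \<in> Mor C B B'"
      and x: "\<xi> \<in> carrier (F A B)"
    for A A' B B' f g \<xi>
  proof -
    obtain x where "x \<in> carrier (G A B)" and x: "\<xi> = N A B #>\<^bsub>G A B\<^esub> x" using x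
      by (auto simp: F1 carrier_FactGroup)
    then obtain y where y: "\<rho> A B x y" using rel[OF 1(1,3)] unfolding coset_rel_def by blast
    from nat[OF 1 y] obtain x' y' where "\<rho> A' B' x' y'"
      "Fm f g (N A B #>\<^bsub>G A B\<^esub> x) = N A' B' #>\<^bsub>G A' B'\<^esub> x'"
       "Fm' f g (L A B #>\<^bsub>H A B\<^esub> y) = L A' B' #>\<^bsub>H A' B'\<^esub> y'" by blast
    then show ?thesis using \<tau>(2)[OF 1(1,3) y] \<tau>(2)[OF 1(2,4)] x by simp
  qed
  then show ?thesis using \<tau>(1) unfolding natural_iso_def F1 F2
    by (intro exI[of _ \<tau>] conjI ballI) blast+
qed

lemma (in comm_group) comm_group_subgroup: "subgroup Z G \<Longrightarrow> comm_group (G\<lparr>carrier := Z\<rparr>)"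
  using subgroup.mem_carrier[of Z G]
  by (intro group.group_comm_groupI subgroup_imp_group) (simp_all add: m_comm)

lemma r_coset_carrier_update [simp]: "N #>\<^bsub>G\<lparr>carrier := Z\<rparr>\<^esub> x = N #>\<^bsub>G\<^esub> x"
  by (simp add: r_coset_def)

section \<open>Cocycles and coboundaries in terms of syzygies\<close>

context model
begin

lemma core_maps_subgroup: "subgroup (core_maps C M x y) (MorGrp C x y)"
proof (rule group.subgroupI[OF grp(2)])
  show "inv\<^bsub>MorGrp C x y\<^esub> f \<in> core_maps C M x y" if "f \<in> core_maps C M x y" for f
    using hneg_core_maps[OF that] MorD(2,3)[OF core_maps_Mor[OF that]] by (simp add: hneg_def)
  show "core_maps C M x y \<noteq> {}" using nul_core_maps by blast
qed (use core_maps_Mor hadd_core_maps in auto)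

lemma stabeq_hadd:
  assumes "f \<approx> g" "f' \<approx> g'" "src C f = src C f'" "tgt C f = tgt C f'" shows "f +. f' \<approx> g +. g'"
proof -
  have a [simp]: "f \<in> arrs C" "g \<in> arrs C" "f' \<in> arrs C" "g' \<in> arrs C" "src C f = src C g'"
    "tgt C f = tgt C g'" "src C g = src C g'" "tgt C g = tgt C g'"
    "src C f' = src C g'" "tgt C f' = tgt C g'"
    using stabeqD[OF assms(1)] stabeqD[OF assms(2)] assms(3,4) by simp_all
  have "(f -. g) +. (f' -. g') \<in> core_maps C M (src C g') (tgt C g')"
    using assms by (intro hadd_core_maps) (simp_all add: stabeq_def)
  moreover have "(f -. g) +. (f' -. g') = (f +. f') -. (g +. g')"
    by (simp add: hsub_def hadd_left_commute[of "hneg C g" f' "hneg C g'"])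
  ultimately show ?thesis by (simp add: stabeq_def)
qed

lemma stabeq_core_maps: "f \<approx> g \<Longrightarrow> f \<in> core_maps C M x y \<longleftrightarrow> g \<in> core_maps C M x y"
proof -
  have "g \<in> core_maps C M x y" if "f \<approx> g" "f \<in> core_maps C M x y" for f g
  proof -
    note [simp] = MorD[OF core_maps_Mor[OF that(2)]]
    have "g -. f \<in> core_maps C M x y" using stabeq_sym[OF that(1)] by (simp add: stabeq_def)
    then have "(g -. f) +. f \<in> core_maps C M x y" using that(2) by (rule hadd_core_maps)
    then show ?thesis using stabeqD[OF that(1)] by simp
  qed
  then show "f \<approx> g \<Longrightarrow> ?thesis" using stabeq_sym by blast
qed

lemma precomp_hom: "e \<in> arrs C \<Longrightarrow>
    group_hom (MorGrp C (tgt C e) B) (MorGrp C (src C e) B) (\<lambda>z. z \<cdot> e)"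
  by (intro group_hom.intro group_hom_axioms.intro grp homI) (simp_all add: Mor_def)

lemma postcomp_hom: "k \<in> arrs C \<Longrightarrow>
    group_hom (MorGrp C A (src C k)) (MorGrp C A (tgt C k)) (\<lambda>z. k \<cdot> z)"
  by (intro group_hom.intro group_hom_axioms.intro grp homI) (simp_all add: Mor_def)

lemma Mor_subgroup: "subgroup (Mor C x y) (MorGrp C x y)"
  using group.subgroup_self[OF grp(2), of x y] by simp

text \<open>The epi \<open>e (n + 1)\<close> cancels from the cocycle equation; what remains says
  that \<open>z\<close> kills \<open>k (n + 1)\<close> and hence descends along
  \<open>e n\<close>.\<close>

lemma lcocycles:
  assumes r: "resolution_factors C M A P k e"
  shows "kernel (lcochains C P B n) (lcochains C P B (n + 1)) (ldiff C P n) =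
      (\<lambda>z. z \<cdot> e n) ` Mor C (tgt C (e n)) B"
proof -
  note [simp] = resolution_factorsD(6-8,10,11)[OF r]
  note s = resolution_factorsD(5)[OF r, of n]
  note [simp] = sesD(3-5)[OF s]
  have k: "kernel (lcochains C P B n) (lcochains C P B (n + 1)) (ldiff C P n) =
    {z \<in> Mor C (ob P n) B. z \<cdot> dif P (n + 1) = nul C (ob P (n + 1)) B}"
    by (auto simp: kernel_def lcochains_def ldiff_def)
  show ?thesis unfolding k resolution_factorsD(4)[OF r]
  proof (intro equalityI subsetI)
    fix z assume "z \<in> {z \<in> Mor C (ob P n) B. z \<cdot> k (n + 1) \<cdot> e (n + 1) = nul C (ob P (n + 1)) B}"
    then have z [simp]: "z \<in> arrs C" "src C z = ob P n" "tgt C z = B"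
      and 0: "z \<cdot> k (n + 1) \<cdot> e (n + 1) = nul C (ob P (n + 1)) B"
      by (auto simp: Mor_def)
    have "z \<cdot> k (n + 1) = nul C (tgt C (e (n + 1))) B"
      by (rule is_epiD[OF resolution_factorsD(13)[OF r, of "n + 1"]]) (simp_all add: 0)
    then obtain z' where "z' \<in> arrs C" "tgt C z' = B" "src C z' = tgt C (e n)" "z' \<cdot> e n = z"
      using ses_colift[OF s, of z] by auto
    then show "z \<in> (\<lambda>z. z \<cdot> e n) ` Mor C (tgt C (e n)) B" by (auto simp: Mor_def)
  next
    fix z assume "z \<in> (\<lambda>z. z \<cdot> e n) ` Mor C (tgt C (e n)) B"
    then show "z \<in> {z \<in> Mor C (ob P n) B. z \<cdot> k (n + 1) \<cdot> e (n + 1) = nul C (ob P (n + 1)) B}"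
      by (auto simp: Mor_def)
  qed
qed

text \<open>A map of the form \<open>z \<cdot> k n\<close> passes through the trivial object
  \<open>ob P (n - 1)\<close>, so it is null. Conversely, a null map extends along
  \<open>k n\<close>, because the cokernel is a cofibrant syzygy.\<close>

lemma lcoboundaries:
  assumes r: "resolution_factors C M A P k e" and A: "A \<in> cofs M" and B: "B \<in> fibs M"
  shows "coboundaries (lcochains C P B) (ldiff C P) n =
      (\<lambda>z. z \<cdot> e n) ` core_maps C M (tgt C (e n)) B"
proof -
  note [simp] = resolution_factorsD(6-8,10,11)[OF r]
  have s: "short_exact C (k n) (e (n - 1))" using resolution_factorsD(5)[OF r, of "n - 1"] by simp
  note c = resolution_factors_cofs[OF r A]
  have k: "coboundaries (lcochains C P B) (ldiff C P) n =
      (\<lambda>z. z \<cdot> k n \<cdot> e n) ` Mor C (ob P (n - 1)) B"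
    by (simp add: coboundaries_def lcochains_def ldiff_def resolution_factorsD(4)[OF r])
  have 1: "z \<cdot> k n \<in> core_maps C M (tgt C (e n)) B" if "z \<in> Mor C (ob P (n - 1)) B" for z
    using null_factor[of "k n" z] that B c[of n] resolution_factorsD(9)[OF r, of "n - 1"]
      by (simp add: Mor_def)
  have 2: "\<exists>t\<in>Mor C (ob P (n - 1)) B. t \<cdot> k n = z" if z: "z \<in> core_maps C M (tgt C (e n)) B" for z
  proof -
    obtain t where t: "t \<in> core_maps C M (tgt C (k n)) B" "t \<cdot> k n = z"
      by (rule core_maps_extend[OF z s]) (simp_all add: c)
    then show ?thesis using core_maps_Mor[OF t(1)] by auto
  qed
  have "(\<lambda>z. z \<cdot> k n \<cdot> e n) ` Mor C (ob P (n - 1)) B =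
      (\<lambda>z. z \<cdot> e n) ` (\<lambda>z. z \<cdot> k n) ` Mor C (ob P (n - 1)) B"
    by (auto simp: image_image Mor_def)
  also have "(\<lambda>z. z \<cdot> k n) ` Mor C (ob P (n - 1)) B = core_maps C M (tgt C (e n)) B" using 1 2
    by blast
  finally show ?thesis using k by simp
qed

text \<open>Cochain degree \<open>n\<close> sits at chain index \<open>- n - 1\<close>, and the mono
  into that term is \<open>k (- n)\<close>; hence the syzygy that carries the cocycles has index
  \<open>- n\<close>.\<close>

lemma rcocycles:
  assumes r: "resolution_factors C M B (reindex T) k e"
  shows "kernel (rcochains C A T n) (rcochains C A T (n + 1)) (rdiff C T n) =
      (\<lambda>z. k (- n) \<cdot> z) ` Mor C A (tgt C (e (- n)))"
proof -
  note [simp] = resolution_factorsD(6-8,10,11)[OF r]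
  have s: "short_exact C (k (- n)) (e (- n - 1))" using resolution_factorsD(5)[OF r, of "- n - 1"]
    by simp
  note [simp] = sesD(4,5)[OF s]
  have T: "ob T n = ob (reindex T) (- n - 1)" "ob T (n + 1) = ob (reindex T) (- n - 1 - 1)"
    "dif T n = dif (reindex T) (- n - 1)"
    by (simp_all add: reindex_def add.commute)
  have k: "kernel (rcochains C A T n) (rcochains C A T (n + 1)) (rdiff C T n) =
    {z \<in> Mor C A (ob (reindex T) (- n - 1)). k (- n - 1) \<cdot> e (- n - 1) \<cdot> z = nul C A (ob (reindex T)
      (- n - 1 - 1))}"
    by (auto simp: kernel_def rcochains_def rdiff_def T resolution_factorsD(4)[OF r] Mor_def)
  show ?thesis unfolding k
  proof (intro equalityI subsetI)
    fix z assume "z \<in> {z \<in> Mor C A (ob (reindex T) (- n - 1)). k (- n - 1) \<cdot> e (- n - 1) \<cdot> z =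
        nul C A (ob (reindex T) (- n - 1 - 1))}"
    then have z [simp]: "z \<in> arrs C" "src C z = A" "tgt C z = ob (reindex T) (- n - 1)"
      and 0: "k (- n - 1) \<cdot> e (- n - 1) \<cdot> z = nul C A (ob (reindex T) (- n - 1 - 1))"
      by (auto simp: Mor_def)
    have "e (- n - 1) \<cdot> z = nul C A (tgt C (e (- n - 1)))"
      by (rule is_monoD[OF resolution_factorsD(12)[OF r, of "- n - 1"]]) (simp_all add: 0)
    then obtain z' where "z' \<in> arrs C" "src C z' = A" "tgt C z' = tgt C (e (- n))"
      "k (- n) \<cdot> z' = z"
      using ses_lift[OF s, of z] by auto
    then show "z \<in> (\<lambda>z. k (- n) \<cdot> z) ` Mor C A (tgt C (e (- n)))" by (auto simp: Mor_def)
  next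
    fix z assume "z \<in> (\<lambda>z. k (- n) \<cdot> z) ` Mor C A (tgt C (e (- n)))"
    then show "z \<in> {z \<in> Mor C A (ob (reindex T) (- n - 1)). k (- n - 1) \<cdot> e (- n - 1) \<cdot> z =
        nul C A (ob (reindex T) (- n - 1 - 1))}"
      by (auto simp: Mor_def)
  qed
qed

lemma rcoboundaries:
  assumes r: "resolution_factors C M B (reindex T) k e" and A: "A \<in> cofs M" and B: "B \<in> fibs M"
  shows "coboundaries (rcochains C A T) (rdiff C T) n =
      (\<lambda>z. k (- n) \<cdot> z) ` core_maps C M A (tgt C (e (- n)))"
proof -
  note [simp] = resolution_factorsD(6-8,10,11)[OF r]
  note s = resolution_factorsD(5)[OF r, of "- n"]
  note c = resolution_factors_fibs[OF r B]
  have T: "ob T (n - 1) = ob (reindex T) (- n)" "dif T (n - 1) = dif (reindex T) (- n)"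
    by (simp_all add: reindex_def)
  have k: "coboundaries (rcochains C A T) (rdiff C T) n =
      (\<lambda>z. k (- n) \<cdot> e (- n) \<cdot> z) ` Mor C A (ob (reindex T) (- n))"
    by (auto simp: coboundaries_def rcochains_def rdiff_def T resolution_factorsD(4)[OF r]
      Mor_def image_def)
  have 1: "e (- n) \<cdot> z \<in> core_maps C M A (tgt C (e (- n)))" if "z \<in> Mor C A (ob (reindex T) (- n))"
    for z
    using null_factor[of z "e (- n)"] that A c[of "- n"] resolution_factorsD(9)[OF r, of "- n"]
      by (simp add: Mor_def)
  have 2: "\<exists>t\<in>Mor C A (ob (reindex T) (- n)). e (- n) \<cdot> t = z"
    if z: "z \<in> core_maps C M A (tgt C (e (- n)))" for z
  proof -
    have "src C (k (- n + 1)) \<in> fibs M" using c[of "- n + 1"] by simp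
    then obtain t where t: "t \<in> core_maps C M A (tgt C (k (- n + 1)))" "e (- n) \<cdot> t = z"
      using core_maps_lift[OF z s] by auto
    then show ?thesis using core_maps_Mor[OF t(1)] by auto
  qed
  have "(\<lambda>z. k (- n) \<cdot> e (- n) \<cdot> z) ` Mor C A (ob (reindex T) (- n)) =
      (\<lambda>z. k (- n) \<cdot> z) ` (\<lambda>z. e (- n) \<cdot> z) ` Mor C A (ob (reindex T) (- n))"
    by (simp add: image_image)
  also have "(\<lambda>z. e (- n) \<cdot> z) ` Mor C A (ob (reindex T) (- n)) = core_maps C M A (tgt C (e (- n)))"
    using 1 2 by blast
  finally show ?thesis using k by simp
qed

lemma coset_shift:
  assumes "subgroup N (MorGrp C x y)" "f -. g \<in> N" "f \<in> Mor C x y" "g \<in> Mor C x y"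
  shows "N #>\<^bsub>MorGrp C x y\<^esub> f = N #>\<^bsub>MorGrp C x y\<^esub> g"
proof -
  have "f \<in> N #>\<^bsub>MorGrp C x y\<^esub> g"
    unfolding r_coset_def using assms(2-4) by (auto intro!: bexI[of _ "f -. g"] simp: Mor_def)
  then show ?thesis using group.repr_independence[OF grp(2) _ _ assms(1)] assms(4) by simp
qed

end

section \<open>The natural isomorphisms\<close>

locale model_ext = model_loop +
  fixes P T :: "'a \<Rightarrow> ('a, 'b) zcomplex"
  assumes res: "M_resolution C M A (P A)" and cores: "M_coresolution C M B (T B)"
begin

definition lfac :: "'a \<Rightarrow> (int \<Rightarrow> 'b) \<times> (int \<Rightarrow> 'b)" where
  "lfac A = (SOME ke. resolution_factors C M A (P A) (fst ke) (snd ke))"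

definition rfac :: "'a \<Rightarrow> (int \<Rightarrow> 'b) \<times> (int \<Rightarrow> 'b)" where
  "rfac B = (SOME ke. resolution_factors C M B (reindex (T B)) (fst ke) (snd ke))"

abbreviation "lk A \<equiv> fst (lfac A)"
abbreviation "lp A \<equiv> snd (lfac A)"
abbreviation "rk B \<equiv> fst (rfac B)"
abbreviation "rp B \<equiv> snd (rfac B)"

lemma lfac: "resolution_factors C M A (P A) (lk A) (lp A)"
proof -
  obtain k e where "resolution_factors C M A (P A) (fst (k, e)) (snd (k, e))"
    using resolution_factors_exist[OF res[of A]] by auto
  then show ?thesis unfolding lfac_def by (rule someI)
qed

lemma rfac: "resolution_factors C M B (reindex (T B)) (rk B) (rp B)"
proof -
  obtain k e where "resolution_factors C M B (reindex (T B)) (fst (k, e)) (snd (k, e))"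
    using resolution_factors_exist[OF cores[of B, unfolded M_coresolution_def]] by auto
  then show ?thesis unfolding rfac_def by (rule someI)
qed

abbreviation "la A \<equiv> (\<lambda>i. lk A (i + 1))"
abbreviation "ra B \<equiv> (\<lambda>i. rk B (i + 1))"

lemmas lzseq = resolution_factors_zseq[OF lfac]
lemmas rzseq = resolution_factors_zseq[OF rfac]
lemmas lcofs = resolution_factors_cofs[OF lfac]
lemmas rfibs = resolution_factors_fibs[OF rfac]

lemma bb_fibs: "tgt C (bb A n) \<in> fibs M" and bb_cofs: "tgt C (bb A n) \<in> cofs M"
  by simp_all

text \<open>A unit from \<open>A\<close> to \<open>RQ A\<close>, prolonged to all degrees: the
  component at \<open>n\<close> compares the \<open>n\<close>-th syzygy of \<open>A\<close> with the
  replaced object \<open>Om n A\<close>.\<close>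

definition wfam :: "'a \<Rightarrow> int \<Rightarrow> 'b" where
  "wfam A = (SOME w. zmap (la A) (lp A) (ba A) (bb A) w \<and> unit_map A (w 0))"

text \<open>A counit from \<open>RQ B\<close> to \<open>B\<close>, prolonged to all degrees; the
  component at \<open>- n\<close> reaches the syzygy that carries the cocycles of degree
  \<open>n\<close> in the coresolution.\<close>

definition yfam :: "'a \<Rightarrow> int \<Rightarrow> 'b" where
  "yfam B = (SOME y. zmap (ba B) (bb B) (ra B) (rp B) y \<and> counit_map B (y 0))"

lemma wfam:
  assumes "A \<in> cofs M" shows "zmap (la A) (lp A) (ba A) (bb A) (wfam A)" "unit_map A (wfam A 0)"
proof -
  obtain m where m: "unit_map A m" using unit_map_exists[OF assms] by blast
  have "m \<in> Mor C (tgt C (lp A 0)) (tgt C (bb A 0))"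
    using unit_map_Mor[OF m] resolution_factorsD(3)[OF lfac] by simp
  then obtain w where "zmap (la A) (lp A) (ba A) (bb A) w" "w 0 = m"
    using zmap_exists[OF lzseq bif_zseq lcofs[OF assms] bb_fibs] by blast
  then have "\<exists>w. zmap (la A) (lp A) (ba A) (bb A) w \<and> unit_map A (w 0)" using m by blast
  from someI_ex[OF this] show "zmap (la A) (lp A) (ba A) (bb A) (wfam A)" "unit_map A (wfam A 0)"
    unfolding wfam_def by blast+
qed

lemma yfam:
  assumes "B \<in> fibs M" shows "zmap (ba B) (bb B) (ra B) (rp B) (yfam B)" "counit_map B (yfam B 0)"
proof -
  obtain q where q: "counit_map B q" using counit_map_exists[OF assms] by blast
  have "q \<in> Mor C (tgt C (bb B 0)) (tgt C (rp B 0))"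
    using counit_map_Mor[OF q] resolution_factorsD(3)[OF rfac] by simp
  then obtain y where "zmap (ba B) (bb B) (ra B) (rp B) y" "y 0 = q"
    using zmap_exists[OF bif_zseq rzseq bb_cofs rfibs[OF assms]] by blast
  then have "\<exists>y. zmap (ba B) (bb B) (ra B) (rp B) y \<and> counit_map B (y 0)" using q by blast
  from someI_ex[OF this] show "zmap (ba B) (bb B) (ra B) (rp B) (yfam B)" "counit_map B (yfam B 0)"
    unfolding yfam_def by blast+
qed

lemma wfam_arr:
  assumes "A \<in> cofs M"
  shows "wfam A n \<in> arrs C" "src C (wfam A n) = tgt C (lp A n)" "tgt C (wfam A n) = RQ (Om n A)"
  using zmapD(2)[OF wfam(1)[OF assms], of n] by (simp_all add: Mor_def)

lemma yfam_arr:
  assumes "B \<in> fibs M"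
  shows "yfam B n \<in> arrs C" "src C (yfam B n) = RQ (Om n B)" "tgt C (yfam B n) = tgt C (rp B n)"
  using zmapD(2)[OF yfam(1)[OF assms], of n] by (simp_all add: Mor_def)

lemma wfam_pre_equiv: assumes "A \<in> cofs M" shows "pre_equiv (wfam A n)"
  using pre_equiv_zmap[OF lzseq bif_zseq lcofs[OF assms] bb_cofs wfam(1)[OF assms]
    unit_map_pre_equiv[OF wfam(2)[OF assms]]] .

lemma yfam_post_equiv: assumes "B \<in> fibs M" shows "post_equiv (yfam B n)"
  using post_equiv_zmap[OF bif_zseq rzseq bb_fibs rfibs[OF assms] yfam(1)[OF assms]
    counit_map_post_equiv[OF yfam(2)[OF assms] assms]] .

text \<open>Cancellation of \<open>y\<close> is tested on the cofibrant \<open>src C w\<close>, that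
  of \<open>w\<close> on the fibrant \<open>src C y\<close>. With \<open>sandwich_surj\<close> this
  makes sandwiching bijective on stable classes.\<close>

lemma sandwich_null:
  assumes "pre_equiv w" "post_equiv y" "tgt C w \<in> cofs M" "src C w \<in> cofs M" "tgt C y \<in> fibs M"
    "src C y \<in> fibs M"
    and [simp]: "w \<in> arrs C" "y \<in> arrs C" and h: "h \<in> Mor C (tgt C w) (src C y)"
  shows "y \<cdot> (h \<cdot> w) \<in> core_maps C M (src C w) (tgt C y) \<longleftrightarrow> h \<in> core_maps C M (tgt C w) (src C y)"
proof
  note [simp] = MorD[OF h]
  assume "y \<cdot> (h \<cdot> w) \<in> core_maps C M (src C w) (tgt C y)"
  moreover have "h \<cdot> w \<in> Mor C (src C w) (src C y)" by (simp add: Mor_def)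
  ultimately have "h \<cdot> w \<in> core_maps C M (src C w) (src C y)"
    using assms(2,4) unfolding post_equiv_def by blast
  then show "h \<in> core_maps C M (tgt C w) (src C y)" using assms(1,6) h unfolding pre_equiv_def
    by blast
next
  assume "h \<in> core_maps C M (tgt C w) (src C y)"
  then show "y \<cdot> (h \<cdot> w) \<in> core_maps C M (src C w) (tgt C y)"
    by (intro core_maps_cmp_left[of _ _ "src C y"] core_maps_cmp_right[of _ "tgt C w"]) simp_all
qed

lemma sandwich_surj:
  assumes "pre_equiv w" "post_equiv y" "tgt C w \<in> cofs M" "src C w \<in> cofs M" "tgt C y \<in> fibs M"
    "src C y \<in> fibs M"
    and [simp]: "w \<in> arrs C" "y \<in> arrs C" and z: "z \<in> Mor C (src C w) (tgt C y)"
  obtains h where "h \<in> Mor C (tgt C w) (src C y)" "y \<cdot> (h \<cdot> w) \<approx> z"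
proof -
  obtain z1 where z1: "z1 \<in> Mor C (src C w) (src C y)" "y \<cdot> z1 \<approx> z"
    using assms(2,4) z unfolding post_equiv_def by blast
  obtain h where h: "h \<in> Mor C (tgt C w) (src C y)" "h \<cdot> w \<approx> z1"
    using assms(1,6) z1(1) unfolding pre_equiv_def by blast
  have "y \<cdot> (h \<cdot> w) \<approx> y \<cdot> z1" by (rule stabeq_cmp_left[OF h(2)]) (simp_all add: MorD[OF z1(1)])
  also note z1(2)
  finally show ?thesis using h(1) that by blast
qed

section \<open>Correspondences between cocycles and stable maps\<close>

definition lgrp :: "int \<Rightarrow> 'a \<Rightarrow> 'a \<Rightarrow> 'b monoid" where
  "lgrp n A B = (lcochains C (P A) B n)\<lparr>carrier :=
      kernel (lcochains C (P A) B n) (lcochains C (P A) B (n + 1)) (ldiff C (P A) n)\<rparr>"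

definition rgrp :: "int \<Rightarrow> 'a \<Rightarrow> 'a \<Rightarrow> 'b monoid" where
  "rgrp n A B = (rcochains C A (T B) n)\<lparr>carrier :=
      kernel (rcochains C A (T B) n) (rcochains C A (T B) (n + 1)) (rdiff C (T B) n)\<rparr>"

definition lbd :: "int \<Rightarrow> 'a \<Rightarrow> 'a \<Rightarrow> 'b set" where
  "lbd n A B = coboundaries (lcochains C (P A) B) (ldiff C (P A)) n"

definition rbd :: "int \<Rightarrow> 'a \<Rightarrow> 'a \<Rightarrow> 'b set" where
  "rbd n A B = coboundaries (rcochains C A (T B)) (rdiff C (T B)) n"

lemma lgrp: "lgrp n A B = (MorGrp C (ob (P A) n) B)\<lparr>carrier :=
    (\<lambda>z. z \<cdot> lp A n) ` Mor C (tgt C (lp A n)) B\<rparr>"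
  unfolding lgrp_def lcocycles[OF lfac] by (simp add: lcochains_def)

lemma rgrp: "rgrp n A B = (MorGrp C A (ob (T B) n))\<lparr>carrier :=
    (\<lambda>z. rk B (- n) \<cdot> z) ` Mor C A (tgt C (rp B (- n)))\<rparr>"
  unfolding rgrp_def rcocycles[OF rfac] by (simp add: rcochains_def)

lemma lbd: "\<lbrakk>A \<in> cofs M; B \<in> fibs M\<rbrakk> \<Longrightarrow>
    lbd n A B = (\<lambda>z. z \<cdot> lp A n) ` core_maps C M (tgt C (lp A n)) B"
  unfolding lbd_def by (rule lcoboundaries[OF lfac])

lemma rbd: "\<lbrakk>A \<in> cofs M; B \<in> fibs M\<rbrakk> \<Longrightarrow>
    rbd n A B = (\<lambda>z. rk B (- n) \<cdot> z) ` core_maps C M A (tgt C (rp B (- n)))"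
  unfolding rbd_def by (rule rcoboundaries[OF rfac])

lemma lp_arr [simp]: "lp A n \<in> arrs C" "src C (lp A n) = ob (P A) n"
  using resolution_factorsD[OF lfac] by blast+

lemma rk_arr [simp]: "rk B (- n) \<in> arrs C" "tgt C (rk B (- n)) = ob (T B) n"
  "src C (rk B (- n)) = tgt C (rp B (- n))"
  using resolution_factorsD(7,8,10)[OF rfac] by (simp_all add: reindex_def)

lemma lp_cancel: "\<lbrakk>z \<cdot> lp A n =
    z' \<cdot> lp A n; z \<in> Mor C (tgt C (lp A n)) B; z' \<in> Mor C (tgt C (lp A n)) B\<rbrakk> \<Longrightarrow> z = z'"
  by (rule is_epiD[OF resolution_factorsD(13)[OF lfac]]) (simp_all add: Mor_def)

lemma rk_cancel: "\<lbrakk>rk B (- n) \<cdot> z =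
    rk B (- n) \<cdot> z'; z \<in> Mor C A (tgt C (rp B (- n))); z' \<in> Mor C A (tgt C (rp B (- n)))\<rbrakk> \<Longrightarrow> z = z'"
  by (rule is_monoD[OF resolution_factorsD(12)[OF rfac]])
    (simp_all add: Mor_def resolution_factorsD(8)[OF rfac])

lemma lbd_subgroup:
  assumes "A \<in> cofs M" "B \<in> fibs M" shows "subgroup (lbd n A B) (MorGrp C (ob (P A) n) B)"
  using group_hom.subgroup_img_is_subgroup[OF precomp_hom[OF lp_arr(1)] core_maps_subgroup,
    of A n B] unfolding lbd[OF assms] by simp

lemma rbd_subgroup:
  assumes "A \<in> cofs M" "B \<in> fibs M" shows "subgroup (rbd n A B) (MorGrp C A (ob (T B) n))"
  using group_hom.subgroup_img_is_subgroup[OF postcomp_hom[OF rk_arr(1)], of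
    "core_maps C M A (tgt C (rp B (- n)))" A] core_maps_subgroup
  unfolding rbd[OF assms] by simp

text \<open>A given cocycle is reached by sandwiching only up to null maps, hence
  \<open>\<approx>\<close> in place of equality; \<open>yfam B 0\<close> is the counit.\<close>

definition lrel :: "int \<Rightarrow> 'a \<Rightarrow> 'a \<Rightarrow> 'b \<Rightarrow> 'b \<Rightarrow> bool" where
  "lrel n A B z h \<longleftrightarrow> h \<in> Mor C (RQ (Om n A)) (RQ B) \<and> (\<exists>z'. z = z' \<cdot> lp A n \<and>
      z' \<approx> yfam B 0 \<cdot> (h \<cdot> wfam A n))"

text \<open>Shifting the family of \<open>A\<close> by \<open>n\<close> puts \<open>Om n A\<close>
  at index 0 and \<open>A\<close> itself at index \<open>- n\<close>. Read at these two indices, one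
  morphism to the family of \<open>B\<close> yields both sides of the middle isomorphism.\<close>

definition mrel :: "int \<Rightarrow> 'a \<Rightarrow> 'a \<Rightarrow> 'b \<Rightarrow> 'b \<Rightarrow> bool" where
  "mrel n A B h h' \<longleftrightarrow> (\<exists>\<phi>. zmap (\<lambda>i. ba A (i + n)) (\<lambda>i. bb A (i + n)) (ba B) (bb B) \<phi> \<and> h \<approx> \<phi> 0 \<and>
      h' \<approx> \<phi> (- n))"

definition rrel :: "int \<Rightarrow> 'a \<Rightarrow> 'a \<Rightarrow> 'b \<Rightarrow> 'b \<Rightarrow> bool" where
  "rrel n A B h z \<longleftrightarrow> h \<in> Mor C (RQ A) (RQ (Om (- n) B)) \<and> (\<exists>z'. z = rk B (- n) \<cdot> z' \<and>
      z' \<approx> yfam B (- n) \<cdot> (h \<cdot> wfam A 0))"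

lemma rp_0 [simp]: "tgt C (rp B 0) = B" and lp_0 [simp]: "tgt C (lp A 0) = A"
  using resolution_factorsD(3) lfac rfac by blast+

text \<open>\<open>\<iota>\<close> stands for precomposition with the epi \<open>lp A n\<close> or
  postcomposition with the mono \<open>rk B (- n)\<close>, which turn maps out of or into a syzygy
  into cocycles; so one argument serves both outer isomorphisms.\<close>

lemma sandwich_coset_rel:
  assumes sw: "pre_equiv w" "post_equiv y" "tgt C w \<in> cofs M" "src C w \<in> cofs M" "tgt C y \<in> fibs M"
    "src C y \<in> fibs M"
      "w \<in> arrs C" "y \<in> arrs C"
    and hom: "group_hom (MorGrp C (src C w) (tgt C y)) (MorGrp C a b) \<iota>"
      and inj: "inj_on \<iota> (Mor C (src C w) (tgt C y))"
  shows "coset_rel ((MorGrp C a b)\<lparr>carrier :=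
      \<iota> ` Mor C (src C w) (tgt C y)\<rparr>) (\<iota> ` core_maps C M (src C w) (tgt C y))
    (MorGrp C (tgt C w) (src C y)) (core_maps C M (tgt C w) (src C y))
    (\<lambda>z h. h \<in> Mor C (tgt C w) (src C y) \<and> (\<exists>z'. z = \<iota> z' \<and> z' \<approx> y \<cdot> (h \<cdot> w)))"
    (is "coset_rel ?G ?A ?H ?B ?\<rho>")
proof -
  define \<rho> where "\<rho> = ?\<rho>"
  interpret \<iota>: group_hom "MorGrp C (src C w) (tgt C y)" "MorGrp C a b" \<iota> by (rule hom)
  note [simp] = sw(7,8)
  have Z: "subgroup (\<iota> ` Mor C (src C w) (tgt C y)) (MorGrp C a b)"
    by (rule \<iota>.subgroup_img_is_subgroup[OF Mor_subgroup])
  have mor: "z \<in> Mor C (src C w) (tgt C y)" if "h \<in> Mor C (tgt C w) (src C y)" "z \<approx> y \<cdot> (h \<cdot> w)"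
    for z h
    using stabeqD[OF that(2)] MorD[OF that(1)] by (simp add: Mor_def)
  have "coset_rel ?G ?A ?H ?B \<rho>"
    unfolding coset_rel_def
  proof (intro conjI allI impI ballI)
    show "comm_group ?G" by (rule comm_group.comm_group_subgroup[OF grp(1) Z])
    show "subgroup ?A ?G"
      by (rule group.subgroup_incl[OF grp(2) \<iota>.subgroup_img_is_subgroup[OF core_maps_subgroup] Z])
        (use core_maps_Mor in auto)
  next
    fix z h assume "\<rho> z h"
    then obtain z' where h: "h \<in> Mor C (tgt C w) (src C y)" and z: "z = \<iota> z'" "z' \<approx> y \<cdot> (h \<cdot> w)"
      by (auto simp: \<rho>_def)
    show "z \<in> carrier ?G" "h \<in> carrier ?H" using mor[OF h z(2)] z(1) h by simp_all
    have "z \<in> ?A \<longleftrightarrow> z' \<in> core_maps C M (src C w) (tgt C y)"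
      unfolding z(1) by (rule inj_on_image_mem_iff[OF inj mor[OF h z(2)]])
        (use core_maps_Mor in blast)
    also have "\<dots> \<longleftrightarrow> h \<in> ?B"
      unfolding stabeq_core_maps[OF z(2)] by (rule sandwich_null[OF sw h])
    finally show "z \<in> ?A \<longleftrightarrow> h \<in> ?B" .
  next
    fix z h x g assume "\<rho> z h" "\<rho> x g"
    then obtain z' x' where h: "h \<in> Mor C (tgt C w) (src C y)" and z: "z = \<iota> z'" "z' \<approx> y \<cdot> (h \<cdot> w)"
      and g: "g \<in> Mor C (tgt C w) (src C y)" and x: "x = \<iota> x'" "x' \<approx> y \<cdot> (g \<cdot> w)" unfolding \<rho>_def
        by blast
    note [simp] = MorD[OF h] MorD[OF g] MorD[OF mor[OF h z(2)]] MorD[OF mor[OF g x(2)]]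
    have "z' +. x' \<approx> y \<cdot> (h \<cdot> w) +. y \<cdot> (g \<cdot> w)"
      by (rule stabeq_hadd[OF z(2) x(2)]) simp_all
    then show "\<rho> (z \<otimes>\<^bsub>?G\<^esub> x) (h \<otimes>\<^bsub>?H\<^esub> g)"
      unfolding \<rho>_def using \<iota>.hom_mult[of z' x'] mor[OF h z(2)] mor[OF g x(2)]
      by (intro conjI exI[of _ "z' +. x'"]) (simp_all add: Mor_def z(1) x(1))
  next
    fix z assume "z \<in> carrier ?G"
    then obtain z' where z': "z' \<in> Mor C (src C w) (tgt C y)" "z = \<iota> z'" by auto
    obtain h where "h \<in> Mor C (tgt C w) (src C y)" "y \<cdot> (h \<cdot> w) \<approx> z'"
      by (rule sandwich_surj[OF sw z'(1)])
    then show "\<exists>h. \<rho> z h" unfolding \<rho>_def using z' stabeq_sym by blast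
  next
    fix h assume "h \<in> carrier ?H"
    then have h: "h \<in> Mor C (tgt C w) (src C y)" by simp
    have "y \<cdot> (h \<cdot> w) \<in> arrs C" using MorD[OF h] by simp
    then show "\<exists>z. \<rho> z h" unfolding \<rho>_def using h stabeq_refl by blast
  qed (use grp(1) core_maps_subgroup in simp_all)
  then show ?thesis unfolding \<rho>_def .
qed

lemma lrel_coset_rel:
  assumes A: "A \<in> cofs M" and B: "B \<in> fibs M"
  shows "coset_rel (lgrp n A B) (lbd n A B) (MorGrp C (RQ (Om n A)) (RQ B)) (core_maps C M (RQ (Om n
      A)) (RQ B)) (lrel n A B)"
proof -
  note [simp] = wfam_arr[OF A] yfam_arr[OF B]
  have "inj_on (\<lambda>z. z \<cdot> lp A n) (Mor C (tgt C (lp A n)) B)" by (rule inj_onI) (rule lp_cancel)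
  then show ?thesis
    using sandwich_coset_rel[OF wfam_pre_equiv[OF A, of n] yfam_post_equiv[OF B, of 0], of
      "ob (P A) n" B "\<lambda>z. z \<cdot> lp A n"]
      precomp_hom[OF lp_arr(1), of A n B] lcofs[OF A] B unfolding lgrp lbd[OF A B] lrel_def[abs_def]
        by simp
qed

lemma rrel_coset_rel:
  assumes A: "A \<in> cofs M" and B: "B \<in> fibs M"
  shows "coset_rel (MorGrp C (RQ A) (RQ (Om (- n) B))) (core_maps C M (RQ A) (RQ (Om (- n) B)))
      (rgrp n A B) (rbd n A B) (rrel n A B)"
proof (rule coset_rel_sym)
  note [simp] = wfam_arr[OF A] yfam_arr[OF B]
  have "inj_on (\<lambda>z. rk B (- n) \<cdot> z) (Mor C A (tgt C (rp B (- n))))"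
    by (rule inj_onI) (rule rk_cancel)
  then show "coset_rel (rgrp n A B) (rbd n A B) (MorGrp C (RQ A) (RQ (Om (- n) B))) (core_maps C M
      (RQ A) (RQ (Om (- n) B))) (\<lambda>z h. rrel n A B h z)"
    using sandwich_coset_rel[OF wfam_pre_equiv[OF A, of 0] yfam_post_equiv[OF B, of "- n"], of A
      "ob (T B) n" "\<lambda>z. rk B (- n) \<cdot> z"]
      postcomp_hom[OF rk_arr(1), of A B n] rfibs[OF B] A unfolding rgrp rbd[OF A B] rrel_def by simp
qed

lemma mrel_coset_rel:
  "coset_rel (MorGrp C (RQ (Om n A)) (RQ B)) (core_maps C M (RQ (Om n A)) (RQ B))
     (MorGrp C (RQ A) (RQ (Om (- n) B))) (core_maps C M (RQ A) (RQ (Om (- n) B))) (mrel n A B)"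
proof -
  let ?a = "\<lambda>i. ba A (i + n)" and ?b = "\<lambda>i. bb A (i + n)"
  note z = zseq_shift[OF bif_zseq, of A n] and z' = bif_zseq[of B]
  have Q: "tgt C (?b i) \<in> cofs M" for i by simp
  have mor: "\<phi> 0 \<in> Mor C (RQ (Om n A)) (RQ B)" "\<phi> (- n) \<in> Mor C (RQ A) (RQ (Om (- n) B))"
    if "zmap ?a ?b (ba B) (bb B) \<phi>" for \<phi>
    using zmapD(2)[OF that, of 0] zmapD(2)[OF that, of "- n"] by simp_all
  have eqM: "h \<in> Mor C x y" if "h \<approx> g" "g \<in> Mor C x y" for h g x y
    using stabeqD[OF that(1)] MorD[OF that(2)] by (simp add: Mor_def)
  show ?thesis
    unfolding coset_rel_def
  proof (intro conjI allI impI ballI)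
    fix h h' assume "mrel n A B h h'"
    then obtain \<phi> where f: "zmap ?a ?b (ba B) (bb B) \<phi>" "h \<approx> \<phi> 0" "h' \<approx> \<phi> (- n)"
      by (auto simp: mrel_def)
    show "h \<in> carrier (MorGrp C (RQ (Om n A)) (RQ B))"
      "h' \<in> carrier (MorGrp C (RQ A) (RQ (Om (- n) B)))"
      using eqM f mor[OF f(1)] by simp_all
    show "h \<in> core_maps C M (RQ (Om n A)) (RQ B) \<longleftrightarrow> h' \<in> core_maps C M (RQ A) (RQ (Om (- n) B))"
      unfolding stabeq_core_maps[OF f(2)] stabeq_core_maps[OF f(3)]
      using zmap_null[OF z z' Q bb_fibs f(1), of 0 "- n"] zmap_null[OF z z' Q bb_fibs f(1), of
        "- n" 0] by auto
  next
    fix h h' g g' assume "mrel n A B h h'" "mrel n A B g g'"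
    then obtain \<phi> \<psi> where f: "zmap ?a ?b (ba B) (bb B) \<phi>" "h \<approx> \<phi> 0" "h' \<approx> \<phi> (- n)"
      and g: "zmap ?a ?b (ba B) (bb B) \<psi>" "g \<approx> \<psi> 0" "g' \<approx> \<psi> (- n)" by (auto simp: mrel_def)
    have "h +. g \<approx> \<phi> 0 +. \<psi> 0" "h' +. g' \<approx> \<phi> (- n) +. \<psi> (- n)"
      using MorD[OF eqM[OF f(2) mor(1)[OF f(1)]]] MorD[OF eqM[OF g(2) mor(1)[OF g(1)]]]
        MorD[OF eqM[OF f(3) mor(2)[OF f(1)]]] MorD[OF eqM[OF g(3) mor(2)[OF g(1)]]]
      by (auto intro!: stabeq_hadd f g)
    then show "mrel n A B (h \<otimes>\<^bsub>MorGrp C (RQ (Om n A)) (RQ B)\<^esub> g) (h' \<otimes>\<^bsub>MorGrp C (RQ A) (RQ (Om (- n)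
        B))\<^esub> g')"
      unfolding mrel_def using zmap_hadd[OF z z' f(1) g(1)]
        by (intro exI[of _ "\<lambda>i. \<phi> i +. \<psi> i"]) simp
  next
    fix h assume "h \<in> carrier (MorGrp C (RQ (Om n A)) (RQ B))"
    then have h: "h \<in> Mor C (tgt C (?b 0)) (tgt C (bb B 0))" by simp
    obtain \<phi> where "zmap ?a ?b (ba B) (bb B) \<phi>" "\<phi> 0 = h" by (rule zmap_exists[OF z z' Q bb_fibs h])
    then show "\<exists>h'. mrel n A B h h'" unfolding mrel_def
      using stabeq_refl MorD(1)[OF mor(1)] MorD(1)[OF mor(2)] by blast
  next
    fix h assume "h \<in> carrier (MorGrp C (RQ A) (RQ (Om (- n) B)))"
    then have h: "h \<in> Mor C (tgt C (?b (- n))) (tgt C (bb B (- n)))" by simp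
    obtain \<phi> where "zmap ?a ?b (ba B) (bb B) \<phi>" "\<phi> (- n) = h"
      by (rule zmap_exists[OF z z' Q bb_fibs h])
    then show "\<exists>h'. mrel n A B h' h" unfolding mrel_def
      using stabeq_refl MorD(1)[OF mor(1)] MorD(1)[OF mor(2)] by blast
  qed (use grp(1) core_maps_subgroup in simp_all)
qed

section \<open>Naturality of the correspondences\<close>

lemma bifibrant_lifts_Mor: "\<lbrakk>f \<in> Mor C A B; f'' \<in> bifibrant_lifts C K f\<rbrakk> \<Longrightarrow>
    f'' \<in> Mor C (RQ A) (RQ B)"
  using MorD[of f C A B] by (simp add: bifibrant_lifts_def Let_def)

lemma lift_family:
  assumes "f \<in> Mor C A' A"
  obtains \<phi> where "zmap (ba A') (bb A') (ba A) (bb A) \<phi>" "\<phi> 0 \<in> bifibrant_lifts C K f"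
proof -
  obtain f'' where f'': "f'' \<in> bifibrant_lifts C K f" using bifibrant_lift_exists[OF assms] by blast
  then have "f'' \<in> Mor C (tgt C (bb A' 0)) (tgt C (bb A 0))"
    using MorD[OF assms] by (simp add: bifibrant_lifts_def Let_def)
  then show ?thesis using zmap_exists[OF bif_zseq bif_zseq bb_cofs bb_fibs] that f'' by metis
qed

lemma zmap_bb_Mor: "zmap (ba A') (bb A') (ba A) (bb A) \<phi> \<Longrightarrow> \<phi> n \<in> Mor C (RQ (Om n A')) (RQ (Om n A))"
  using zmapD(2)[of "ba A'" "bb A'" "ba A" "bb A" \<phi> n] by simp

text \<open>Both sides are morphisms of families from the syzygies of \<open>A'\<close> to the loop
  family of \<open>A\<close>. They agree at 0 by naturality of the unit, hence everywhere.\<close>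

lemma wfam_natural:
  assumes "A \<in> cofs M" "A' \<in> cofs M" "f \<in> Mor C A' A" "zmap (ba A') (bb A') (ba A) (bb A) \<phi>"
    "\<phi> 0 \<in> bifibrant_lifts C K f"
    and "zmap (la A') (lp A') (la A) (lp A) \<kappa>" "\<kappa> 0 = f"
  shows "wfam A n \<cdot> \<kappa> n \<approx> \<phi> n \<cdot> wfam A' n"
proof (rule zmap_cong[OF lzseq bif_zseq lcofs[OF assms(2)] bb_fibs])
  show "zmap (la A') (lp A') (ba A) (bb A) (\<lambda>n. wfam A n \<cdot> \<kappa> n)"
    by (rule zmap_comp[OF lzseq lzseq bif_zseq assms(6) wfam(1)[OF assms(1)]])
  show "zmap (la A') (lp A') (ba A) (bb A) (\<lambda>n. \<phi> n \<cdot> wfam A' n)"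
    by (rule zmap_comp[OF lzseq bif_zseq bif_zseq wfam(1)[OF assms(2)] assms(4)])
  show "wfam A 0 \<cdot> \<kappa> 0 \<approx> \<phi> 0 \<cdot> wfam A' 0"
    using unit_map_natural[OF assms(2) wfam(2)[OF assms(1)] wfam(2)[OF assms(2)] assms(3,5)]
      assms(7) stabeq_sym by simp
qed

lemma yfam_natural:
  assumes "B \<in> fibs M" "B' \<in> fibs M" "g \<in> Mor C B B'" "zmap (ba B) (bb B) (ba B') (bb B') \<gamma>"
    "\<gamma> 0 \<in> bifibrant_lifts C K g"
    and "zmap (ra B) (rp B) (ra B') (rp B') \<kappa>" "\<kappa> 0 = g"
  shows "\<kappa> n \<cdot> yfam B n \<approx> yfam B' n \<cdot> \<gamma> n"
proof (rule zmap_cong[OF bif_zseq rzseq bb_cofs rfibs[OF assms(2)]])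
  show "zmap (ba B) (bb B) (ra B') (rp B') (\<lambda>n. \<kappa> n \<cdot> yfam B n)"
    by (rule zmap_comp[OF bif_zseq rzseq rzseq yfam(1)[OF assms(1)] assms(6)])
  show "zmap (ba B) (bb B) (ra B') (rp B') (\<lambda>n. yfam B' n \<cdot> \<gamma> n)"
    by (rule zmap_comp[OF bif_zseq bif_zseq rzseq assms(4) yfam(1)[OF assms(2)]])
  show "\<kappa> 0 \<cdot> yfam B 0 \<approx> yfam B' 0 \<cdot> \<gamma> 0"
    using counit_map_natural[OF assms(2) yfam(2)[OF assms(1)] yfam(2)[OF assms(2)] assms(3,5)]
      assms(7) stabeq_sym by simp
qed

text \<open>Cofibrancy evaluates \<open>Ho_arr\<close> on \<open>f\<close> and fibrancy evaluates it
  on \<open>g\<close>; \<open>Omega_map_class\<close> passes from index 0 to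
  \<open>n\<close>.\<close>

lemma Ho_Omega_map_class:
  assumes "A \<in> cofs M" "A' \<in> cofs M" "B \<in> fibs M" "B' \<in> fibs M" and f: "f \<in> Mor C A' A"
    and g: "g \<in> Mor C B B'"
    and phi: "zmap (ba A') (bb A') (ba A) (bb A) \<phi>" "\<phi> 0 \<in> bifibrant_lifts C K f"
      and g'': "g'' \<in> bifibrant_lifts C K g"
    and h: "h \<in> Mor C (RQ (Om n A)) (RQ B)"
  shows "Ho_Omega_map C M K s l n f g (stable_class C M (RQ (Om n A)) (RQ B) h) =
    stable_class C M (RQ (Om n A')) (RQ B') (g'' \<cdot> (h \<cdot> \<phi> n))"
proof -
  note [simp] = MorD[OF f] MorD[OF g]
  have gm: "g'' \<in> Mor C (RQ B) (RQ B')" using bifibrant_lifts_Mor[OF g g''] .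
  note pm = zmap_bb_Mor[OF phi(1), of n]
  have hp: "h \<cdot> \<phi> n \<in> Mor C (RQ (Om n A')) (RQ B)" using cmp_Mor[OF pm h] .
  have "Omega_map C M K s l n A' A (Ho_arr C M K f) =
      stable_class C M (RQ (Om n A')) (RQ (Om n A)) (\<phi> n)"
    unfolding Ho_arr_cofs[OF assms(2,1) f phi(2)] by (rule Omega_map_class[OF phi(1)])
  then show ?thesis
    by (simp add: Ho_Omega_map_def Let_def Ho_comp_class[OF h pm] Ho_arr_fibs[OF assms(4,3) g g'']
      Ho_comp_class[OF gm hp])
qed

lemma Ho_Sigma_map_class:
  assumes "A \<in> cofs M" "A' \<in> cofs M" "B \<in> fibs M" "B' \<in> fibs M" and f: "f \<in> Mor C A' A"
    and g: "g \<in> Mor C B B'"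
    and gam: "zmap (ba B) (bb B) (ba B') (bb B') \<gamma>" "\<gamma> 0 \<in> bifibrant_lifts C K g"
      and f'': "f'' \<in> bifibrant_lifts C K f"
    and h: "h \<in> Mor C (RQ A) (RQ (Om (- n) B))"
  shows "Ho_Sigma_map C M K s l n f g (stable_class C M (RQ A) (RQ (Om (- n) B)) h) =
    stable_class C M (RQ A') (RQ (Om (- n) B')) (\<gamma> (- n) \<cdot> (h \<cdot> f''))"
proof -
  note [simp] = MorD[OF f] MorD[OF g]
  have fm: "f'' \<in> Mor C (RQ A') (RQ A)" using bifibrant_lifts_Mor[OF f f''] .
  note gm = zmap_bb_Mor[OF gam(1), of "- n"]
  have hf: "h \<cdot> f'' \<in> Mor C (RQ A') (RQ (Om (- n) B))" using cmp_Mor[OF fm h] .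
  have O: "Sigma_ob C s l n = Omega_ob C s l (- n)"
    "Sigma_map C M K s l n = Omega_map C M K s l (- n)"
    by (simp_all add: Omega_ob_def Omega_map_def fun_eq_iff)
  have "Omega_map C M K s l (- n) B B' (Ho_arr C M K g) =
      stable_class C M (RQ (Om (- n) B)) (RQ (Om (- n) B')) (\<gamma> (- n))"
    unfolding Ho_arr_fibs[OF assms(4,3) g gam(2)] by (rule Omega_map_class[OF gam(1)])
  then show ?thesis
    by (simp add: Ho_Sigma_map_def Let_def O Ho_comp_class[OF h fm] Ho_arr_cofs[OF assms(2,1) f f'']
      Ho_comp_class[OF gm hf])
qed

text \<open>Every chain lift and every representative gives the cocycle class that sandwiching
  attaches to \<open>g'' \<cdot> (h \<cdot> \<phi> n)\<close>: naturality of the counit moves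
  \<open>g\<close> inwards, naturality of \<open>wfam\<close> moves the syzygy map inwards.\<close>

lemma lExt_map_class:
  assumes A: "A \<in> cofs M" "A' \<in> cofs M" and B: "B \<in> fibs M" "B' \<in> fibs M" and f: "f \<in> Mor C A' A"
    and g: "g \<in> Mor C B B'"
    and phi: "zmap (ba A') (bb A') (ba A) (bb A) \<phi>" "\<phi> 0 \<in> bifibrant_lifts C K f"
      and g'': "g'' \<in> bifibrant_lifts C K g"
    and h: "h \<in> Mor C (RQ (Om n A)) (RQ B)" and z: "z \<approx> yfam B 0 \<cdot> (h \<cdot> wfam A n)"
  shows "lExt_map C P n f g (lbd n A B #>\<^bsub>lgrp n A B\<^esub> (z \<cdot> lp A n)) =
    lbd n A' B' #>\<^bsub>lgrp n A' B'\<^esub> ((yfam B' 0 \<cdot> ((g'' \<cdot> (h \<cdot> \<phi> n)) \<cdot> wfam A' n)) \<cdot> lp A' n)"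
proof -
  have gm: "g'' \<in> Mor C (RQ B) (RQ B')" using bifibrant_lifts_Mor[OF g g''] .
  note [simp] = MorD[OF f] MorD[OF g] MorD[OF gm] MorD[OF zmap_bb_Mor[OF phi(1)]] MorD[OF h]
    wfam_arr[OF A(1)] wfam_arr[OF A(2)] yfam_arr[OF B(1)] yfam_arr[OF B(2)]
  have zm [simp]: "z \<in> arrs C" "src C z = tgt C (lp A n)" "tgt C z = B" using stabeqD[OF z]
    by simp_all
  let ?t = "yfam B' 0 \<cdot> ((g'' \<cdot> (h \<cdot> \<phi> n)) \<cdot> wfam A' n)"
  have eq: "coclass (lcochains C (P A') B') (ldiff C (P A')) n (g \<cdot> y \<cdot> u n) =
      lbd n A' B' #>\<^bsub>lgrp n A' B'\<^esub> (?t \<cdot> lp A' n)"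
    if u: "chain_lift C (P A') (P A) f u" and y: "y \<in> lbd n A B #>\<^bsub>lgrp n A B\<^esub> (z \<cdot> lp A n)" for u y
  proof -
    obtain \<kappa> where k: "zmap (la A') (lp A') (la A) (lp A) \<kappa>" "\<kappa> 0 = f"
      and ku: "\<And>n. lp A n \<cdot> u n = \<kappa> n \<cdot> lp A' n"
      by (rule chain_lift_zmap[OF lfac lfac u f]) blast
    note [simp] = MorD[OF zmapD(2)[OF k(1)]]
    have [simp]: "u n \<in> arrs C" "src C (u n) = ob (P A') n" "tgt C (u n) = ob (P A) n"
      using u by (auto simp: chain_lift_def Mor_def)
    \<comment> \<open>Another representative differs by a coboundary, that is, by a null map on the
      syzygy.\<close>
    obtain c where c: "c \<in> core_maps C M (tgt C (lp A n)) B" and yc: "y = c \<cdot> lp A n +. z \<cdot> lp A n"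
      using y unfolding lbd[OF A(1) B(1)] by (auto simp: r_coset_def lgrp)
    note [simp] = MorD[OF core_maps_Mor[OF c]]
    have "c +. z \<approx> z" using c by (simp add: stabeq_def)
    also note z
    finally have 1: "c +. z \<approx> yfam B 0 \<cdot> (h \<cdot> wfam A n)" .
    have "(c +. z) \<cdot> \<kappa> n \<approx> (yfam B 0 \<cdot> (h \<cdot> wfam A n)) \<cdot> \<kappa> n"
      by (rule stabeq_cmp_right[OF 1]) simp_all
    then have "g \<cdot> ((c +. z) \<cdot> \<kappa> n) \<approx> g \<cdot> ((yfam B 0 \<cdot> (h \<cdot> wfam A n)) \<cdot> \<kappa> n)"
      by (rule stabeq_cmp_left) simp_all
    also have "g \<cdot> ((yfam B 0 \<cdot> (h \<cdot> wfam A n)) \<cdot> \<kappa> n) = (g \<cdot> yfam B 0) \<cdot> (h \<cdot> (wfam A n \<cdot> \<kappa> n))"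
      by simp
    also have "\<dots> \<approx> (yfam B' 0 \<cdot> g'') \<cdot> (h \<cdot> (\<phi> n \<cdot> wfam A' n))"
    proof (rule stabeq_cmp)
      show "g \<cdot> yfam B 0 \<approx> yfam B' 0 \<cdot> g''"
        by (rule stabeq_sym[OF counit_map_natural[OF B(2) yfam(2)[OF B(1)] yfam(2)[OF B(2)] g g'']])
      show "h \<cdot> (wfam A n \<cdot> \<kappa> n) \<approx> h \<cdot> (\<phi> n \<cdot> wfam A' n)"
        by (rule stabeq_cmp_left[OF wfam_natural[OF A f phi k]]) simp_all
    qed simp
    also have "(yfam B' 0 \<cdot> g'') \<cdot> (h \<cdot> (\<phi> n \<cdot> wfam A' n)) = ?t" by simp
    finally have 2: "g \<cdot> ((c +. z) \<cdot> \<kappa> n) \<approx> ?t" .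
    have e: "g \<cdot> y \<cdot> u n = (g \<cdot> ((c +. z) \<cdot> \<kappa> n)) \<cdot> lp A' n" unfolding yc by (simp add: ku)
    have "lbd n A' B' #>\<^bsub>MorGrp C (ob (P A') n) B'\<^esub> ((g \<cdot> ((c +. z) \<cdot> \<kappa> n)) \<cdot> lp A' n) =
        lbd n A' B' #>\<^bsub>MorGrp C (ob (P A') n) B'\<^esub> (?t \<cdot> lp A' n)"
    proof (rule coset_shift[OF lbd_subgroup[OF A(2) B(2)]])
      have "(g \<cdot> ((c +. z) \<cdot> \<kappa> n) -. ?t) \<cdot> lp A' n \<in> lbd n A' B'"
        unfolding lbd[OF A(2) B(2)] using 2 by (intro imageI) (simp add: stabeq_def)
      then show "(g \<cdot> ((c +. z) \<cdot> \<kappa> n)) \<cdot> lp A' n -. ?t \<cdot> lp A' n \<in> lbd n A' B'" by simp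
    qed (simp_all add: Mor_def)
    then show ?thesis unfolding e coclass_def lgrp r_coset_carrier_update
      by (simp add: lcochains_def lbd_def)
  qed
  obtain u where u: "chain_lift C (P A') (P A) f u" using chain_lift_exists[OF lfac lfac f] by blast
  have ne: "z \<cdot> lp A n \<in> lbd n A B #>\<^bsub>lgrp n A B\<^esub> (z \<cdot> lp A n)"
    unfolding lgrp r_coset_carrier_update
    by (rule group.rcos_self[OF grp(2) _ lbd_subgroup[OF A(1) B(1)]]) (simp add: Mor_def)
  have "(\<Union>u\<in>{u. chain_lift C (P A') (P A) f u}. \<Union>y\<in>lbd n A B #>\<^bsub>lgrp n A B\<^esub> (z \<cdot> lp A n).
      coclass (lcochains C (P A') B') (ldiff C (P A')) n (g \<cdot> y \<cdot> u n))
        = lbd n A' B' #>\<^bsub>lgrp n A' B'\<^esub> (?t \<cdot> lp A' n)"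
    by (rule UN_constant_eq, use u in blast, rule UN_constant_eq, use ne in blast, rule eq) simp_all
  then show ?thesis by (simp add: lExt_map_def)
qed

text \<open>Mirror image of the left case: now naturality of the unit is used at index 0, and that
  of the prolonged counit at index \<open>- n\<close>.\<close>

lemma rExt_map_class:
  assumes A: "A \<in> cofs M" "A' \<in> cofs M" and B: "B \<in> fibs M" "B' \<in> fibs M" and f: "f \<in> Mor C A' A"
    and g: "g \<in> Mor C B B'"
    and gam: "zmap (ba B) (bb B) (ba B') (bb B') \<gamma>" "\<gamma> 0 \<in> bifibrant_lifts C K g"
      and f'': "f'' \<in> bifibrant_lifts C K f"
    and h: "h \<in> Mor C (RQ A) (RQ (Om (- n) B))" and z: "z \<approx> yfam B (- n) \<cdot> (h \<cdot> wfam A 0)"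
  shows "rExt_map C T n f g (rbd n A B #>\<^bsub>rgrp n A B\<^esub> (rk B (- n) \<cdot> z)) =
    rbd n A' B' #>\<^bsub>rgrp n A' B'\<^esub> (rk B' (- n) \<cdot> (yfam B' (- n) \<cdot> ((\<gamma> (- n) \<cdot> (h \<cdot> f''))
      \<cdot> wfam A' 0)))"
proof -
  have fm: "f'' \<in> Mor C (RQ A') (RQ A)" using bifibrant_lifts_Mor[OF f f''] .
  note [simp] = MorD[OF f] MorD[OF g] MorD[OF fm] MorD[OF zmap_bb_Mor[OF gam(1)]] MorD[OF h]
    wfam_arr[OF A(1)] wfam_arr[OF A(2)] yfam_arr[OF B(1)] yfam_arr[OF B(2)]
  have zm [simp]: "z \<in> arrs C" "src C z = A" "tgt C z = tgt C (rp B (- n))" using stabeqD[OF z]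
    by simp_all
  let ?t = "yfam B' (- n) \<cdot> ((\<gamma> (- n) \<cdot> (h \<cdot> f'')) \<cdot> wfam A' 0)"
  have eq: "coclass (rcochains C A' (T B')) (rdiff C (T B')) n (u (- n - 1) \<cdot> y \<cdot> f) =
      rbd n A' B' #>\<^bsub>rgrp n A' B'\<^esub> (rk B' (- n) \<cdot> ?t)"
    if u: "chain_lift C (reindex (T B)) (reindex (T B')) g u"
      and y: "y \<in> rbd n A B #>\<^bsub>rgrp n A B\<^esub> (rk B (- n) \<cdot> z)" for u y
  proof -
    obtain \<kappa> where k: "zmap (ra B) (rp B) (ra B') (rp B') \<kappa>" "\<kappa> 0 = g"
      and ku: "\<And>n. u (n - 1) \<cdot> rk B n = rk B' n \<cdot> \<kappa> n"
      by (rule chain_lift_zmap[OF rfac rfac u g]) blast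
    note [simp] = MorD[OF zmapD(2)[OF k(1)]]
    have [simp]: "u (- n - 1) \<in> arrs C" "src C (u (- n - 1)) = ob (T B) n"
      "tgt C (u (- n - 1)) = ob (T B') n"
      using u by (auto simp: chain_lift_def Mor_def reindex_def)
    obtain c where c: "c \<in> core_maps C M A (tgt C (rp B (- n)))"
      and yc: "y = rk B (- n) \<cdot> c +. rk B (- n) \<cdot> z"
      using y unfolding rbd[OF A(1) B(1)] by (auto simp: r_coset_def rgrp)
    note [simp] = MorD[OF core_maps_Mor[OF c]]
    have "c +. z \<approx> z" using c by (simp add: stabeq_def)
    also note z
    finally have 1: "c +. z \<approx> yfam B (- n) \<cdot> (h \<cdot> wfam A 0)" .
    have "\<kappa> (- n) \<cdot> (c +. z) \<approx> \<kappa> (- n) \<cdot> (yfam B (- n) \<cdot> (h \<cdot> wfam A 0))"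
      by (rule stabeq_cmp_left[OF 1]) simp_all
    then have "(\<kappa> (- n) \<cdot> (c +. z)) \<cdot> f \<approx> (\<kappa> (- n) \<cdot> (yfam B (- n) \<cdot> (h \<cdot> wfam A 0))) \<cdot> f"
      by (rule stabeq_cmp_right) simp_all
    also have "(\<kappa> (- n) \<cdot> (yfam B (- n) \<cdot> (h \<cdot> wfam A 0))) \<cdot> f =
        (\<kappa> (- n) \<cdot> yfam B (- n)) \<cdot> (h \<cdot> (wfam A 0 \<cdot> f))" by simp
    also have "\<dots> \<approx> (yfam B' (- n) \<cdot> \<gamma> (- n)) \<cdot> (h \<cdot> (f'' \<cdot> wfam A' 0))"
    proof (rule stabeq_cmp)
      show "\<kappa> (- n) \<cdot> yfam B (- n) \<approx> yfam B' (- n) \<cdot> \<gamma> (- n)" by (rule yfam_natural[OF B g gam k])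
      show "h \<cdot> (wfam A 0 \<cdot> f) \<approx> h \<cdot> (f'' \<cdot> wfam A' 0)"
        by (rule stabeq_cmp_left[OF stabeq_sym[OF unit_map_natural[OF A(2) wfam(2)[OF A(1)]
          wfam(2)[OF A(2)] f f'']]]) simp_all
    qed simp
    also have "(yfam B' (- n) \<cdot> \<gamma> (- n)) \<cdot> (h \<cdot> (f'' \<cdot> wfam A' 0)) = ?t" by simp
    finally have 2: "(\<kappa> (- n) \<cdot> (c +. z)) \<cdot> f \<approx> ?t" .
    have e: "u (- n - 1) \<cdot> y \<cdot> f = rk B' (- n) \<cdot> ((\<kappa> (- n) \<cdot> (c +. z)) \<cdot> f)" unfolding yc
      by (simp add: reassoc[OF ku])
    have "rbd n A' B' #>\<^bsub>MorGrp C A' (ob (T B') n)\<^esub> (rk B' (- n) \<cdot> ((\<kappa> (- n) \<cdot> (c +. z)) \<cdot> f)) =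
        rbd n A' B' #>\<^bsub>MorGrp C A' (ob (T B') n)\<^esub> (rk B' (- n) \<cdot> ?t)"
    proof (rule coset_shift[OF rbd_subgroup[OF A(2) B(2)]])
      have "rk B' (- n) \<cdot> ((\<kappa> (- n) \<cdot> (c +. z)) \<cdot> f -. ?t) \<in> rbd n A' B'"
        unfolding rbd[OF A(2) B(2)] using 2 by (intro imageI) (simp add: stabeq_def)
      then show "rk B' (- n) \<cdot> ((\<kappa> (- n) \<cdot> (c +. z)) \<cdot> f) -. rk B' (- n) \<cdot> ?t \<in> rbd n A' B'" by simp
    qed (simp_all add: Mor_def)
    then show ?thesis unfolding e coclass_def rgrp r_coset_carrier_update
      by (simp add: rcochains_def rbd_def)
  qed
  obtain u where u: "chain_lift C (reindex (T B)) (reindex (T B')) g u"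
    using chain_lift_exists[OF rfac rfac g] by blast
  have ne: "rk B (- n) \<cdot> z \<in> rbd n A B #>\<^bsub>rgrp n A B\<^esub> (rk B (- n) \<cdot> z)"
    unfolding rgrp r_coset_carrier_update
    by (rule group.rcos_self[OF grp(2) _ rbd_subgroup[OF A(1) B(1)]]) (simp add: Mor_def)
  have "(\<Union>u\<in>{u. chain_lift C (reindex (T B)) (reindex (T B')) g u}. \<Union>y\<in>rbd n A B #>\<^bsub>rgrp n A B\<^esub> (rk
      B (- n) \<cdot> z).
      coclass (rcochains C A' (T B')) (rdiff C (T B')) n (u (- n - 1) \<cdot> y \<cdot> f))
        = rbd n A' B' #>\<^bsub>rgrp n A' B'\<^esub> (rk B' (- n) \<cdot> ?t)"
    by (rule UN_constant_eq, use u in blast, rule UN_constant_eq, use ne in blast, rule eq) simp_all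
  then show ?thesis by (simp add: rExt_map_def)
qed

lemma lExt_iso_Ho_Omega:
  "\<exists>\<tau>. natural_iso C M (lExt C P n) (lExt_map C P n) (\<lambda>A B. Ho C M K (Om n A) B) (Ho_Omega_map C M K
      s l n) \<tau>"
proof (rule natural_iso_of_coset_rel[OF lrel_coset_rel])
  show "lExt C P n A B = lgrp n A B Mod lbd n A B" for A B
    by (simp add: lExt_def cohomology_def lgrp_def lbd_def)
  show "Ho C M K (Om n A) B = MorGrp C (RQ (Om n A)) (RQ B) Mod core_maps C M (RQ (Om n A)) (RQ B)"
    for A B
    by (simp add: Ho_def stable_Mor_def)
  fix A A' B B' f g x h
  assume *: "A \<in> cofs M" "A' \<in> cofs M" "B \<in> fibs M" "B' \<in> fibs M" "f \<in> Mor C A' A" "g \<in> Mor C B B'"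
    and "lrel n A B x h"
  then obtain z where h: "h \<in> Mor C (RQ (Om n A)) (RQ B)"
    and z: "x = z \<cdot> lp A n" "z \<approx> yfam B 0 \<cdot> (h \<cdot> wfam A n)"
    unfolding lrel_def by blast
  obtain \<phi> where phi: "zmap (ba A') (bb A') (ba A) (bb A) \<phi>" "\<phi> 0 \<in> bifibrant_lifts C K f"
    using lift_family[OF *(5)] by blast
  obtain g'' where g'': "g'' \<in> bifibrant_lifts C K g" using bifibrant_lift_exists[OF *(6)] by blast
  note m = cmp_Mor[OF cmp_Mor[OF zmap_bb_Mor[OF phi(1), of n] h] bifibrant_lifts_Mor[OF *(6) g'']]
  have "lrel n A' B' ((yfam B' 0 \<cdot> ((g'' \<cdot> (h \<cdot> \<phi> n)) \<cdot> wfam A' n)) \<cdot> lp A' n) (g'' \<cdot> (h \<cdot> \<phi> n))"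
    unfolding lrel_def
    by (intro conjI exI[of _ "yfam B' 0 \<cdot> ((g'' \<cdot> (h \<cdot> \<phi> n)) \<cdot> wfam A' n)"] m refl stabeq_refl)
      (use MorD[OF m] wfam_arr[OF *(2)] yfam_arr[OF *(4)] in simp)
  with lExt_map_class[OF *(1-6) phi g'' h z(2)] Ho_Omega_map_class[OF *(1-6) phi g'' h]
  show "\<exists>x' h'. lrel n A' B' x' h' \<and>
      lExt_map C P n f g (lbd n A B #>\<^bsub>lgrp n A B\<^esub> x) = lbd n A' B' #>\<^bsub>lgrp n A' B'\<^esub> x' \<and>
     Ho_Omega_map C M K s l n f g (core_maps C M (RQ (Om n A)) (RQ B) #>\<^bsub>MorGrp C (RQ (Om n A))
       (RQ B)\<^esub> h) =
       core_maps C M (RQ (Om n A')) (RQ B') #>\<^bsub>MorGrp C (RQ (Om n A')) (RQ B')\<^esub> h'"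
    unfolding z(1) stable_class_def by blast
qed

lemma Sigma_Omega: "Sigma_ob C s l n B = Om (- n) B"
  by (simp add: Omega_ob_def)

lemma Ho_Sigma_quotient: "Ho C M K A (Sigma_ob C s l n B) =
    MorGrp C (RQ A) (RQ (Om (- n) B)) Mod core_maps C M (RQ A) (RQ (Om (- n) B))"
  unfolding Sigma_Omega by (simp add: Ho_def stable_Mor_def)

lemma Ho_Sigma_iso_rExt:
  "\<exists>\<tau>. natural_iso C M (\<lambda>A B. Ho C M K A (Sigma_ob C s l n B)) (Ho_Sigma_map C M K s l n) (rExt C T
      n) (rExt_map C T n) \<tau>"
proof (rule natural_iso_of_coset_rel[OF rrel_coset_rel])
  show "rExt C T n A B = rgrp n A B Mod rbd n A B" for A B
    by (simp add: rExt_def cohomology_def rgrp_def rbd_def)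
  show "Ho C M K A (Sigma_ob C s l n B) =
      MorGrp C (RQ A) (RQ (Om (- n) B)) Mod core_maps C M (RQ A) (RQ (Om (- n) B))" for A B
    by (rule Ho_Sigma_quotient)
  fix A A' B B' f g h x
  assume *: "A \<in> cofs M" "A' \<in> cofs M" "B \<in> fibs M" "B' \<in> fibs M" "f \<in> Mor C A' A" "g \<in> Mor C B B'"
    and "rrel n A B h x"
  then obtain z where h: "h \<in> Mor C (RQ A) (RQ (Om (- n) B))"
    and z: "x = rk B (- n) \<cdot> z" "z \<approx> yfam B (- n) \<cdot> (h \<cdot> wfam A 0)"
    unfolding rrel_def by blast
  obtain \<gamma> where gam: "zmap (ba B) (bb B) (ba B') (bb B') \<gamma>" "\<gamma> 0 \<in> bifibrant_lifts C K g"
    using lift_family[OF *(6)] by blast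
  obtain f'' where f'': "f'' \<in> bifibrant_lifts C K f" using bifibrant_lift_exists[OF *(5)] by blast
  note m = cmp_Mor[OF cmp_Mor[OF bifibrant_lifts_Mor[OF *(5) f''] h] zmap_bb_Mor[OF gam(1), of
    "- n"]]
  have "rrel n A' B' (\<gamma> (- n) \<cdot> (h \<cdot> f'')) (rk B' (- n) \<cdot> (yfam B' (- n) \<cdot> ((\<gamma> (- n) \<cdot> (h \<cdot> f'')) \<cdot>
      wfam A' 0)))"
    unfolding rrel_def
    by (intro conjI exI[of _ "yfam B' (- n) \<cdot> ((\<gamma> (- n) \<cdot> (h \<cdot> f'')) \<cdot> wfam A' 0)"]
      m refl stabeq_refl)
      (use MorD[OF m] wfam_arr[OF *(2)] yfam_arr[OF *(4)] in simp)
  with rExt_map_class[OF *(1-6) gam f'' h z(2)] Ho_Sigma_map_class[OF *(1-6) gam f'' h]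
  show "\<exists>h' x'. rrel n A' B' h' x' \<and>
     Ho_Sigma_map C M K s l n f g (core_maps C M (RQ A) (RQ (Om (- n) B)) #>\<^bsub>MorGrp C (RQ A)
       (RQ (Om (- n) B))\<^esub> h) =
       core_maps C M (RQ A') (RQ (Om (- n) B')) #>\<^bsub>MorGrp C (RQ A') (RQ (Om (- n) B'))\<^esub> h' \<and>
     rExt_map C T n f g (rbd n A B #>\<^bsub>rgrp n A B\<^esub> x) = rbd n A' B' #>\<^bsub>rgrp n A' B'\<^esub> x'"
    unfolding z(1) stable_class_def by blast
qed

lemma Ho_Omega_iso_Ho_Sigma:
  "\<exists>\<tau>. natural_iso C M (\<lambda>A B. Ho C M K (Om n A) B) (Ho_Omega_map C M K s l n)
     (\<lambda>A B. Ho C M K A (Sigma_ob C s l n B)) (Ho_Sigma_map C M K s l n) \<tau>"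
proof (rule natural_iso_of_coset_rel[OF mrel_coset_rel])
  show "Ho C M K (Om n A) B = MorGrp C (RQ (Om n A)) (RQ B) Mod core_maps C M (RQ (Om n A)) (RQ B)"
    for A B
    by (simp add: Ho_def stable_Mor_def)
  show "Ho C M K A (Sigma_ob C s l n B) =
      MorGrp C (RQ A) (RQ (Om (- n) B)) Mod core_maps C M (RQ A) (RQ (Om (- n) B))" for A B
    by (rule Ho_Sigma_quotient)
  fix A A' B B' f g h h'
  assume *: "A \<in> cofs M" "A' \<in> cofs M" "B \<in> fibs M" "B' \<in> fibs M" "f \<in> Mor C A' A" "g \<in> Mor C B B'"
    and "mrel n A B h h'"
  then obtain \<psi> where psi: "zmap (\<lambda>i. ba A (i + n)) (\<lambda>i. bb A (i + n)) (ba B) (bb B) \<psi>"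
    and h: "h \<approx> \<psi> 0" "h' \<approx> \<psi> (- n)"
    unfolding mrel_def by blast
  have pm: "\<psi> 0 \<in> Mor C (RQ (Om n A)) (RQ B)" "\<psi> (- n) \<in> Mor C (RQ A) (RQ (Om (- n) B))"
    using zmapD(2)[OF psi, of 0] zmapD(2)[OF psi, of "- n"] by simp_all
  note [simp] = MorD[OF pm(1)] MorD[OF pm(2)]
  have hm: "h \<in> Mor C (RQ (Om n A)) (RQ B)" "h' \<in> Mor C (RQ A) (RQ (Om (- n) B))"
    using stabeqD[OF h(1)] stabeqD[OF h(2)] by (simp_all add: Mor_def)
  obtain \<phi> where phi: "zmap (ba A') (bb A') (ba A) (bb A) \<phi>" "\<phi> 0 \<in> bifibrant_lifts C K f"
    using lift_family[OF *(5)] by blast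
  obtain \<gamma> where gam: "zmap (ba B) (bb B) (ba B') (bb B') \<gamma>" "\<gamma> 0 \<in> bifibrant_lifts C K g"
    using lift_family[OF *(6)] by blast
  have fam [simp]: "\<phi> i \<in> arrs C" "src C (\<phi> i) = RQ (Om i A')" "tgt C (\<phi> i) = RQ (Om i A)"
    "\<gamma> i \<in> arrs C" "src C (\<gamma> i) = RQ (Om i B)" "tgt C (\<gamma> i) = RQ (Om i B')" for i
    using MorD[OF zmap_bb_Mor[OF phi(1)]] MorD[OF zmap_bb_Mor[OF gam(1)]] by blast+
  \<comment> \<open>\<open>\<phi>\<close> is shifted by \<open>n\<close> to fit the source of
    \<open>\<psi>\<close>. At index 0 the composite involves \<open>\<phi> n\<close> and
    \<open>\<gamma> 0\<close>, as does the action through \<open>Omega_map\<close>; at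
    \<open>- n\<close> it involves \<open>\<phi> 0\<close> and \<open>\<gamma> (- n)\<close>, as
    does the action through \<open>Sigma_map\<close>.\<close>
  have "zmap (\<lambda>i. ba A' (i + n)) (\<lambda>i. bb A' (i + n)) (ba B') (bb B') (\<lambda>i. \<gamma> i \<cdot> (\<psi> i \<cdot> \<phi> (i + n)))"
    by (rule zmap_comp[OF _ bif_zseq bif_zseq zmap_comp[OF _ _ bif_zseq zmap_shift[OF phi(1)] psi]
      gam(1)])
      (rule zseq_shift[OF bif_zseq])+
  moreover have "\<gamma> 0 \<cdot> (h \<cdot> \<phi> n) \<approx> \<gamma> 0 \<cdot> (\<psi> 0 \<cdot> \<phi> n)"
    by (rule stabeq_cmp_left[OF stabeq_cmp_right[OF h(1)]]) simp_all
  moreover have "\<gamma> (- n) \<cdot> (h' \<cdot> \<phi> 0) \<approx> \<gamma> (- n) \<cdot> (\<psi> (- n) \<cdot> \<phi> 0)"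
    by (rule stabeq_cmp_left[OF stabeq_cmp_right[OF h(2)]]) simp_all
  ultimately have "mrel n A' B' (\<gamma> 0 \<cdot> (h \<cdot> \<phi> n)) (\<gamma> (- n) \<cdot> (h' \<cdot> \<phi> 0))"
    unfolding mrel_def by (intro exI[of _ "\<lambda>i. \<gamma> i \<cdot> (\<psi> i \<cdot> \<phi> (i + n))"]) simp
  with Ho_Omega_map_class[OF *(1-6) phi gam(2) hm(1)] Ho_Sigma_map_class[OF *(1-6) gam phi(2) hm(2)]
  show "\<exists>x' y'. mrel n A' B' x' y' \<and>
     Ho_Omega_map C M K s l n f g (core_maps C M (RQ (Om n A)) (RQ B) #>\<^bsub>MorGrp C (RQ (Om n A))
       (RQ B)\<^esub> h) =
       core_maps C M (RQ (Om n A')) (RQ B') #>\<^bsub>MorGrp C (RQ (Om n A')) (RQ B')\<^esub> x' \<and>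
     Ho_Sigma_map C M K s l n f g (core_maps C M (RQ A) (RQ (Om (- n) B)) #>\<^bsub>MorGrp C (RQ A)
       (RQ (Om (- n) B))\<^esub> h') =
       core_maps C M (RQ A') (RQ (Om (- n) B')) #>\<^bsub>MorGrp C (RQ A') (RQ (Om (- n) B'))\<^esub> y'"
    unfolding stable_class_def by blast
qed

end

theorem theorem6p3:
  fixes C :: "('o, 'a) cat" and M :: "'o triple" and K :: "('o, 'a) repl"
    and s l :: "'o \<Rightarrow> 'a \<times> 'a" and P T :: "'o \<Rightarrow> ('o, 'a) zcomplex" and n :: int
  assumes "abelian_category C"
    and "hereditary_model_structure C M"
    and "replacement_choice C M K"
    and "suspension_choice C M s"
    and "loop_choice C M l"
    and "\<And>A. M_resolution C M A (P A)"
    and "\<And>B. M_coresolution C M B (T B)"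
  shows "(\<exists>\<tau>. natural_iso C M
             (lExt C P n) (lExt_map C P n)
             (\<lambda>A B. Ho C M K (Omega_ob C s l n A) B) (Ho_Omega_map C M K s l n) \<tau>)
       \<and> (\<exists>\<tau>. natural_iso C M
             (\<lambda>A B. Ho C M K (Omega_ob C s l n A) B) (Ho_Omega_map C M K s l n)
             (\<lambda>A B. Ho C M K A (Sigma_ob C s l n B)) (Ho_Sigma_map C M K s l n) \<tau>)
       \<and> (\<exists>\<tau>. natural_iso C M
             (\<lambda>A B. Ho C M K A (Sigma_ob C s l n B)) (Ho_Sigma_map C M K s l n)
             (rExt C T n) (rExt_map C T n) \<tau>)"
proof -
  interpret model_ext C M K s l P T
    by (intro model_ext.intro model_loop.intro model_replacement.intro model_ext_axioms.intro
      model_loop_axioms.intro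
      model_replacement_axioms.intro hereditary_model_structure_model assms)
  show ?thesis
    by (intro conjI lExt_iso_Ho_Omega Ho_Omega_iso_Ho_Sigma Ho_Sigma_iso_rExt)
qed

end
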